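(* Let $\mathcal T$ be a triangulated category and $\mathcal X\subset\mathcal A$ subcategories of $\mathcal T$. The following are equivalent: (a) $\mathcal A$ is extension closed in $\mathcal T$ and $(\mathcal A,\mathcal A)$ forms an $\mathcal X$-mutation pair. (b) $\mathcal X$ is a functorially finite subcategory of $\mathcal A$ satisfying $(\mathcal X,\mathcal X[1])=0$, every $\mathcal X$-monomorphism of $\mathcal A$ has a cone in $\mathcal A$, every $\mathcal X$-epimorphism of $\mathcal A$ has a cocone in $\mathcal A$, and the subfactor category $\mathcal A/[\mathcal X]$ (with its pretriangulated structure $(\Omega,\Sigma,\triangle,\nabla)$ described in the context) forms a triangulated category.
   Context: Conventions. All categories are $k$-linear over a field $k$, Hom-finite, skeletally small and Krull-Schmidt. "Subcategory" means full subcategory closed under isomorphisms, (finite) direct sums and direct summands. The shift of $\mathcal T$ is $[1]$; "triangle" means distinguished triangle of $\mathcal T$. $(\mathcal U,\mathcal V)=0$ means $\mathcal T(U,V)=0$ for all $U\in\mathcal U$, $V\in\mathcal V$. $\mathcal A$ is extension closed if for every triangle $A_2\to B\to A_1\to A_2[1]$ with $A_1,A_2\in\mathcal A$ one has $B\in\mathcal A$. Mutation pairs (Iyama-Yoshino). For subcategories $\mathcal U,\mathcal V$ of $\mathcal T$, $\mathcal U*\mathcal V$ is the class of objects $W$ admitting a triangle $U\to W\to V\to U[1]$ with $U\in\mathcal U$, $V\in\mathcal V$; ${}^{\perp}\mathcal U=\{T:\mathcal T(T,\mathcal U)=0\}$ and $\mathcal U^{\perp}=\{T:\mathcal T(\mathcal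 U,T)=0\}$. Let $\mathcal X$ satisfy $(\mathcal X,\mathcal X[1])=0$ (this is part of the notion of $\mathcal X$-mutation pair). Put $\mu^{-1}(\mathcal U;\mathcal X)=(\mathcal X*\mathcal U[1])\cap{}^{\perp}(\mathcal X[1])$ and $\mu(\mathcal U;\mathcal X)=(\mathcal U[-1]*\mathcal X)\cap(\mathcal X[-1])^{\perp}$. A pair $(\mathcal U,\mathcal V)$ is an $\mathcal X$-mutation pair if $\mathcal X\subset\mathcal U\subset\mu(\mathcal V;\mathcal X)$ and $\mathcal X\subset\mathcal V\subset\mu^{-1}(\mathcal U;\mathcal X)$. Approximations. A left $\mathcal X$-approximation of $A\in\mathcal A$ is a morphism $A\to X_A$ with $X_A\in\mathcal X$ through which every morphism from $A$ to an object of $\mathcal X$ factors; right $\mathcal X$-approximations are dual. $\mathcal X$ is functorially finite in $\mathcal A$ if every object of $\mathcal A$ has both a left and a right $\mathcal X$-approximation. A morphism $f:A\to B$ is $\mathcal X$-monic if $\mathcal T(f,X):\mathcal T(B,X)\to\mathcal T(A,X)$ is surjective for all $X\in\mathcal X$, and $\mathcal X$-epic if $\mathcal T(X,f)$ is surjective for all $X\in\mathcal X$. "Every $\mathcal X$-monomorphism of $\mathcal A$ has a cone" means: for every $\mathcal X$-monic $f:A\to B$ with $A,B\in\mathcal A$, in the triangle $A\xrightarrow{f}B\to C\to A[1]$ one has $C\in\mathcal A$; "every $\mathcal X$-epimorphism has a cocone" means: for every $\mathcal X$-epic $f:B\to C$ with $B,C\in\mathcal A$, in the triangle $K\to B\xrightarrow{f}C\to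 K[1]$ one has $K\in\mathcal A$. Subfactor category. $\mathcal A/[\mathcal X]$ has the objects of $\mathcal A$ (written $\bar A$) and morphisms $\mathcal A(A,B)$ modulo those factoring through an object of $\mathcal X$; $\bar f$ is the class of $f$. Structure on $\mathcal A/[\mathcal X]$. Suspension $\Sigma$: for each $A\in\mathcal A$ fix a triangle $A\xrightarrow{\alpha_A}X_A\xrightarrow{\beta_A}\Sigma A\xrightarrow{\gamma_A}A[1]$ with $\alpha_A$ a left $\mathcal X$-approximation; $\Sigma\bar A=\overline{\Sigma A}$, and for $f:A\to A'$, $\Sigma\bar f=\bar h$ where $(f,g,h)$ is any morphism between the fixed triangles. $\nabla$ is the class of sextuples isomorphic to some $\bar A\xrightarrow{\bar f}\bar B\xrightarrow{\bar g}\bar C_f\xrightarrow{\bar h}\Sigma\bar A$, where $f:A\to B$ is in $\mathcal A$ and $B\xrightarrow{g}C_f\xrightarrow{h}\Sigma A\xrightarrow{f[1]\gamma_A}B[1]$ is a triangle. Loop functor $\Omega$, dually: for each $C\in\mathcal A$ fix a triangle $\Omega C\xrightarrow{a_C}Y_C\xrightarrow{b_C}C\xrightarrow{c_C}\Omega C[1]$ with $b_C$ a right $\mathcal X$-approximation, $\Omega$ on morphisms being induced by morphisms of triangles. $\triangle$ is the class of diagrams isomorphic to some $\Omega\bar C\xrightarrow{\bar h}\bar K_f\xrightarrow{\bar g}\bar B\xrightarrow{\bar f}\bar C$, where $f:B\to C$ is in $\mathcal A$ and $\Omega C\xrightarrow{h}K_f\xrightarrow{g}B\xrightarrow{c_Cf}\Omega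 C[1]$ is a triangle. Under the hypotheses on $\mathcal X$ and $\mathcal A$ in (b), $(\Sigma,\Omega)$ is an adjoint pair and $(\Omega,\Sigma,\triangle,\nabla)$ is a pretriangulation of $\mathcal A/[\mathcal X]$ in the sense of Beligiannis-Reiten (a right triangulation $\nabla$ and a left triangulation $\triangle$ satisfying compatibility axioms with respect to the adjunction). It "forms a triangulated category" if and only if $\Omega=\Sigma^{-1}$ (i.e. $\Sigma$ is an auto-equivalence with quasi-inverse $\Omega$ via the unit and counit of the adjunction) and $\triangle=\nabla$ (under the resulting identification $\Sigma\Omega C\cong C$ of diagrams $\Omega C\to A\to B\to C$ with sextuples $\Omega C\to A\to B\to\Sigma\Omega C$). *)

theory Defs
  imports Main
begin

text \<open>
  Small categories with object set \<open>obj\<close> and pairwise disjoint Hom-sets, so that a morphism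
  determines its domain and codomain. \<open>g \<cdot> f\<close> is "first \<open>f\<close>, then \<open>g\<close>".
\<close>

record ('o, 'm) category =
  obj :: "'o set"
  hom :: "'o \<Rightarrow> 'o \<Rightarrow> 'm set"
  comp :: "'m \<Rightarrow> 'm \<Rightarrow> 'm" (infixl "\<cdot>\<index>" 75)
  ident :: "'o \<Rightarrow> 'm"

record ('k, 'o, 'm) lin_category = "('o, 'm) category" +
  add :: "'m \<Rightarrow> 'm \<Rightarrow> 'm" (infixl "\<oplus>\<index>" 65)
  zero_mor :: "'o \<Rightarrow> 'o \<Rightarrow> 'm"
  scale :: "'k \<Rightarrow> 'm \<Rightarrow> 'm" (infixr "\<odot>\<index>" 70)

locale category =
  fixes C (structure)
  assumes hom_obj: "f \<in> hom C A B \<Longrightarrow> A \<in> obj C \<and> B \<in> obj C"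
    and hom_disjoint: "\<lbrakk>f \<in> hom C A B; f \<in> hom C A' B'\<rbrakk> \<Longrightarrow> A = A' \<and> B = B'"
    and ident_hom: "A \<in> obj C \<Longrightarrow> ident C A \<in> hom C A A"
    and comp_hom: "\<lbrakk>g \<in> hom C B D; f \<in> hom C A B\<rbrakk> \<Longrightarrow> g \<cdot> f \<in> hom C A D"
    and ident_left: "f \<in> hom C A B \<Longrightarrow> ident C B \<cdot> f = f"
    and ident_right: "f \<in> hom C A B \<Longrightarrow> f \<cdot> ident C A = f"
    and comp_assoc:
      "\<lbrakk>h \<in> hom C D E; g \<in> hom C B D; f \<in> hom C A B\<rbrakk> \<Longrightarrow> (h \<cdot> g) \<cdot> f = h \<cdot> (g \<cdot> f)"

locale lin_category = category C
  for C :: "('k::field, 'o, 'm, 'z) lin_category_scheme" (structure) +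
  assumes zero_hom: "\<lbrakk>A \<in> obj C; B \<in> obj C\<rbrakk> \<Longrightarrow> zero_mor C A B \<in> hom C A B"
    and add_hom: "\<lbrakk>f \<in> hom C A B; g \<in> hom C A B\<rbrakk> \<Longrightarrow> f \<oplus> g \<in> hom C A B"
    and scale_hom: "f \<in> hom C A B \<Longrightarrow> c \<odot> f \<in> hom C A B"
    and add_assoc: "\<lbrakk>f \<in> hom C A B; g \<in> hom C A B; h \<in> hom C A B\<rbrakk>
      \<Longrightarrow> (f \<oplus> g) \<oplus> h = f \<oplus> (g \<oplus> h)"
    and add_commute: "\<lbrakk>f \<in> hom C A B; g \<in> hom C A B\<rbrakk> \<Longrightarrow> f \<oplus> g = g \<oplus> f"
    and add_zero: "f \<in> hom C A B \<Longrightarrow> f \<oplus> zero_mor C A B = f"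
    and add_inverse: "f \<in> hom C A B \<Longrightarrow> \<exists>g \<in> hom C A B. f \<oplus> g = zero_mor C A B"
    and scale_add_right: "\<lbrakk>f \<in> hom C A B; g \<in> hom C A B\<rbrakk> \<Longrightarrow> c \<odot> (f \<oplus> g) = c \<odot> f \<oplus> c \<odot> g"
    and scale_add_left: "f \<in> hom C A B \<Longrightarrow> (c + d) \<odot> f = c \<odot> f \<oplus> d \<odot> f"
    and scale_scale: "f \<in> hom C A B \<Longrightarrow> (c * d) \<odot> f = c \<odot> (d \<odot> f)"
    and scale_one: "f \<in> hom C A B \<Longrightarrow> 1 \<odot> f = f"
    and comp_add_right: "\<lbrakk>g \<in> hom C B D; f \<in> hom C A B; f' \<in> hom C A B\<rbrakk>
      \<Longrightarrow> g \<cdot> (f \<oplus> f') = g \<cdot> f \<oplus> g \<cdot> f'"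
    and comp_add_left: "\<lbrakk>g \<in> hom C B D; g' \<in> hom C B D; f \<in> hom C A B\<rbrakk>
      \<Longrightarrow> (g \<oplus> g') \<cdot> f = g \<cdot> f \<oplus> g' \<cdot> f"
    and comp_scale_right: "\<lbrakk>g \<in> hom C B D; f \<in> hom C A B\<rbrakk> \<Longrightarrow> g \<cdot> (c \<odot> f) = c \<odot> (g \<cdot> f)"
    and comp_scale_left: "\<lbrakk>g \<in> hom C B D; f \<in> hom C A B\<rbrakk> \<Longrightarrow> (c \<odot> g) \<cdot> f = c \<odot> (g \<cdot> f)"

abbreviation neg :: "('k::field, 'o, 'm, 'z) lin_category_scheme \<Rightarrow> 'm \<Rightarrow> 'm" where
  "neg C f \<equiv> (- 1) \<odot>\<^bsub>C\<^esub> f"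

definition is_iso :: "('o, 'm, 'z) category_scheme \<Rightarrow> 'o \<Rightarrow> 'o \<Rightarrow> 'm \<Rightarrow> bool" where
  "is_iso C A B f \<longleftrightarrow> f \<in> hom C A B \<and>
     (\<exists>g \<in> hom C B A. g \<cdot>\<^bsub>C\<^esub> f = ident C A \<and> f \<cdot>\<^bsub>C\<^esub> g = ident C B)"

definition isomorphic :: "('o, 'm, 'z) category_scheme \<Rightarrow> 'o \<Rightarrow> 'o \<Rightarrow> bool" where
  "isomorphic C A B \<longleftrightarrow> (\<exists>f. is_iso C A B f)"

definition zero_object :: "('k, 'o, 'm, 'z) lin_category_scheme \<Rightarrow> 'o \<Rightarrow> bool" where
  "zero_object C Z \<longleftrightarrow> Z \<in> obj C \<and> ident C Z = zero_mor C Z Z"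

definition direct_sum :: "('k, 'o, 'm, 'z) lin_category_scheme \<Rightarrow> 'o \<Rightarrow> 'o \<Rightarrow> 'o \<Rightarrow> bool" where
  "direct_sum C S A B \<longleftrightarrow>
     (\<exists>i \<in> hom C A S. \<exists>j \<in> hom C B S. \<exists>p \<in> hom C S A. \<exists>q \<in> hom C S B.
        p \<cdot>\<^bsub>C\<^esub> i = ident C A \<and> q \<cdot>\<^bsub>C\<^esub> j = ident C B \<and>
        p \<cdot>\<^bsub>C\<^esub> j = zero_mor C B A \<and> q \<cdot>\<^bsub>C\<^esub> i = zero_mor C A B \<and>
        i \<cdot>\<^bsub>C\<^esub> p \<oplus>\<^bsub>C\<^esub> j \<cdot>\<^bsub>C\<^esub> q = ident C S)"

primrec direct_sum_list :: "('k, 'o, 'm, 'z) lin_category_scheme \<Rightarrow> 'o \<Rightarrow> 'o list \<Rightarrow> bool" where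
  "direct_sum_list C S [] = zero_object C S"
| "direct_sum_list C S (A # As) = (\<exists>S'. direct_sum C S A S' \<and> direct_sum_list C S' As)"

locale additive_category = lin_category C
  for C :: "('k::field, 'o, 'm, 'z) lin_category_scheme" (structure) +
  assumes ex_zero_object: "\<exists>Z. zero_object C Z"
    and ex_direct_sum: "\<lbrakk>A \<in> obj C; B \<in> obj C\<rbrakk> \<Longrightarrow> \<exists>S. direct_sum C S A B"

definition lin_comb ::
  "('k, 'o, 'm, 'z) lin_category_scheme \<Rightarrow> 'o \<Rightarrow> 'o \<Rightarrow> 'k list \<Rightarrow> 'm list \<Rightarrow> 'm" where
  "lin_comb C A B cs fs =
     foldr (\<lambda>(c, f) s. c \<odot>\<^bsub>C\<^esub> f \<oplus>\<^bsub>C\<^esub> s) (zip cs fs) (zero_mor C A B)"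

definition hom_finite :: "('k, 'o, 'm, 'z) lin_category_scheme \<Rightarrow> bool" where
  "hom_finite C \<longleftrightarrow> (\<forall>A \<in> obj C. \<forall>B \<in> obj C. \<exists>fs. set fs \<subseteq> hom C A B \<and>
     (\<forall>g \<in> hom C A B. \<exists>cs. length cs = length fs \<and> g = lin_comb C A B cs fs))"

text \<open>\<open>End(A)\<close> is a (not necessarily commutative) local ring: nonzero, and the non-units are
  closed under addition.\<close>

definition local_end :: "('k, 'o, 'm, 'z) lin_category_scheme \<Rightarrow> 'o \<Rightarrow> bool" where
  "local_end C A \<longleftrightarrow> A \<in> obj C \<and> ident C A \<noteq> zero_mor C A A \<and>
     (\<forall>f \<in> hom C A A. \<forall>g \<in> hom C A A.
        \<not> is_iso C A A f \<longrightarrow> \<not> is_iso C A A g \<longrightarrow> \<not> is_iso C A A (f \<oplus>\<^bsub>C\<^esub> g))"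

definition krull_schmidt :: "('k, 'o, 'm, 'z) lin_category_scheme \<Rightarrow> bool" where
  "krull_schmidt C \<longleftrightarrow> (\<forall>S \<in> obj C. \<exists>As. (\<forall>A \<in> set As. local_end C A) \<and> direct_sum_list C S As)"

text \<open>Full subcategories, given by their sets of objects.\<close>

definition subcategory :: "('k, 'o, 'm, 'z) lin_category_scheme \<Rightarrow> 'o set \<Rightarrow> bool" where
  "subcategory C \<A> \<longleftrightarrow> \<A> \<subseteq> obj C \<and>
     (\<forall>A B. A \<in> \<A> \<longrightarrow> isomorphic C A B \<longrightarrow> B \<in> \<A>) \<and>
     (\<forall>Z. zero_object C Z \<longrightarrow> Z \<in> \<A>) \<and>
     (\<forall>S A B. direct_sum C S A B \<longrightarrow> A \<in> \<A> \<longrightarrow> B \<in> \<A> \<longrightarrow> S \<in> \<A>) \<and>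
     (\<forall>S A B. direct_sum C S A B \<longrightarrow> S \<in> \<A> \<longrightarrow> A \<in> \<A> \<and> B \<in> \<A>)"


text \<open>An endofunctor is given by its action \<open>Fo\<close> on objects and \<open>Fm\<close> on morphisms.\<close>

definition lin_endofunctor ::
  "('k, 'o, 'm, 'z) lin_category_scheme \<Rightarrow> ('o \<Rightarrow> 'o) \<Rightarrow> ('m \<Rightarrow> 'm) \<Rightarrow> bool" where
  "lin_endofunctor C Fo Fm \<longleftrightarrow>
     (\<forall>A \<in> obj C. Fo A \<in> obj C) \<and>
     (\<forall>A B. \<forall>f \<in> hom C A B. Fm f \<in> hom C (Fo A) (Fo B)) \<and>
     (\<forall>A \<in> obj C. Fm (ident C A) = ident C (Fo A)) \<and>
     (\<forall>A B D. \<forall>g \<in> hom C B D. \<forall>f \<in> hom C A B. Fm (g \<cdot>\<^bsub>C\<^esub> f) = Fm g \<cdot>\<^bsub>C\<^esub> Fm f) \<and>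
     (\<forall>A B. \<forall>f \<in> hom C A B. \<forall>g \<in> hom C A B. Fm (f \<oplus>\<^bsub>C\<^esub> g) = Fm f \<oplus>\<^bsub>C\<^esub> Fm g) \<and>
     (\<forall>A B c. \<forall>f \<in> hom C A B. Fm (c \<odot>\<^bsub>C\<^esub> f) = c \<odot>\<^bsub>C\<^esub> Fm f)"

definition autoequivalence ::
  "('k, 'o, 'm, 'z) lin_category_scheme \<Rightarrow> ('o \<Rightarrow> 'o) \<Rightarrow> ('m \<Rightarrow> 'm) \<Rightarrow> bool" where
  "autoequivalence C Fo Fm \<longleftrightarrow> lin_endofunctor C Fo Fm \<and>
     (\<forall>A \<in> obj C. \<forall>B \<in> obj C. bij_betw Fm (hom C A B) (hom C (Fo A) (Fo B))) \<and>
     (\<forall>B \<in> obj C. \<exists>A \<in> obj C. isomorphic C (Fo A) B)"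

text \<open>\<open>F\<close> is left adjoint to \<open>G\<close> with unit \<open>\<eta>\<close> and counit \<open>\<epsilon>\<close>.\<close>

definition adjunction ::
  "('k, 'o, 'm, 'z) lin_category_scheme \<Rightarrow> ('o \<Rightarrow> 'o) \<Rightarrow> ('m \<Rightarrow> 'm) \<Rightarrow> ('o \<Rightarrow> 'o) \<Rightarrow> ('m \<Rightarrow> 'm)
     \<Rightarrow> ('o \<Rightarrow> 'm) \<Rightarrow> ('o \<Rightarrow> 'm) \<Rightarrow> bool" where
  "adjunction C Fo Fm Go Gm \<eta> \<epsilon> \<longleftrightarrow> lin_endofunctor C Fo Fm \<and> lin_endofunctor C Go Gm \<and>
     (\<forall>A \<in> obj C. \<eta> A \<in> hom C A (Go (Fo A))) \<and>
     (\<forall>A \<in> obj C. \<epsilon> A \<in> hom C (Fo (Go A)) A) \<and>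
     (\<forall>A B. \<forall>f \<in> hom C A B. Gm (Fm f) \<cdot>\<^bsub>C\<^esub> \<eta> A = \<eta> B \<cdot>\<^bsub>C\<^esub> f) \<and>
     (\<forall>A B. \<forall>f \<in> hom C A B. f \<cdot>\<^bsub>C\<^esub> \<epsilon> A = \<epsilon> B \<cdot>\<^bsub>C\<^esub> Fm (Gm f)) \<and>
     (\<forall>A \<in> obj C. \<epsilon> (Fo A) \<cdot>\<^bsub>C\<^esub> Fm (\<eta> A) = ident C (Fo A)) \<and>
     (\<forall>A \<in> obj C. Gm (\<epsilon> A) \<cdot>\<^bsub>C\<^esub> \<eta> (Go A) = ident C (Go A))"

definition adjoint_equivalence ::
  "('k, 'o, 'm, 'z) lin_category_scheme \<Rightarrow> ('o \<Rightarrow> 'o) \<Rightarrow> ('m \<Rightarrow> 'm) \<Rightarrow> ('o \<Rightarrow> 'o) \<Rightarrow> ('m \<Rightarrow> 'm)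
     \<Rightarrow> ('o \<Rightarrow> 'm) \<Rightarrow> ('o \<Rightarrow> 'm) \<Rightarrow> bool" where
  "adjoint_equivalence C Fo Fm Go Gm \<eta> \<epsilon> \<longleftrightarrow> adjunction C Fo Fm Go Gm \<eta> \<epsilon> \<and>
     (\<forall>A \<in> obj C. is_iso C A (Go (Fo A)) (\<eta> A)) \<and>
     (\<forall>A \<in> obj C. is_iso C (Fo (Go A)) A (\<epsilon> A))"


text \<open>
  Relative to an endofunctor \<open>F\<close>, the value \<open>Sextuple A B D f g h\<close> stands for
  \<open>A \<midarrow>f\<rightarrow> B \<midarrow>g\<rightarrow> D \<midarrow>h\<rightarrow> F A\<close> (predicates \<open>right_\<dots>\<close>), or for
  \<open>F D \<midarrow>f\<rightarrow> A \<midarrow>g\<rightarrow> B \<midarrow>h\<rightarrow> D\<close> (predicates \<open>left_\<dots>\<close>).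
\<close>

datatype ('o, 'm) sextuple =
  Sextuple (ob1: 'o) (ob2: 'o) (ob3: 'o) (mor1: 'm) (mor2: 'm) (mor3: 'm)

definition right_sextuple ::
  "('o, 'm, 'z) category_scheme \<Rightarrow> ('o \<Rightarrow> 'o) \<Rightarrow> ('o, 'm) sextuple \<Rightarrow> bool" where
  "right_sextuple C Fo t \<longleftrightarrow> mor1 t \<in> hom C (ob1 t) (ob2 t) \<and> mor2 t \<in> hom C (ob2 t) (ob3 t) \<and>
     mor3 t \<in> hom C (ob3 t) (Fo (ob1 t))"

definition right_morphism ::
  "('o, 'm, 'z) category_scheme \<Rightarrow> ('o \<Rightarrow> 'o) \<Rightarrow> ('m \<Rightarrow> 'm) \<Rightarrow> ('o, 'm) sextuple \<Rightarrow> ('o, 'm) sextuple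
     \<Rightarrow> 'm \<Rightarrow> 'm \<Rightarrow> 'm \<Rightarrow> bool" where
  "right_morphism C Fo Fm s t a b d \<longleftrightarrow> right_sextuple C Fo s \<and> right_sextuple C Fo t \<and>
     a \<in> hom C (ob1 s) (ob1 t) \<and> b \<in> hom C (ob2 s) (ob2 t) \<and> d \<in> hom C (ob3 s) (ob3 t) \<and>
     b \<cdot>\<^bsub>C\<^esub> mor1 s = mor1 t \<cdot>\<^bsub>C\<^esub> a \<and>
     d \<cdot>\<^bsub>C\<^esub> mor2 s = mor2 t \<cdot>\<^bsub>C\<^esub> b \<and>
     Fm a \<cdot>\<^bsub>C\<^esub> mor3 s = mor3 t \<cdot>\<^bsub>C\<^esub> d"

definition right_isomorphic ::
  "('o, 'm, 'z) category_scheme \<Rightarrow> ('o \<Rightarrow> 'o) \<Rightarrow> ('m \<Rightarrow> 'm) \<Rightarrow> ('o, 'm) sextuple \<Rightarrow> ('o, 'm) sextuple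
     \<Rightarrow> bool" where
  "right_isomorphic C Fo Fm s t \<longleftrightarrow> (\<exists>a b d. right_morphism C Fo Fm s t a b d \<and>
     is_iso C (ob1 s) (ob1 t) a \<and> is_iso C (ob2 s) (ob2 t) b \<and> is_iso C (ob3 s) (ob3 t) d)"

definition left_sextuple ::
  "('o, 'm, 'z) category_scheme \<Rightarrow> ('o \<Rightarrow> 'o) \<Rightarrow> ('o, 'm) sextuple \<Rightarrow> bool" where
  "left_sextuple C Fo t \<longleftrightarrow> mor1 t \<in> hom C (Fo (ob3 t)) (ob1 t) \<and>
     mor2 t \<in> hom C (ob1 t) (ob2 t) \<and> mor3 t \<in> hom C (ob2 t) (ob3 t)"

definition left_isomorphic ::
  "('o, 'm, 'z) category_scheme \<Rightarrow> ('o \<Rightarrow> 'o) \<Rightarrow> ('m \<Rightarrow> 'm) \<Rightarrow> ('o, 'm) sextuple \<Rightarrow> ('o, 'm) sextuple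
     \<Rightarrow> bool" where
  "left_isomorphic C Fo Fm s t \<longleftrightarrow> left_sextuple C Fo s \<and> left_sextuple C Fo t \<and>
     (\<exists>a b d. is_iso C (ob1 s) (ob1 t) a \<and> is_iso C (ob2 s) (ob2 t) b \<and>
        is_iso C (ob3 s) (ob3 t) d \<and>
        a \<cdot>\<^bsub>C\<^esub> mor1 s = mor1 t \<cdot>\<^bsub>C\<^esub> Fm d \<and>
        b \<cdot>\<^bsub>C\<^esub> mor2 s = mor2 t \<cdot>\<^bsub>C\<^esub> a \<and>
        d \<cdot>\<^bsub>C\<^esub> mor3 s = mor3 t \<cdot>\<^bsub>C\<^esub> b)"


record ('k, 'o, 'm) tri_category = "('k, 'o, 'm) lin_category" +
  shift_ob :: "'o \<Rightarrow> 'o"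
  shift_mor :: "'m \<Rightarrow> 'm"
  triangles :: "('o, 'm) sextuple set"

text \<open>The shift is only required to be an auto-equivalence, not an automorphism.\<close>

locale triangulated_category = additive_category T
  for T :: "('k::field, 'o, 'm, 'z) tri_category_scheme" (structure) +
  assumes shift: "autoequivalence T (shift_ob T) (shift_mor T)"
    and triangle_sextuple: "t \<in> triangles T \<Longrightarrow> right_sextuple T (shift_ob T) t"
    and triangle_iso:
      "\<lbrakk>s \<in> triangles T; right_isomorphic T (shift_ob T) (shift_mor T) s t\<rbrakk> \<Longrightarrow> t \<in> triangles T"
    and TR1_ident: "\<lbrakk>A \<in> obj T; zero_object T Z\<rbrakk> \<Longrightarrow>
      Sextuple A A Z (ident T A) (zero_mor T A Z) (zero_mor T Z (shift_ob T A)) \<in> triangles T"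
    and TR1_cone: "f \<in> hom T A B \<Longrightarrow> \<exists>D g h. Sextuple A B D f g h \<in> triangles T"
    and TR2: "\<lbrakk>f \<in> hom T A B; g \<in> hom T B D; h \<in> hom T D (shift_ob T A)\<rbrakk> \<Longrightarrow>
      Sextuple A B D f g h \<in> triangles T \<longleftrightarrow>
      Sextuple B D (shift_ob T A) g h (neg T (shift_mor T f)) \<in> triangles T"
    and TR3: "\<lbrakk>s \<in> triangles T; t \<in> triangles T;
        a \<in> hom T (ob1 s) (ob1 t); b \<in> hom T (ob2 s) (ob2 t); b \<cdot> mor1 s = mor1 t \<cdot> a\<rbrakk> \<Longrightarrow>
      \<exists>d. right_morphism T (shift_ob T) (shift_mor T) s t a b d"
    and TR4: "\<lbrakk>Sextuple A B D f f1 f2 \<in> triangles T; Sextuple B E G g g1 g2 \<in> triangles T;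
        Sextuple A E H (g \<cdot> f) h1 h2 \<in> triangles T\<rbrakk> \<Longrightarrow>
      \<exists>u v. Sextuple D H G u v (shift_mor T f1 \<cdot> g2) \<in> triangles T \<and>
        u \<cdot> f1 = h1 \<cdot> g \<and> v \<cdot> h1 = g1 \<and> h2 \<cdot> u = f2 \<and> g2 \<cdot> v = shift_mor T f \<cdot> h2"

abbreviation triangle_morphism ::
  "('k, 'o, 'm, 'z) tri_category_scheme \<Rightarrow> ('o, 'm) sextuple \<Rightarrow> ('o, 'm) sextuple
     \<Rightarrow> 'm \<Rightarrow> 'm \<Rightarrow> 'm \<Rightarrow> bool" where
  "triangle_morphism T \<equiv> right_morphism T (shift_ob T) (shift_mor T)"


definition orthogonal :: "('k, 'o, 'm, 'z) lin_category_scheme \<Rightarrow> 'o set \<Rightarrow> 'o set \<Rightarrow> bool" where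
  "orthogonal C \<U> \<V> \<longleftrightarrow> (\<forall>U \<in> \<U>. \<forall>V \<in> \<V>. hom C U V = {zero_mor C U V})"

definition left_perp :: "('k, 'o, 'm, 'z) lin_category_scheme \<Rightarrow> 'o set \<Rightarrow> 'o set" where
  "left_perp C \<U> = {A \<in> obj C. orthogonal C {A} \<U>}"

definition right_perp :: "('k, 'o, 'm, 'z) lin_category_scheme \<Rightarrow> 'o set \<Rightarrow> 'o set" where
  "right_perp C \<U> = {A \<in> obj C. orthogonal C \<U> {A}}"

text \<open>The subcategories \<open>\<U>[1]\<close> and \<open>\<U>[-1]\<close>, closed under isomorphisms.\<close>

definition shift_up :: "('k, 'o, 'm, 'z) tri_category_scheme \<Rightarrow> 'o set \<Rightarrow> 'o set" where
  "shift_up T \<U> = {W \<in> obj T. \<exists>U \<in> \<U>. isomorphic T W (shift_ob T U)}"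

definition shift_down :: "('k, 'o, 'm, 'z) tri_category_scheme \<Rightarrow> 'o set \<Rightarrow> 'o set" where
  "shift_down T \<U> = {W \<in> obj T. \<exists>U \<in> \<U>. isomorphic T (shift_ob T W) U}"

definition star :: "('k, 'o, 'm, 'z) tri_category_scheme \<Rightarrow> 'o set \<Rightarrow> 'o set \<Rightarrow> 'o set" where
  "star T \<U> \<V> = {W. \<exists>U \<in> \<U>. \<exists>V \<in> \<V>. \<exists>f g h. Sextuple U W V f g h \<in> triangles T}"

definition extension_closed :: "('k, 'o, 'm, 'z) tri_category_scheme \<Rightarrow> 'o set \<Rightarrow> bool" where
  "extension_closed T \<A> \<longleftrightarrow> (\<forall>A2 B A1 f g h.
     Sextuple A2 B A1 f g h \<in> triangles T \<longrightarrow> A1 \<in> \<A> \<longrightarrow> A2 \<in> \<A> \<longrightarrow> B \<in> \<A>)"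

definition mu_inv :: "('k, 'o, 'm, 'z) tri_category_scheme \<Rightarrow> 'o set \<Rightarrow> 'o set \<Rightarrow> 'o set" where
  "mu_inv T \<U> \<X> = star T \<X> (shift_up T \<U>) \<inter> left_perp T (shift_up T \<X>)"

definition mu :: "('k, 'o, 'm, 'z) tri_category_scheme \<Rightarrow> 'o set \<Rightarrow> 'o set \<Rightarrow> 'o set" where
  "mu T \<U> \<X> = star T (shift_down T \<U>) \<X> \<inter> right_perp T (shift_down T \<X>)"

definition mutation_pair ::
  "('k, 'o, 'm, 'z) tri_category_scheme \<Rightarrow> 'o set \<Rightarrow> 'o set \<Rightarrow> 'o set \<Rightarrow> bool" where
  "mutation_pair T \<X> \<U> \<V> \<longleftrightarrow> orthogonal T \<X> (shift_up T \<X>) \<and>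
     \<X> \<subseteq> \<U> \<and> \<U> \<subseteq> mu T \<V> \<X> \<and> \<X> \<subseteq> \<V> \<and> \<V> \<subseteq> mu_inv T \<U> \<X>"


definition left_approximation ::
  "('o, 'm, 'z) category_scheme \<Rightarrow> 'o set \<Rightarrow> 'o \<Rightarrow> 'o \<Rightarrow> 'm \<Rightarrow> bool" where
  "left_approximation C \<X> A X \<alpha> \<longleftrightarrow> X \<in> \<X> \<and> \<alpha> \<in> hom C A X \<and>
     (\<forall>X' \<in> \<X>. \<forall>f \<in> hom C A X'. \<exists>g \<in> hom C X X'. f = g \<cdot>\<^bsub>C\<^esub> \<alpha>)"

definition right_approximation ::
  "('o, 'm, 'z) category_scheme \<Rightarrow> 'o set \<Rightarrow> 'o \<Rightarrow> 'o \<Rightarrow> 'm \<Rightarrow> bool" where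
  "right_approximation C \<X> A Y b \<longleftrightarrow> Y \<in> \<X> \<and> b \<in> hom C Y A \<and>
     (\<forall>X' \<in> \<X>. \<forall>f \<in> hom C X' A. \<exists>g \<in> hom C X' Y. f = b \<cdot>\<^bsub>C\<^esub> g)"

definition functorially_finite ::
  "('o, 'm, 'z) category_scheme \<Rightarrow> 'o set \<Rightarrow> 'o set \<Rightarrow> bool" where
  "functorially_finite C \<X> \<A> \<longleftrightarrow> (\<forall>A \<in> \<A>.
     (\<exists>X \<alpha>. left_approximation C \<X> A X \<alpha>) \<and> (\<exists>Y b. right_approximation C \<X> A Y b))"

definition X_monic :: "('o, 'm, 'z) category_scheme \<Rightarrow> 'o set \<Rightarrow> 'o \<Rightarrow> 'o \<Rightarrow> 'm \<Rightarrow> bool" where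
  "X_monic C \<X> A B f \<longleftrightarrow> f \<in> hom C A B \<and>
     (\<forall>X \<in> \<X>. (\<lambda>\<phi>. \<phi> \<cdot>\<^bsub>C\<^esub> f) ` hom C B X = hom C A X)"

definition X_epic :: "('o, 'm, 'z) category_scheme \<Rightarrow> 'o set \<Rightarrow> 'o \<Rightarrow> 'o \<Rightarrow> 'm \<Rightarrow> bool" where
  "X_epic C \<X> A B f \<longleftrightarrow> f \<in> hom C A B \<and>
     (\<forall>X \<in> \<X>. (\<lambda>\<phi>. f \<cdot>\<^bsub>C\<^esub> \<phi>) ` hom C X A = hom C X B)"

definition X_monics_have_cones ::
  "('k, 'o, 'm, 'z) tri_category_scheme \<Rightarrow> 'o set \<Rightarrow> 'o set \<Rightarrow> bool" where
  "X_monics_have_cones T \<X> \<A> \<longleftrightarrow> (\<forall>A \<in> \<A>. \<forall>B \<in> \<A>. \<forall>D f g h. X_monic T \<X> A B f \<longrightarrow>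
     Sextuple A B D f g h \<in> triangles T \<longrightarrow> D \<in> \<A>)"

definition X_epics_have_cocones ::
  "('k, 'o, 'm, 'z) tri_category_scheme \<Rightarrow> 'o set \<Rightarrow> 'o set \<Rightarrow> bool" where
  "X_epics_have_cocones T \<X> \<A> \<longleftrightarrow> (\<forall>B \<in> \<A>. \<forall>D \<in> \<A>. \<forall>K f g h. X_epic T \<X> B D f \<longrightarrow>
     Sextuple K B D g f h \<in> triangles T \<longrightarrow> K \<in> \<A>)"


text \<open>
  The subfactor category \<open>\<A>/[\<X>]\<close>. Its morphisms are the classes \<open>quot_class\<close>. Operations on
  classes are unions over representatives of the resulting classes; for a subcategory \<open>\<X>\<close> all
  the classes in such a union coincide.
\<close>

definition quot_class :: "('k, 'o, 'm, 'z) lin_category_scheme \<Rightarrow> 'o set \<Rightarrow> 'm \<Rightarrow> 'm set" where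
  "quot_class C \<X> f = {f'. \<exists>A B. f \<in> hom C A B \<and>
     (\<exists>X \<in> \<X>. \<exists>u \<in> hom C A X. \<exists>v \<in> hom C X B. f' = f \<oplus>\<^bsub>C\<^esub> v \<cdot>\<^bsub>C\<^esub> u)}"

definition subfactor ::
  "('k, 'o, 'm, 'z) lin_category_scheme \<Rightarrow> 'o set \<Rightarrow> 'o set \<Rightarrow> ('k, 'o, 'm set) lin_category" where
  "subfactor C \<X> \<A> = \<lparr>
     obj = \<A>,
     hom = (\<lambda>A B. if A \<in> \<A> \<and> B \<in> \<A> then quot_class C \<X> ` hom C A B else {}),
     comp = (\<lambda>\<psi> \<phi>. \<Union>g \<in> \<psi>. \<Union>f \<in> \<phi>. quot_class C \<X> (g \<cdot>\<^bsub>C\<^esub> f)),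
     ident = (\<lambda>A. quot_class C \<X> (ident C A)),
     add = (\<lambda>\<phi> \<psi>. \<Union>f \<in> \<phi>. \<Union>g \<in> \<psi>. quot_class C \<X> (f \<oplus>\<^bsub>C\<^esub> g)),
     zero_mor = (\<lambda>A B. quot_class C \<X> (zero_mor C A B)),
     scale = (\<lambda>c \<phi>. \<Union>f \<in> \<phi>. quot_class C \<X> (c \<odot>\<^bsub>C\<^esub> f)) \<rparr>"

definition susp_triangle ::
  "('k, 'o, 'm, 'z) tri_category_scheme \<Rightarrow> 'o set \<Rightarrow> 'o \<Rightarrow> ('o, 'm) sextuple \<Rightarrow> bool" where
  "susp_triangle T \<X> A t \<longleftrightarrow> t \<in> triangles T \<and> ob1 t = A \<and>
     left_approximation T \<X> A (ob2 t) (mor1 t)"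

definition loop_triangle ::
  "('k, 'o, 'm, 'z) tri_category_scheme \<Rightarrow> 'o set \<Rightarrow> 'o \<Rightarrow> ('o, 'm) sextuple \<Rightarrow> bool" where
  "loop_triangle T \<X> A t \<longleftrightarrow> t \<in> triangles T \<and> ob3 t = A \<and>
     right_approximation T \<X> A (ob2 t) (mor2 t)"

text \<open>
  \<open>S A\<close> and \<open>L A\<close> are the triangles fixed for the objects of \<open>\<A>\<close>; a choice of such triangles is
  only demanded for those objects which admit one.
\<close>

definition susp_choice ::
  "('k, 'o, 'm, 'z) tri_category_scheme \<Rightarrow> 'o set \<Rightarrow> 'o set \<Rightarrow> ('o \<Rightarrow> ('o, 'm) sextuple) \<Rightarrow> bool" where
  "susp_choice T \<X> \<A> S \<longleftrightarrow>
     (\<forall>A \<in> \<A>. (\<exists>t. susp_triangle T \<X> A t) \<longrightarrow> susp_triangle T \<X> A (S A))"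

definition loop_choice ::
  "('k, 'o, 'm, 'z) tri_category_scheme \<Rightarrow> 'o set \<Rightarrow> 'o set \<Rightarrow> ('o \<Rightarrow> ('o, 'm) sextuple) \<Rightarrow> bool" where
  "loop_choice T \<X> \<A> L \<longleftrightarrow>
     (\<forall>A \<in> \<A>. (\<exists>t. loop_triangle T \<X> A t) \<longrightarrow> loop_triangle T \<X> A (L A))"

abbreviation susp_ob :: "('o \<Rightarrow> ('o, 'm) sextuple) \<Rightarrow> 'o \<Rightarrow> 'o" where
  "susp_ob S A \<equiv> ob3 (S A)"

abbreviation loop_ob :: "('o \<Rightarrow> ('o, 'm) sextuple) \<Rightarrow> 'o \<Rightarrow> 'o" where
  "loop_ob L A \<equiv> ob1 (L A)"

definition susp_mor ::
  "('k, 'o, 'm, 'z) tri_category_scheme \<Rightarrow> 'o set \<Rightarrow> ('o \<Rightarrow> ('o, 'm) sextuple) \<Rightarrow> 'm set \<Rightarrow> 'm set" where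
  "susp_mor T \<X> S \<phi> = \<Union> {quot_class T \<X> h |h. \<exists>A A' f g. f \<in> \<phi> \<and> f \<in> hom T A A' \<and>
     triangle_morphism T (S A) (S A') f g h}"

definition loop_mor ::
  "('k, 'o, 'm, 'z) tri_category_scheme \<Rightarrow> 'o set \<Rightarrow> ('o \<Rightarrow> ('o, 'm) sextuple) \<Rightarrow> 'm set \<Rightarrow> 'm set" where
  "loop_mor T \<X> L \<phi> = \<Union> {quot_class T \<X> f |f. \<exists>A A' g h. h \<in> \<phi> \<and> h \<in> hom T A A' \<and>
     triangle_morphism T (L A) (L A') f g h}"

text \<open>
  The adjunction of \<open>\<Sigma>\<close> and \<open>\<Omega>\<close>: the classes of \<open>\<phi> : \<Sigma>A \<rightarrow> D\<close> and \<open>\<psi> : A \<rightarrow> \<Omega>D\<close> correspond iff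
  \<open>(\<psi>, g, -\<phi>)\<close> is a morphism of triangles from \<open>S A\<close> to \<open>L D\<close> for some \<open>g\<close>. Unit and counit
  correspond to \<open>\<phi> = 1\<close> and \<open>\<psi> = 1\<close>.

  The sign is forced by the conventions for \<open>\<nabla>\<close> and \<open>\<triangle>\<close> below and the compatibility axioms of
  a pretriangulation: take \<open>\<X> = 0\<close>, an automorphism \<open>[1]\<close>, \<open>\<Sigma> = [1]\<close>, \<open>\<Omega> = [-1]\<close> and
  \<open>\<gamma> = c = 1\<close>. Then \<open>(h, g, f)\<close> is in \<open>\<triangle>\<close> iff it is distinguished, but in \<open>\<nabla>\<close> iff
  \<open>(-h, g, f)\<close> is distinguished, so that \<open>\<triangle>\<close> and \<open>\<nabla>\<close> match along \<open>-1 : \<Sigma>\<Omega>D \<rightarrow> D\<close> and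
  in general not along \<open>+1\<close>.
\<close>

definition adj_unit ::
  "('k::field, 'o, 'm, 'z) tri_category_scheme \<Rightarrow> 'o set \<Rightarrow> ('o \<Rightarrow> ('o, 'm) sextuple)
     \<Rightarrow> ('o \<Rightarrow> ('o, 'm) sextuple) \<Rightarrow> 'o \<Rightarrow> 'm set" where
  "adj_unit T \<X> S L A = \<Union> {quot_class T \<X> \<psi> |\<psi>. \<exists>g.
     triangle_morphism T (S A) (L (susp_ob S A)) \<psi> g (neg T (ident T (susp_ob S A)))}"

text \<open>\<open>(-1, g, \<phi>)\<close> is a morphism of triangles iff \<open>(1, -g, -\<phi>)\<close> is.\<close>

definition adj_counit ::
  "('k::field, 'o, 'm, 'z) tri_category_scheme \<Rightarrow> 'o set \<Rightarrow> ('o \<Rightarrow> ('o, 'm) sextuple)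
     \<Rightarrow> ('o \<Rightarrow> ('o, 'm) sextuple) \<Rightarrow> 'o \<Rightarrow> 'm set" where
  "adj_counit T \<X> S L D = \<Union> {quot_class T \<X> \<phi> |\<phi>. \<exists>g.
     triangle_morphism T (S (loop_ob L D)) (L D) (neg T (ident T (loop_ob L D))) g \<phi>}"

text \<open>The classes \<open>\<nabla>\<close> and \<open>\<triangle>\<close> of right and left triangles in \<open>\<A>/[\<X>]\<close>.\<close>

definition nabla ::
  "('k, 'o, 'm, 'z) tri_category_scheme \<Rightarrow> 'o set \<Rightarrow> 'o set \<Rightarrow> ('o \<Rightarrow> ('o, 'm) sextuple)
     \<Rightarrow> ('o, 'm set) sextuple set" where
  "nabla T \<X> \<A> S = {t. \<exists>A \<in> \<A>. \<exists>B \<in> \<A>. \<exists>D \<in> \<A>. \<exists>f g h. f \<in> hom T A B \<and>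
     Sextuple B D (susp_ob S A) g h (shift_mor T f \<cdot>\<^bsub>T\<^esub> mor3 (S A)) \<in> triangles T \<and>
     right_isomorphic (subfactor T \<X> \<A>) (susp_ob S) (susp_mor T \<X> S)
       (Sextuple A B D (quot_class T \<X> f) (quot_class T \<X> g) (quot_class T \<X> h)) t}"

definition delta ::
  "('k, 'o, 'm, 'z) tri_category_scheme \<Rightarrow> 'o set \<Rightarrow> 'o set \<Rightarrow> ('o \<Rightarrow> ('o, 'm) sextuple)
     \<Rightarrow> ('o, 'm set) sextuple set" where
  "delta T \<X> \<A> L = {t. \<exists>K \<in> \<A>. \<exists>B \<in> \<A>. \<exists>D \<in> \<A>. \<exists>f g h. f \<in> hom T B D \<and>
     Sextuple (loop_ob L D) K B h g (mor3 (L D) \<cdot>\<^bsub>T\<^esub> f) \<in> triangles T \<and>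
     left_isomorphic (subfactor T \<X> \<A>) (loop_ob L) (loop_mor T \<X> L)
       (Sextuple K B D (quot_class T \<X> h) (quot_class T \<X> g) (quot_class T \<X> f)) t}"

text \<open>
  \<open>(\<Omega>, \<Sigma>, \<triangle>, \<nabla>)\<close> makes \<open>\<A>/[\<X>]\<close> a triangulated category: \<open>\<Sigma>\<close> is an auto-equivalence with
  quasi-inverse \<open>\<Omega>\<close>, and \<open>\<triangle> = \<nabla>\<close> along the counit \<open>\<Sigma>\<Omega>D \<cong> D\<close>.
\<close>

definition subfactor_triangulated ::
  "('k::field, 'o, 'm, 'z) tri_category_scheme \<Rightarrow> 'o set \<Rightarrow> 'o set \<Rightarrow> ('o \<Rightarrow> ('o, 'm) sextuple)
     \<Rightarrow> ('o \<Rightarrow> ('o, 'm) sextuple) \<Rightarrow> bool" where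
  "subfactor_triangulated T \<X> \<A> S L \<longleftrightarrow> (let Q = subfactor T \<X> \<A> in
     adjoint_equivalence Q (susp_ob S) (susp_mor T \<X> S) (loop_ob L) (loop_mor T \<X> L)
       (adj_unit T \<X> S L) (adj_counit T \<X> S L) \<and>
     (\<forall>A \<in> \<A>. \<forall>B \<in> \<A>. \<forall>D \<in> \<A>. \<forall>h \<in> hom Q (loop_ob L D) A. \<forall>g \<in> hom Q A B.
        \<forall>w \<in> hom Q B (susp_ob S (loop_ob L D)).
          Sextuple A B D h g (adj_counit T \<X> S L D \<cdot>\<^bsub>Q\<^esub> w) \<in> delta T \<X> \<A> L \<longleftrightarrow>
          Sextuple (loop_ob L D) A B h g w \<in> nabla T \<X> \<A> S))"

end

theory Submission
  imports Defs
begin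

text \<open>
  Assume (a). The mutation pair condition says that \<open>(\<X>, \<A>[1]) = 0 = (\<A>, \<X>[1])\<close> and that every
  object of \<open>\<A>\<close> starts and ends a triangle in \<open>\<A>\<close> with middle term in \<open>\<X>\<close>: the triangles of \<open>T\<close> with
  terms in \<open>\<A>\<close> behave like the conflations of a Frobenius category with projective-injectives \<open>\<X>\<close>.
  The cone of an \<open>\<X>\<close>-monomorphism \<open>A \<rightarrow> B\<close> is, by an octahedron, a direct summand of an extension of
  \<open>\<Sigma>A\<close> by \<open>B\<close>. Both \<open>\<nabla>\<close> and \<open>\<triangle>\<close> turn out to consist of the images of the triangles
  \<open>A \<rightarrow> B \<rightarrow> D \<rightarrow> A[1]\<close> with terms in \<open>\<A>\<close>, where \<open>D \<rightarrow> A[1]\<close> is written as \<open>-\<gamma> w\<close> with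
  \<open>w : D \<rightarrow> \<Sigma>A\<close> for \<open>\<nabla>\<close> and as \<open>c f\<close> for \<open>\<triangle>\<close>; the counit, given by \<open>c \<epsilon> = -\<gamma>\<close>, matches the two.

  Assume (b). As the unit is an isomorphism modulo \<open>\<X>\<close>, \<open>\<gamma> : \<Sigma>A \<rightarrow> A[1]\<close> factors through the
  connecting morphism \<open>c\<close> of \<open>\<Sigma>A\<close>, which kills all morphisms from \<open>\<X>\<close>. As \<open>(\<X>, \<X>[1]) = 0\<close>, every
  morphism from \<open>\<X>\<close> to \<open>A[1]\<close> factors through \<open>\<gamma>\<close>, so it vanishes. The counit gives
  \<open>(\<A>, \<X>[1]) = 0\<close> in the same way. An extension in \<open>\<A>\<close> is then obtained from the cocone of an
  \<open>\<X>\<close>-epimorphism.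
\<close>

section \<open>Linear categories\<close>

context category
begin

text \<open>With domain and codomain as functions, the typing conditions of the category laws can be
  discharged by rewriting.\<close>

definition arr where
  "arr f \<longleftrightarrow> (\<exists>A B. f \<in> hom C A B)"

definition src where
  "src f = (THE A. \<exists>B. f \<in> hom C A B)"

definition tgt where
  "tgt f = (THE B. \<exists>A. f \<in> hom C A B)"

lemma hom_iff: "f \<in> hom C A B \<longleftrightarrow> arr f \<and> src f = A \<and> tgt f = B"
proof -
  have "src f = A \<and> tgt f = B" if "f \<in> hom C A B" for A B
    unfolding src_def tgt_def using that by (blast dest: hom_disjoint)
  then show ?thesis
    unfolding arr_def by blast
qed

lemma homD:
  assumes "f \<in> hom C A B"
  shows "arr f" and "src f = A" and "tgt f = B" and "A \<in> obj C" and "B \<in> obj C"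
  using assms hom_obj[OF assms] by (auto simp: hom_iff)

lemma arr_hom: "arr f \<Longrightarrow> f \<in> hom C (src f) (tgt f)"
  by (simp add: hom_iff)

lemma arr_obj [simp]: "arr f \<Longrightarrow> src f \<in> obj C" "arr f \<Longrightarrow> tgt f \<in> obj C"
  using hom_obj[OF arr_hom] by auto

lemma arr_comp [simp]:
  assumes "arr g" "arr f" "src g = tgt f"
  shows "arr (g \<cdot> f)" and "src (g \<cdot> f) = src f" and "tgt (g \<cdot> f) = tgt g"
proof -
  have "g \<cdot> f \<in> hom C (src f) (tgt g)"
    using assms by (intro comp_hom[of g "tgt f" _ f]) (auto simp: hom_iff)
  then show "arr (g \<cdot> f)" "src (g \<cdot> f) = src f" "tgt (g \<cdot> f) = tgt g"
    by (simp_all add: hom_iff)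
qed

lemma arr_ident [simp]:
  assumes "A \<in> obj C"
  shows "arr (ident C A)" and "src (ident C A) = A" and "tgt (ident C A) = A"
  using ident_hom[OF assms] by (simp_all add: hom_iff)

lemma comp_ident [simp]:
  "\<lbrakk>arr f; tgt f = B\<rbrakk> \<Longrightarrow> ident C B \<cdot> f = f"
  "\<lbrakk>arr f; src f = A\<rbrakk> \<Longrightarrow> f \<cdot> ident C A = f"
  using ident_left[of f "src f" B] ident_right[of f A "tgt f"] by (simp_all add: hom_iff)

lemma assoc:
  "\<lbrakk>arr h; arr g; arr f; src h = tgt g; src g = tgt f\<rbrakk> \<Longrightarrow> (h \<cdot> g) \<cdot> f = h \<cdot> (g \<cdot> f)"
  using comp_assoc[of h "src h" "tgt h" g "src g" f "src f"] by (simp add: hom_iff)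

lemma comp_reduce:
  "\<lbrakk>h \<cdot> g = k; arr h; arr g; arr f; src h = tgt g; src g = tgt f\<rbrakk> \<Longrightarrow> h \<cdot> (g \<cdot> f) = k \<cdot> f"
  by (metis assoc)

lemma is_isoI:
  "\<lbrakk>f \<in> hom C A B; g \<in> hom C B A; g \<cdot> f = ident C A; f \<cdot> g = ident C B\<rbrakk> \<Longrightarrow> is_iso C A B f"
  by (auto simp: is_iso_def)

lemma is_isoE:
  assumes "is_iso C A B f"
  obtains g where "f \<in> hom C A B" "g \<in> hom C B A" "g \<cdot> f = ident C A" "f \<cdot> g = ident C B"
    "is_iso C B A g"
  using assms by (auto simp: is_iso_def)

lemma is_iso_ident: "A \<in> obj C \<Longrightarrow> is_iso C A A (ident C A)"
  by (rule is_isoI[of _ _ _ "ident C A"]) (simp_all add: hom_iff)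

lemma is_iso_comp:
  assumes "is_iso C B D g" "is_iso C A B f"
  shows "is_iso C A D (g \<cdot> f)"
proof -
  obtain g' where g: "g \<in> hom C B D" "g' \<in> hom C D B" "g' \<cdot> g = ident C B" "g \<cdot> g' = ident C D"
    using assms(1) by (rule is_isoE)
  obtain f' where f: "f \<in> hom C A B" "f' \<in> hom C B A" "f' \<cdot> f = ident C A" "f \<cdot> f' = ident C B"
    using assms(2) by (rule is_isoE)
  note [simp] = homD[OF g(1)] homD[OF g(2)] homD[OF f(1)] homD[OF f(2)]
  show ?thesis
  proof (rule is_isoI)
    have "f' \<cdot> (g' \<cdot> (g \<cdot> f)) = ident C A"
      using f(3) by (simp add: comp_reduce[OF g(3)])
    then show "(f' \<cdot> g') \<cdot> (g \<cdot> f) = ident C A"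
      by (simp add: assoc)
    have "g \<cdot> (f \<cdot> (f' \<cdot> g')) = ident C D"
      using g(4) by (simp add: comp_reduce[OF f(4)])
    then show "(g \<cdot> f) \<cdot> (f' \<cdot> g') = ident C D"
      by (simp add: assoc)
  qed (simp_all add: hom_iff)
qed

lemma is_iso_both_sides:
  assumes f: "f \<in> hom C A B" and g: "g \<in> hom C B A" "g' \<in> hom C B A"
    and "is_iso C A A (g \<cdot> f)" "is_iso C B B (f \<cdot> g')"
  shows "is_iso C A B f"
proof -
  note [simp] = homD[OF f] homD[OF g(1)] homD[OF g(2)]
  obtain k where k: "k \<in> hom C A A" "k \<cdot> (g \<cdot> f) = ident C A"
    using assms(4) by (rule is_isoE)
  obtain l where l: "l \<in> hom C B B" "(f \<cdot> g') \<cdot> l = ident C B"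
    using assms(5) by (rule is_isoE)
  note [simp] = homD[OF k(1)] homD[OF l(1)]
  have "k \<cdot> g = (k \<cdot> g) \<cdot> ((f \<cdot> g') \<cdot> l)"
    using l by simp
  also have "\<dots> = (k \<cdot> (g \<cdot> f)) \<cdot> (g' \<cdot> l)"
    by (simp add: assoc)
  finally have eq: "k \<cdot> g = g' \<cdot> l"
    using k by simp
  show ?thesis
  proof (rule is_isoI)
    show "(k \<cdot> g) \<cdot> f = ident C A"
      using k by (simp add: assoc)
    show "f \<cdot> (k \<cdot> g) = ident C B"
      using l by (simp add: assoc eq)
  qed (simp_all add: hom_iff)
qed

end

context lin_category
begin

lemma arr_zero [simp]:
  assumes "A \<in> obj C" "B \<in> obj C"
  shows "arr (zero_mor C A B)" and "src (zero_mor C A B) = A" and "tgt (zero_mor C A B) = B"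
  using zero_hom[OF assms] by (simp_all add: hom_iff)

lemma arr_add [simp]:
  assumes "arr f" "arr g" "src f = src g" "tgt f = tgt g"
  shows "arr (f \<oplus> g)" and "src (f \<oplus> g) = src g" and "tgt (f \<oplus> g) = tgt g"
  using add_hom[of f "src g" "tgt g" g] assms by (simp_all add: hom_iff)

lemma arr_scale [simp]:
  assumes "arr f"
  shows "arr (c \<odot> f)" and "src (c \<odot> f) = src f" and "tgt (c \<odot> f) = tgt f"
  using scale_hom[OF arr_hom[OF assms]] by (simp_all add: hom_iff)

lemma add_ac:
  "\<lbrakk>arr f; arr g; arr h; src f = src g; src g = src h; tgt f = tgt g; tgt g = tgt h\<rbrakk>
    \<Longrightarrow> (f \<oplus> g) \<oplus> h = f \<oplus> (g \<oplus> h)"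
  "\<lbrakk>arr f; arr g; src f = src g; tgt f = tgt g\<rbrakk> \<Longrightarrow> f \<oplus> g = g \<oplus> f"
  using add_assoc[of f "src h" "tgt h" g h] add_commute[of f "src g" "tgt g" g]
  by (simp_all add: hom_iff)

lemma add_left_commute:
  assumes "arr f" "arr g" "arr h" "src f = src g" "src g = src h" "tgt f = tgt g" "tgt g = tgt h"
  shows "f \<oplus> (g \<oplus> h) = g \<oplus> (f \<oplus> h)"
proof -
  have "f \<oplus> (g \<oplus> h) = (f \<oplus> g) \<oplus> h"
    by (rule add_ac(1)[symmetric]) (simp_all add: assms)
  also have "\<dots> = (g \<oplus> f) \<oplus> h"
    by (simp add: add_ac(2)[of f g] assms)
  also have "\<dots> = g \<oplus> (f \<oplus> h)"
    by (rule add_ac(1)) (simp_all add: assms)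
  finally show ?thesis .
qed

lemma add_zero_right [simp]: "\<lbrakk>arr f; src f = A; tgt f = B\<rbrakk> \<Longrightarrow> f \<oplus> zero_mor C A B = f"
  using add_zero[of f A B] by (simp add: hom_iff)

lemma add_zero_left [simp]: "\<lbrakk>arr f; src f = A; tgt f = B\<rbrakk> \<Longrightarrow> zero_mor C A B \<oplus> f = f"
  using add_zero_right[of f A B] add_ac(2)[of f "zero_mor C A B"] by fastforce

lemma add_left_cancel:
  assumes [simp]: "arr f" "arr g" "arr h" "src g = src f" "src h = src f" "tgt g = tgt f" "tgt h = tgt f"
  shows "f \<oplus> g = f \<oplus> h \<longleftrightarrow> g = h"
proof
  obtain f' where f': "f' \<in> hom C (src f) (tgt f)" "f \<oplus> f' = zero_mor C (src f) (tgt f)"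
    using add_inverse[of f "src f" "tgt f"] by (auto simp: hom_iff)
  note [simp] = homD[OF f'(1)]
  have f'2: "f' \<oplus> f = zero_mor C (src f) (tgt f)"
    using f'(2) add_ac(2)[of f f'] by simp
  assume *: "f \<oplus> g = f \<oplus> h"
  have "g = (f' \<oplus> f) \<oplus> g"
    by (simp add: f'2)
  also have "\<dots> = f' \<oplus> (f \<oplus> g)"
    by (rule add_ac) simp_all
  also have "\<dots> = (f' \<oplus> f) \<oplus> h"
    unfolding * by (rule add_ac(1)[symmetric]) simp_all
  finally show "g = h"
    by (simp add: f'2)
qed simp

lemma scale_zero [simp]:
  assumes [simp]: "arr f"
  shows "0 \<odot> f = zero_mor C (src f) (tgt f)"
proof -
  have "f \<oplus> 0 \<odot> f = (1 \<odot> f) \<oplus> (0 \<odot> f)"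
    using scale_one[OF arr_hom] by simp
  also have "\<dots> = f \<oplus> zero_mor C (src f) (tgt f)"
    using scale_add_left[OF arr_hom, of f 1 0] scale_one[OF arr_hom] by simp
  finally show ?thesis
    by (subst (asm) add_left_cancel) simp_all
qed

lemma add_neg [simp]:
  assumes [simp]: "arr f"
  shows "f \<oplus> neg C f = zero_mor C (src f) (tgt f)" and "neg C f \<oplus> f = zero_mor C (src f) (tgt f)"
proof -
  show *: "f \<oplus> neg C f = zero_mor C (src f) (tgt f)"
    using scale_add_left[OF arr_hom, of f 1 "-1"] scale_one[OF arr_hom] by simp
  show "neg C f \<oplus> f = zero_mor C (src f) (tgt f)"
    using add_ac(2)[of f "neg C f"] * by simp
qed

lemma neg_neg [simp]: "arr f \<Longrightarrow> neg C (neg C f) = f"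
  using scale_scale[OF arr_hom, of f "-1" "-1"] scale_one[OF arr_hom] by simp

lemma neg_inject [simp]: "\<lbrakk>arr f; arr g\<rbrakk> \<Longrightarrow> neg C f = neg C g \<longleftrightarrow> f = g"
  using neg_neg by metis

lemma neg_eq_iff: "\<lbrakk>arr f; arr g\<rbrakk> \<Longrightarrow> neg C f = g \<longleftrightarrow> f = neg C g"
  using neg_neg by metis

lemma scale_comp:
  "\<lbrakk>arr g; arr f; src g = tgt f\<rbrakk> \<Longrightarrow> (c \<odot> g) \<cdot> f = c \<odot> (g \<cdot> f)"
  "\<lbrakk>arr g; arr f; src g = tgt f\<rbrakk> \<Longrightarrow> g \<cdot> (c \<odot> f) = c \<odot> (g \<cdot> f)"
  using comp_scale_left[of g "tgt f" "tgt g" f "src f" c]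
    comp_scale_right[of g "tgt f" "tgt g" f "src f" c]
  by (simp_all add: hom_iff)

lemma comp_add:
  "\<lbrakk>arr g; arr f; arr f'; src g = tgt f; src f' = src f; tgt f' = tgt f\<rbrakk>
    \<Longrightarrow> g \<cdot> (f \<oplus> f') = g \<cdot> f \<oplus> g \<cdot> f'"
  "\<lbrakk>arr g; arr g'; arr f; src g = tgt f; src g' = src g; tgt g' = tgt g\<rbrakk>
    \<Longrightarrow> (g \<oplus> g') \<cdot> f = g \<cdot> f \<oplus> g' \<cdot> f"
  using comp_add_right[of g "tgt f" "tgt g" f "src f" f']
    comp_add_left[of g "tgt f" "tgt g" g' f "src f"]
  by (simp_all add: hom_iff)

lemma scale_add:
  "\<lbrakk>arr f; arr g; src f = src g; tgt f = tgt g\<rbrakk> \<Longrightarrow> c \<odot> (f \<oplus> g) = c \<odot> f \<oplus> c \<odot> g"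
  using scale_add_right[of f "src g" "tgt g" g c] by (simp add: hom_iff)

lemma comp_zero [simp]:
  "\<lbrakk>arr f; tgt f = A; B \<in> obj C\<rbrakk> \<Longrightarrow> zero_mor C A B \<cdot> f = zero_mor C (src f) B"
  "\<lbrakk>arr f; src f = B; A \<in> obj C\<rbrakk> \<Longrightarrow> f \<cdot> zero_mor C A B = zero_mor C A (tgt f)"
proof -
  show "zero_mor C A B \<cdot> f = zero_mor C (src f) B" if [simp]: "arr f" "tgt f = A" "B \<in> obj C"
  proof -
    have "A \<in> obj C"
      using arr_obj(2)[of f] by simp
    then show ?thesis
      using scale_comp(1)[of "zero_mor C A B" f 0] by simp
  qed
  show "f \<cdot> zero_mor C A B = zero_mor C A (tgt f)" if [simp]: "arr f" "src f = B" "A \<in> obj C"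
  proof -
    have "B \<in> obj C"
      using arr_obj(1)[of f] by simp
    then show ?thesis
      using scale_comp(2)[of f "zero_mor C A B" 0] by simp
  qed
qed

lemma scale_zero_mor [simp]:
  assumes [simp]: "A \<in> obj C" "B \<in> obj C"
  shows "c \<odot> zero_mor C A B = zero_mor C A B"
proof -
  have "c \<odot> (0 \<odot> zero_mor C A B) = 0 \<odot> zero_mor C A B"
    using scale_scale[OF arr_hom, of "zero_mor C A B" c 0] by simp
  then show ?thesis
    by simp
qed

lemma neg_eq_zero_iff [simp]:
  assumes [simp]: "arr f" "src f = A" "tgt f = B"
  shows "neg C f = zero_mor C A B \<longleftrightarrow> f = zero_mor C A B"
proof -
  have "A \<in> obj C" "B \<in> obj C"
    using arr_obj[of f] by simp_all
  then show ?thesis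
    by (simp add: neg_eq_iff)
qed

lemma add_neg_cancel [simp]:
  assumes [simp]: "arr f" "arr g" "src f = src g" "tgt f = tgt g"
  shows "f \<oplus> (g \<oplus> neg C f) = g" and "(g \<oplus> neg C f) \<oplus> f = g" and "(g \<oplus> f) \<oplus> neg C f = g"
    and "f \<oplus> (neg C f \<oplus> g) = g" and "neg C f \<oplus> (f \<oplus> g) = g"
proof -
  show a: "(g \<oplus> neg C f) \<oplus> f = g" "(g \<oplus> f) \<oplus> neg C f = g"
    by (subst add_ac(1); simp)+
  show "f \<oplus> (g \<oplus> neg C f) = g"
    by (subst add_ac(2)) (simp_all add: a)
  show "f \<oplus> (neg C f \<oplus> g) = g" "neg C f \<oplus> (f \<oplus> g) = g"
    by (subst add_ac(1)[symmetric]; simp)+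
qed

end

section \<open>Triangulated categories\<close>

context triangulated_category
begin

abbreviation So where "So \<equiv> shift_ob T"
abbreviation Sm where "Sm \<equiv> shift_mor T"
abbreviation tri where "tri A B D f g h \<equiv> Sextuple A B D f g h \<in> triangles T"

lemma shift_ob_obj [simp]: "A \<in> obj T \<Longrightarrow> So A \<in> obj T"
  using shift unfolding autoequivalence_def lin_endofunctor_def by simp

lemma shift_mor_hom: "f \<in> hom T A B \<Longrightarrow> Sm f \<in> hom T (So A) (So B)"
  using shift unfolding autoequivalence_def lin_endofunctor_def by blast

lemma shift_ident [simp]: "A \<in> obj T \<Longrightarrow> Sm (ident T A) = ident T (So A)"
  using shift unfolding autoequivalence_def lin_endofunctor_def by simp

lemma arr_shift [simp]:
  assumes "arr f"
  shows "arr (Sm f)" and "src (Sm f) = So (src f)" and "tgt (Sm f) = So (tgt f)"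
  using shift_mor_hom[OF arr_hom[OF assms]] by (simp_all add: hom_iff)

lemma shift_comp [simp]:
  assumes "arr g" "arr f" "src g = tgt f"
  shows "Sm (g \<cdot> f) = Sm g \<cdot> Sm f"
proof -
  have "g \<in> hom T (tgt f) (tgt g)" "f \<in> hom T (src f) (tgt f)"
    using assms by (simp_all add: hom_iff)
  then show ?thesis
    using shift unfolding autoequivalence_def lin_endofunctor_def by blast
qed

lemma shift_add [simp]:
  assumes "arr f" "arr g" "src f = src g" "tgt f = tgt g"
  shows "Sm (f \<oplus> g) = Sm f \<oplus> Sm g"
proof -
  have "f \<in> hom T (src g) (tgt g)" "g \<in> hom T (src g) (tgt g)"
    using assms by (simp_all add: hom_iff)
  then show ?thesis
    using shift unfolding autoequivalence_def lin_endofunctor_def by blast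
qed

lemma shift_scale [simp]:
  assumes "arr f"
  shows "Sm (c \<odot> f) = c \<odot> Sm f"
proof -
  have "f \<in> hom T (src f) (tgt f)"
    using assms by (simp add: hom_iff)
  then show ?thesis
    using shift unfolding autoequivalence_def lin_endofunctor_def by blast
qed

lemma shift_zero [simp]:
  assumes [simp]: "A \<in> obj T" "B \<in> obj T"
  shows "Sm (zero_mor T A B) = zero_mor T (So A) (So B)"
  using shift_scale[of "zero_mor T A B" 0] by simp

lemma shift_bij:
  assumes "A \<in> obj T" "B \<in> obj T"
  shows "bij_betw Sm (hom T A B) (hom T (So A) (So B))"
  using assms shift unfolding autoequivalence_def by blast

lemma shift_inject [simp]:
  assumes "arr f" "arr g" "src f = src g" "tgt f = tgt g"
  shows "Sm f = Sm g \<longleftrightarrow> f = g"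
  using bij_betw_imp_inj_on[OF shift_bij[of "src g" "tgt g"]] assms
  by (auto simp: inj_on_def hom_iff)

lemma shift_cancel:
  "\<lbrakk>Sm f = Sm g; arr f; arr g; src f = src g; tgt f = tgt g\<rbrakk> \<Longrightarrow> f = g"
  by simp

lemma shift_fullE:
  assumes "g \<in> hom T (So A) (So B)" "A \<in> obj T" "B \<in> obj T"
  obtains f where "f \<in> hom T A B" "g = Sm f"
  using bij_betw_imp_surj_on[OF shift_bij[of A B]] assms by auto

lemma shift_surjE:
  assumes "B \<in> obj T"
  obtains A f where "A \<in> obj T" "is_iso T (So A) B f"
  using shift assms unfolding autoequivalence_def isomorphic_def by blast

lemma shift_zero_object:
  "zero_object T Z \<Longrightarrow> zero_object T (So Z)"
  using shift_ident[of Z] unfolding zero_object_def by simp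

lemma triD:
  assumes "tri A B D f g h"
  shows "f \<in> hom T A B" "g \<in> hom T B D" "h \<in> hom T D (So A)"
  using triangle_sextuple[OF assms] by (simp_all add: right_sextuple_def)

lemma tri_isoI:
  assumes "tri A B D f g h" "is_iso T A A' a" "is_iso T B B' b" "is_iso T D D' d"
    and "f' \<in> hom T A' B'" "g' \<in> hom T B' D'" "h' \<in> hom T D' (So A')"
    and "b \<cdot> f = f' \<cdot> a" "d \<cdot> g = g' \<cdot> b" "Sm a \<cdot> h = h' \<cdot> d"
  shows "tri A' B' D' f' g' h'"
proof (rule triangle_iso[OF assms(1)])
  show "right_isomorphic T So Sm (Sextuple A B D f g h) (Sextuple A' B' D' f' g' h')"
    unfolding right_isomorphic_def right_morphism_def right_sextuple_def
    using assms triD[OF assms(1)] by (auto simp: is_iso_def)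
qed

lemma is_iso_neg_ident: "A \<in> obj T \<Longrightarrow> is_iso T A A (neg T (ident T A))"
  by (rule is_isoI[of _ _ _ "neg T (ident T A)"]) (simp_all add: hom_iff scale_comp)

lemma tri_neg:
  assumes t: "tri A B D f g h"
  shows "tri A B D (neg T f) (neg T g) h" and "tri A B D f (neg T g) (neg T h)"
    and "tri A B D (neg T f) g (neg T h)"
proof -
  note [simp] = homD[OF triD(1)[OF t]] homD[OF triD(2)[OF t]] homD[OF triD(3)[OF t]]
  note I = is_iso_ident is_iso_neg_ident
  show "tri A B D (neg T f) (neg T g) h"
    by (rule tri_isoI[OF t I(1) I(2) I(1)]) (simp_all add: hom_iff scale_comp)
  show "tri A B D f (neg T g) (neg T h)"
    by (rule tri_isoI[OF t I(1) I(1) I(2)]) (simp_all add: hom_iff scale_comp)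
  show "tri A B D (neg T f) g (neg T h)"
    by (rule tri_isoI[OF t I(2) I(1) I(1)]) (simp_all add: hom_iff scale_comp)
qed

lemma tri_rotate:
  assumes "tri A B D f g h"
  shows "tri B D (So A) g h (neg T (Sm f))"
  using assms TR2 triD[OF assms] by blast

lemma tri_rotate_inv:
  assumes "tri B D (So A) g h (neg T (Sm f))" "f \<in> hom T A B"
  shows "tri A B D f g h"
  using assms TR2 triD[OF assms(1)] by blast

lemma tri_shift:
  assumes t: "tri A B D f g h"
  shows "tri (So A) (So B) (So D) (Sm f) (Sm g) (neg T (Sm h))"
proof -
  note [simp] = homD[OF triD(1)[OF t]] homD[OF triD(2)[OF t]] homD[OF triD(3)[OF t]]
  show ?thesis
    using tri_neg(1)[OF tri_rotate[OF tri_rotate[OF tri_rotate[OF t]]]] by simp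
qed

lemma tri_unshift:
  assumes t: "tri (So A) (So B) (So D) (Sm f) (Sm g) (Sm h)"
    and "f \<in> hom T A B" "g \<in> hom T B D" "h \<in> hom T D (So A)"
  shows "tri A B D f g (neg T h)"
proof -
  note [simp] = homD[OF assms(2)] homD[OF assms(3)] homD[OF assms(4)]
  have "tri D (So A) (So B) (neg T h) (neg T (Sm f)) (neg T (Sm g))"
    by (rule tri_rotate_inv)
      (use tri_neg(1)[OF t] in \<open>simp_all add: hom_iff\<close>)
  from tri_rotate_inv[OF this assms(3)]
  have "tri B D (So A) g (neg T h) (neg T (Sm f))" .
  from tri_rotate_inv[OF this assms(2)] show ?thesis .
qed

lemma ex_zero: obtains Z where "zero_object T Z" "Z \<in> obj T"
  using ex_zero_object by (metis zero_object_def)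

lemma tri_comp_zero:
  assumes t: "tri A B D f g h"
  shows "g \<cdot> f = zero_mor T A D" and "h \<cdot> g = zero_mor T B (So A)"
    and "Sm f \<cdot> h = zero_mor T D (So B)"
proof -
  have *: "g \<cdot> f = zero_mor T A D" if t: "tri A B D f g h" for A B D f g h
  proof -
    note [simp] = homD[OF triD(1)[OF t]] homD[OF triD(2)[OF t]] homD[OF triD(3)[OF t]]
    obtain Z where Z[simp]: "zero_object T Z" "Z \<in> obj T"
      by (rule ex_zero)
    obtain d where "right_morphism T So Sm
      (Sextuple A A Z (ident T A) (zero_mor T A Z) (zero_mor T Z (So A)))
      (Sextuple A B D f g h) (ident T A) f d"
      using TR3[OF TR1_ident[of A Z] t, of "ident T A" f] triD[OF t]
      by (auto simp: ident_hom)
    then have d: "d \<in> hom T Z D" "d \<cdot> zero_mor T A Z = g \<cdot> f"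
      by (simp_all add: right_morphism_def)
    note [simp] = homD[OF d(1)]
    show ?thesis
      using d(2) by simp
  qed
  show "g \<cdot> f = zero_mor T A D" "h \<cdot> g = zero_mor T B (So A)"
    using *[OF t] *[OF tri_rotate[OF t]] by simp_all
  note [simp] = homD[OF triD(1)[OF t]] homD[OF triD(2)[OF t]] homD[OF triD(3)[OF t]]
  have "neg T (Sm f) \<cdot> h = zero_mor T D (So B)"
    using *[OF tri_rotate[OF tri_rotate[OF t]]] by simp
  then show "Sm f \<cdot> h = zero_mor T D (So B)"
    by (simp add: scale_comp)
qed

lemma tri_fill_third:
  assumes t: "tri A B D f g h" and t': "tri A' B' D' f' g' h'"
    and "a \<in> hom T A A'" "b \<in> hom T B B'" "b \<cdot> f = f' \<cdot> a"
  obtains d where "d \<in> hom T D D'" "d \<cdot> g = g' \<cdot> b" "h' \<cdot> d = Sm a \<cdot> h"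
  using TR3[OF t t', of a b] assms by (auto simp: right_morphism_def)

lemma tri_fill_first:
  assumes t: "tri A B D f g h" and t': "tri A' B' D' f' g' h'"
    and b: "b \<in> hom T B B'" and d: "d \<in> hom T D D'" and "d \<cdot> g = g' \<cdot> b"
  obtains a where "a \<in> hom T A A'" "b \<cdot> f = f' \<cdot> a" "h' \<cdot> d = Sm a \<cdot> h"
proof -
  note [simp] = homD[OF triD(1)[OF t]] homD[OF triD(2)[OF t]] homD[OF triD(3)[OF t]]
    homD[OF triD(1)[OF t']] homD[OF triD(2)[OF t']] homD[OF triD(3)[OF t']] homD[OF b] homD[OF d]
  obtain e where e: "e \<in> hom T (So A) (So A')" "e \<cdot> h = h' \<cdot> d"
    "neg T (Sm f') \<cdot> e = Sm b \<cdot> neg T (Sm f)"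
    using tri_fill_third[OF tri_rotate[OF t] tri_rotate[OF t'] b d assms(5)] by blast
  obtain a where a: "a \<in> hom T A A'" "e = Sm a"
    using shift_fullE[OF e(1)] by auto
  note [simp] = homD[OF a(1)]
  have "Sm (f' \<cdot> a) = Sm (b \<cdot> f)"
    using e(3) by (simp add: a scale_comp)
  then have "f' \<cdot> a = b \<cdot> f"
    by (rule shift_cancel) simp_all
  then show ?thesis
    using that[OF a(1)] e(2) a(2) by simp
qed

lemma tri_fill_second:
  assumes t: "tri A B D f g h" and t': "tri A' B' D' f' g' h'"
    and a: "a \<in> hom T A A'" and d: "d \<in> hom T D D'" and eq: "h' \<cdot> d = Sm a \<cdot> h"
  obtains b where "b \<in> hom T B B'" "b \<cdot> f = f' \<cdot> a" "d \<cdot> g = g' \<cdot> b"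
proof -
  note [simp] = homD[OF triD(1)[OF t]] homD[OF triD(2)[OF t]] homD[OF triD(3)[OF t]]
    homD[OF triD(1)[OF t']] homD[OF triD(2)[OF t']] homD[OF triD(3)[OF t']] homD[OF a] homD[OF d]
  obtain b where b: "b \<in> hom T B B'" "d \<cdot> g = g' \<cdot> b"
    "neg T (Sm f') \<cdot> Sm a = Sm b \<cdot> neg T (Sm f)"
    by (rule tri_fill_first[OF tri_rotate[OF t] tri_rotate[OF t'] d shift_mor_hom[OF a] eq[symmetric]])
  note [simp] = homD[OF b(1)]
  have "Sm (b \<cdot> f) = Sm (f' \<cdot> a)"
    using b(3) by (simp add: scale_comp)
  then have "b \<cdot> f = f' \<cdot> a"
    by (rule shift_cancel) simp_all
  then show ?thesis
    using that[OF b(1)] b(2) by simp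
qed

lemma tri_lift:
  assumes t: "tri A B D f g h" and x: "x \<in> hom T W B" and "g \<cdot> x = zero_mor T W D"
  obtains y where "y \<in> hom T W A" "x = f \<cdot> y"
proof -
  note [simp] = homD[OF triD(1)[OF t]] homD[OF triD(2)[OF t]] homD[OF triD(3)[OF t]] homD[OF x]
  obtain Z where Z[simp]: "zero_object T Z" "Z \<in> obj T"
    by (rule ex_zero)
  have i: "tri W W Z (ident T W) (zero_mor T W Z) (zero_mor T Z (So W))"
    by (rule TR1_ident) simp_all
  obtain y where "y \<in> hom T W A" "x \<cdot> ident T W = f \<cdot> y"
    using tri_fill_first[OF i t x, of "zero_mor T Z D"] assms(3) by (auto simp: hom_iff)
  then show ?thesis
    using that by simp
qed

lemma tri_colift:
  assumes t: "tri A B D f g h" and x: "x \<in> hom T B W" and "x \<cdot> f = zero_mor T A W"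
  obtains y where "y \<in> hom T D W" "x = y \<cdot> g"
proof -
  note [simp] = homD[OF triD(1)[OF t]] homD[OF triD(2)[OF t]] homD[OF triD(3)[OF t]] homD[OF x]
  obtain Z where Z[simp]: "zero_object T Z" "Z \<in> obj T"
    by (rule ex_zero)
  have "tri W W (So Z) (ident T W) (zero_mor T W (So Z)) (zero_mor T (So Z) (So W))"
    by (rule TR1_ident) (simp_all add: shift_zero_object)
  then have "tri W W (So Z) (ident T W) (zero_mor T W (So Z)) (neg T (Sm (zero_mor T Z W)))"
    by simp
  then have i: "tri Z W W (zero_mor T Z W) (ident T W) (zero_mor T W (So Z))"
    by (rule tri_rotate_inv) (simp add: hom_iff)
  obtain y where "y \<in> hom T D W" "y \<cdot> g = ident T W \<cdot> x"
    using tri_fill_third[OF t i _ x, of "zero_mor T A Z"] assms(3) by (auto simp: hom_iff)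
  then show ?thesis
    using that by simp
qed

lemmas tri_lift_third = tri_lift[OF tri_rotate]
lemmas tri_colift_third = tri_colift[OF tri_rotate]

lemma tri_lift_shift:
  assumes t: "tri A B D f g h" and x: "x \<in> hom T W (So A)" and "Sm f \<cdot> x = zero_mor T W (So B)"
  obtains y where "y \<in> hom T W D" "x = h \<cdot> y"
proof -
  note [simp] = homD[OF triD(1)[OF t]] homD[OF triD(2)[OF t]] homD[OF triD(3)[OF t]] homD[OF x]
  show ?thesis
    by (rule tri_lift[OF tri_rotate[OF tri_rotate[OF t]] x])
      (use that assms in \<open>simp_all add: scale_comp\<close>)
qed

lemma tri_colift_shift:
  assumes t: "tri A B D f g h" and x: "x \<in> hom T (So A) W" and "x \<cdot> h = zero_mor T D W"
  obtains y where "y \<in> hom T (So B) W" "x = y \<cdot> Sm f"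
proof -
  note [simp] = homD[OF triD(1)[OF t]] homD[OF triD(2)[OF t]] homD[OF triD(3)[OF t]] homD[OF x]
  obtain y where y: "y \<in> hom T (So B) W" "x = y \<cdot> neg T (Sm f)"
    by (rule tri_colift[OF tri_rotate[OF tri_rotate[OF t]] x assms(3)])
  note [simp] = homD[OF y(1)]
  show ?thesis
    by (rule that[of "neg T y"]) (simp_all add: y(2) scale_comp hom_iff)
qed

lemma tri_split:
  assumes t: "tri A B D f g (zero_mor T D (So A))"
  obtains i p where "i \<in> hom T D B" "p \<in> hom T B A" "g \<cdot> i = ident T D" "p \<cdot> f = ident T A"
    "p \<cdot> i = zero_mor T D A" "f \<cdot> p \<oplus> i \<cdot> g = ident T B"
proof -
  note [simp] = homD[OF triD(1)[OF t]] homD[OF triD(2)[OF t]] homD[OF triD(3)[OF t]]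
  obtain i where i: "i \<in> hom T D B" "ident T D = g \<cdot> i"
    by (rule tri_lift_third[OF t, of "ident T D" D]) (simp_all add: hom_iff)
  note [simp] = homD[OF i(1)] i(2)[symmetric]
  have "g \<cdot> (ident T B \<oplus> neg T (i \<cdot> g)) = zero_mor T B D"
    by (simp add: comp_add scale_comp comp_reduce[OF i(2)[symmetric]])
  then obtain p where p: "p \<in> hom T B A" "ident T B \<oplus> neg T (i \<cdot> g) = f \<cdot> p"
    by (rule tri_lift[OF t, rotated]) (simp_all add: hom_iff)
  note [simp] = homD[OF p(1)]
  have sum: "f \<cdot> p \<oplus> i \<cdot> g = ident T B"
    by (simp add: p(2)[symmetric])
  obtain q where q: "q \<in> hom T B A" "ident T A = q \<cdot> f"
  proof -
    show thesis
    proof (rule tri_colift_shift[OF t, of "ident T (So A)" "So A"])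
      show "ident T (So A) \<in> hom T (So A) (So A)"
        by (simp add: ident_hom)
      show "ident T (So A) \<cdot> zero_mor T D (So A) = zero_mor T D (So A)"
        by simp
      fix y assume y: "y \<in> hom T (So B) (So A)" "ident T (So A) = y \<cdot> Sm f"
      obtain q where q: "q \<in> hom T B A" "y = Sm q"
        by (rule shift_fullE[OF y(1)]) simp_all
      note [simp] = homD[OF q(1)]
      have "Sm (ident T A) = Sm (q \<cdot> f)"
        using y(2) q(2) by simp
      then have "ident T A = q \<cdot> f"
        by (subst (asm) shift_inject) simp_all
      with q(1) show thesis
        by (rule that)
    qed
  qed
  note [simp] = homD[OF q(1)]
  have mono: "x = y" if "f \<cdot> x = f \<cdot> y" "x \<in> hom T W A" "y \<in> hom T W A" for x y W
  proof -
    note [simp] = homD[OF that(2)] homD[OF that(3)]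
    have "q \<cdot> (f \<cdot> x) = q \<cdot> (f \<cdot> y)"
      by (simp add: that(1))
    then show ?thesis
      by (simp add: comp_reduce[OF q(2)[symmetric]])
  qed
  have gf[simp]: "g \<cdot> f = zero_mor T A D"
    by (rule tri_comp_zero[OF t])
  have "f \<cdot> (p \<cdot> f) = (f \<cdot> p \<oplus> i \<cdot> g) \<cdot> f"
    by (subst comp_add) (simp_all add: assoc)
  also have "\<dots> = f \<cdot> ident T A"
    unfolding sum by simp
  finally have pf: "p \<cdot> f = ident T A"
    by (rule mono) (simp_all add: hom_iff)
  have "f \<cdot> (p \<cdot> i) \<oplus> i = (f \<cdot> p \<oplus> i \<cdot> g) \<cdot> i"
    by (subst comp_add) (simp_all add: assoc)
  also have "\<dots> = i"
    unfolding sum by simp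
  finally have "i \<oplus> f \<cdot> (p \<cdot> i) = i \<oplus> zero_mor T D B"
    using add_ac(2)[of i "f \<cdot> (p \<cdot> i)"] by simp
  then have "f \<cdot> (p \<cdot> i) = f \<cdot> zero_mor T D A"
    by (subst (asm) add_left_cancel) simp_all
  then have "p \<cdot> i = zero_mor T D A"
    by (rule mono) (simp_all add: hom_iff)
  with i p(1) pf sum show ?thesis
    by (intro that) simp_all
qed

lemma tri_split_direct_sum:
  assumes t: "tri A B D f g (zero_mor T D (So A))"
  shows "direct_sum T B A D"
proof (rule tri_split[OF t])
  fix i p
  assume "i \<in> hom T D B" "p \<in> hom T B A" "g \<cdot> i = ident T D" "p \<cdot> f = ident T A"
    "p \<cdot> i = zero_mor T D A" "f \<cdot> p \<oplus> i \<cdot> g = ident T B"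
  then show ?thesis
    unfolding direct_sum_def using triD[OF t] tri_comp_zero[OF t] by blast
qed

lemma retract_direct_sum:
  assumes s: "s \<in> hom T B M" and r: "r \<in> hom T M B" and rs: "r \<cdot> s = ident T B"
  shows "\<exists>D. direct_sum T M B D"
proof -
  note [simp] = homD[OF s] homD[OF r]
  obtain D g h where t: "tri B M D s g h"
    using TR1_cone[OF s] by blast
  note [simp] = homD[OF triD(2)[OF t]] homD[OF triD(3)[OF t]]
  have "Sm r \<cdot> Sm s = ident T (So B)"
    using arg_cong[OF rs, of Sm] by simp
  then have "h = Sm r \<cdot> (Sm s \<cdot> h)"
    by (simp add: comp_reduce)
  then have "h = zero_mor T D (So B)"
    by (simp add: tri_comp_zero[OF t])
  then show ?thesis
    using tri_split_direct_sum t by blast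
qed

lemma tri_endo_iso:
  assumes t: "tri A B D f g h" and b: "b \<in> hom T B B" "b \<cdot> f = f" "g \<cdot> b = g"
  shows "is_iso T B B b"
proof -
  note [simp] = homD[OF triD(1)[OF t]] homD[OF triD(2)[OF t]] homD[OF triD(3)[OF t]]
    homD[OF b(1)]
  define n where "n = ident T B \<oplus> neg T b"
  have [simp]: "arr n" "src n = B" "tgt n = B"
    by (simp_all add: n_def)
  have "n \<cdot> f = zero_mor T A B" "g \<cdot> n = zero_mor T B D"
    by (simp_all add: n_def comp_add scale_comp b)
  moreover have "n \<in> hom T B B"
    by (simp add: hom_iff)
  ultimately obtain u v where u: "u \<in> hom T D B" "n = u \<cdot> g" and v: "v \<in> hom T B A" "n = f \<cdot> v"
    using tri_colift[OF t] tri_lift[OF t] by metis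
  note [simp] = homD[OF u(1)] homD[OF v(1)]
  have nn: "n \<cdot> n = zero_mor T B B"
  proof -
    have "n \<cdot> n = u \<cdot> (g \<cdot> (f \<cdot> v))"
      using u(2) v(2) by (simp add: assoc)
    then show ?thesis
      by (simp add: comp_reduce[OF tri_comp_zero(1)[OF t]])
  qed
  have b_eq: "b = ident T B \<oplus> neg T n"
    by (simp add: n_def scale_add) 
  show ?thesis
    by (rule is_isoI[of _ _ _ "ident T B \<oplus> n"])
      (simp_all add: b_eq hom_iff comp_add scale_comp nn add_ac)
qed

lemma tri_unrotate:
  assumes t: "tri B C E g m n"
  obtains A f h where "tri A B C f g h" "isomorphic T (So A) E"
proof -
  note [simp] = homD[OF triD(1)[OF t]] homD[OF triD(2)[OF t]] homD[OF triD(3)[OF t]]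
  obtain A \<phi> where A[simp]: "A \<in> obj T" and iso: "is_iso T (So A) E \<phi>"
    by (rule shift_surjE[of E]) simp_all
  then obtain \<psi> where \<phi>: "\<phi> \<in> hom T (So A) E" and \<psi>: "\<psi> \<in> hom T E (So A)"
    and inv: "\<phi> \<cdot> \<psi> = ident T E" and iso': "is_iso T E (So A) \<psi>"
    using is_isoE by metis
  note [simp] = homD[OF \<phi>] homD[OF \<psi>]
  obtain f where f: "f \<in> hom T A B" "n \<cdot> \<phi> = Sm f"
    by (rule shift_fullE[of "n \<cdot> \<phi>" A B]) (simp_all add: hom_iff)
  note [simp] = homD[OF f(1)]
  have "tri B C (So A) g (\<psi> \<cdot> m) (neg T (Sm (neg T f)))"
  proof (rule tri_isoI[OF t is_iso_ident is_iso_ident iso'])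
    show "Sm (ident T B) \<cdot> n = neg T (Sm (neg T f)) \<cdot> \<psi>"
      by (simp add: f(2)[symmetric] assoc inv)
  qed (simp_all add: hom_iff)
  then have "tri A B C (neg T f) g (\<psi> \<cdot> m)"
    by (rule tri_rotate_inv) (simp add: hom_iff)
  then show ?thesis
    using iso by (intro that) (auto simp: isomorphic_def)
qed

lemma tri_cocone:
  assumes k: "k \<in> hom T C (So B)" and B: "B \<in> obj T"
  obtains D g w where "tri B D C g w k"
proof -
  obtain E m n where "tri C (So B) E k m n"
    using TR1_cone[OF k] by blast
  then obtain D w h where t: "tri D C (So B) w k h"
    by (rule tri_unrotate)
  note [simp] = homD[OF triD(1)[OF t]] homD[OF triD(3)[OF t]]
  obtain u where u: "u \<in> hom T B D" "h = Sm u"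
    using shift_fullE[OF triD(3)[OF t] B] by auto
  note [simp] = homD[OF u(1)]
  have "tri D C (So B) w k (neg T (Sm (neg T u)))"
    using t u(2) by simp
  then have "tri B D C (neg T u) w k"
    by (rule tri_rotate_inv) (simp add: hom_iff)
  then show ?thesis
    by (rule that)
qed

lemma tri_extend:
  assumes t: "tri A B D f g h" and x: "x \<in> hom T A W" and "Sm x \<cdot> h = zero_mor T D (So W)"
  obtains y where "y \<in> hom T B W" "x = y \<cdot> f"
proof -
  note [simp] = homD[OF triD(1)[OF t]] homD[OF triD(2)[OF t]] homD[OF triD(3)[OF t]] homD[OF x]
  obtain z where z: "z \<in> hom T (So B) (So W)" "Sm x = z \<cdot> Sm f"
    by (rule tri_colift_shift[OF t shift_mor_hom[OF x] assms(3)])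
  obtain y where y: "y \<in> hom T B W" "z = Sm y"
    by (rule shift_fullE[OF z(1)]) simp_all
  note [simp] = homD[OF y(1)]
  have "Sm x = Sm (y \<cdot> f)"
    using z(2) y(2) by simp
  then have "x = y \<cdot> f"
    by (rule shift_cancel) simp_all
  with y(1) show ?thesis
    by (rule that)
qed

lemma triangle_morphism_ex_iff:
  assumes "s \<in> triangles T" "t \<in> triangles T"
  shows "(\<exists>g. triangle_morphism T s t f g h) \<longleftrightarrow>
    f \<in> hom T (ob1 s) (ob1 t) \<and> h \<in> hom T (ob3 s) (ob3 t) \<and> mor3 t \<cdot> h = Sm f \<cdot> mor3 s"
proof
  assume "\<exists>g. triangle_morphism T s t f g h"
  then show "f \<in> hom T (ob1 s) (ob1 t) \<and> h \<in> hom T (ob3 s) (ob3 t) \<and> mor3 t \<cdot> h = Sm f \<cdot> mor3 s"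
    by (auto simp: right_morphism_def)
next
  assume *: "f \<in> hom T (ob1 s) (ob1 t) \<and> h \<in> hom T (ob3 s) (ob3 t) \<and> mor3 t \<cdot> h = Sm f \<cdot> mor3 s"
  have st: "tri (ob1 s) (ob2 s) (ob3 s) (mor1 s) (mor2 s) (mor3 s)"
    "tri (ob1 t) (ob2 t) (ob3 t) (mor1 t) (mor2 t) (mor3 t)"
    using assms by simp_all
  obtain g where "g \<in> hom T (ob2 s) (ob2 t)" "g \<cdot> mor1 s = mor1 t \<cdot> f" "h \<cdot> mor2 s = mor2 t \<cdot> g"
    using tri_fill_second[OF st, of f h] * by blast
  then show "\<exists>g. triangle_morphism T s t f g h"
    using * triangle_sextuple[OF assms(1)] triangle_sextuple[OF assms(2)]
    by (auto simp: right_morphism_def)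
qed

text \<open>The octahedral axiom for the composite \<open>D \<rightarrow> C \<rightarrow> A[1]\<close>.\<close>

lemma octahedron_cocone:
  assumes t: "tri A X C \<alpha> \<beta> \<gamma>" and s: "tri B D C g w k" and r: "tri A B' D f' g' (neg T (\<gamma> \<cdot> w))"
  obtains u v where "tri B B' X u v (k \<cdot> \<beta>)" "g' \<cdot> u = g" "Sm u \<cdot> k = Sm f' \<cdot> \<gamma>"
proof -
  note [simp] = homD[OF triD(1)[OF t]] homD[OF triD(2)[OF t]] homD[OF triD(3)[OF t]]
    homD[OF triD(1)[OF s]] homD[OF triD(2)[OF s]] homD[OF triD(3)[OF s]]
    homD[OF triD(1)[OF r]] homD[OF triD(2)[OF r]] homD[OF triD(3)[OF r]]
  have "tri D (So A) (So B') (\<gamma> \<cdot> w) (Sm f') (neg T (Sm g'))"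
    using tri_neg(1)[OF tri_rotate[OF tri_rotate[OF r]]] by simp
  from TR4[OF tri_rotate[OF s] tri_rotate[OF tri_rotate[OF t]] this]
  obtain U V where UV: "tri (So B) (So B') (So X) U V (Sm k \<cdot> neg T (Sm \<beta>))"
    and U: "U \<cdot> k = Sm f' \<cdot> \<gamma>" "neg T (Sm g') \<cdot> U = neg T (Sm g)"
    by blast
  obtain u where u: "u \<in> hom T B B'" "U = Sm u"
    by (rule shift_fullE[OF triD(1)[OF UV]]) simp_all
  obtain v where v: "v \<in> hom T B' X" "V = Sm v"
    by (rule shift_fullE[OF triD(2)[OF UV]]) simp_all
  note [simp] = homD[OF u(1)] homD[OF v(1)]
  have "tri (So B) (So B') (So X) (Sm u) (Sm v) (Sm (neg T (k \<cdot> \<beta>)))"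
    using UV by (simp add: u v scale_comp)
  from tri_unshift[OF this u(1) v(1)] have "tri B B' X u v (k \<cdot> \<beta>)"
    by (simp add: hom_iff)
  moreover have "Sm (g' \<cdot> u) = Sm g"
    using U(2) by (simp add: u scale_comp)
  then have "g' \<cdot> u = g"
    by (rule shift_cancel) simp_all
  ultimately show ?thesis
    using that U(1) u(2) by simp
qed

text \<open>The octahedral axiom for the composite \<open>C \<rightarrow> A[1] \<rightarrow> B[1]\<close>.\<close>

lemma octahedron_cone:
  assumes t: "tri A X C \<alpha> \<beta> \<gamma>" and s: "tri A B D f g e" and r: "tri B D' C g' h' (Sm f \<cdot> \<gamma>)"
  obtains u v where "tri X D' D u v (Sm \<alpha> \<cdot> e)" "v \<cdot> g' = g" "e \<cdot> v = neg T (\<gamma> \<cdot> h')"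
proof -
  note [simp] = homD[OF triD(1)[OF t]] homD[OF triD(2)[OF t]] homD[OF triD(3)[OF t]]
    homD[OF triD(1)[OF s]] homD[OF triD(2)[OF s]] homD[OF triD(3)[OF s]]
    homD[OF triD(1)[OF r]] homD[OF triD(2)[OF r]] homD[OF triD(3)[OF r]]
  have "tri C (So A) (So X) \<gamma> (neg T (Sm \<alpha>)) (neg T (Sm \<beta>))"
    "tri C (So B) (So D') (Sm f \<cdot> \<gamma>) (neg T (Sm g')) (neg T (Sm h'))"
    by (rule tri_rotate tri_rotate[OF tri_rotate] t r)+
  from TR4[OF this(1) tri_shift[OF s] this(2)]
  obtain U V where UV: "tri (So X) (So D') (So D) U V (Sm (neg T (Sm \<alpha>)) \<cdot> neg T (Sm e))"
    and V: "V \<cdot> neg T (Sm g') = Sm g" "neg T (Sm e) \<cdot> V = Sm \<gamma> \<cdot> neg T (Sm h')"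
    by blast
  obtain u where u: "u \<in> hom T X D'" "U = Sm u"
    by (rule shift_fullE[OF triD(1)[OF UV]]) simp_all
  obtain v where v: "v \<in> hom T D' D" "V = Sm v"
    by (rule shift_fullE[OF triD(2)[OF UV]]) simp_all
  note [simp] = homD[OF u(1)] homD[OF v(1)]
  have "tri (So X) (So D') (So D) (Sm u) (Sm v) (Sm (Sm \<alpha> \<cdot> e))"
    using UV by (simp add: u v scale_comp)
  from tri_neg(2)[OF tri_unshift[OF this u(1) v(1)]] have "tri X D' D u (neg T v) (Sm \<alpha> \<cdot> e)"
    by (simp add: hom_iff)
  moreover have "Sm (neg T v \<cdot> g') = Sm g"
    using V(1) by (simp add: v scale_comp)
  then have "neg T v \<cdot> g' = g"
    by (rule shift_cancel) simp_all
  moreover have "Sm (e \<cdot> neg T v) = Sm (neg T (\<gamma> \<cdot> h'))"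
    using V(2) by (simp add: v scale_comp)
  then have "e \<cdot> neg T v = neg T (\<gamma> \<cdot> h')"
    by (rule shift_cancel) simp_all
  ultimately show ?thesis
    by (rule that)
qed

end

section \<open>Subfactor categories\<close>

locale subcategory_pair = triangulated_category T
  for T :: "('k::field, 'o, 'm, 'z) tri_category_scheme" (structure) +
  fixes \<X> \<A> :: "'o set"
  assumes X_subcategory: "subcategory T \<X>"
    and A_subcategory: "subcategory T \<A>"
    and X_subset: "\<X> \<subseteq> \<A>"
begin

abbreviation Q where "Q \<equiv> subfactor T \<X> \<A>"
abbreviation cl where "cl \<equiv> quot_class T \<X>"

lemma X_obj: "X \<in> \<X> \<Longrightarrow> X \<in> obj T" and A_obj: "A \<in> \<A> \<Longrightarrow> A \<in> obj T"
  using X_subcategory A_subcategory by (auto simp: subcategory_def)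

lemma X_in_A: "X \<in> \<X> \<Longrightarrow> X \<in> \<A>"
  using X_subset by blast

lemma A_summand: "\<lbrakk>direct_sum T S A B; S \<in> \<A>\<rbrakk> \<Longrightarrow> A \<in> \<A> \<and> B \<in> \<A>"
  using A_subcategory unfolding subcategory_def by metis

lemma A_direct_sum: "\<lbrakk>direct_sum T S A B; A \<in> \<A>; B \<in> \<A>\<rbrakk> \<Longrightarrow> S \<in> \<A>"
  using A_subcategory unfolding subcategory_def by metis

lemma A_isomorphic: "\<lbrakk>isomorphic T A B; A \<in> \<A>\<rbrakk> \<Longrightarrow> B \<in> \<A>"
  using A_subcategory unfolding subcategory_def by metis

definition null where
  "null n \<longleftrightarrow> (\<exists>X \<in> \<X>. \<exists>u v. arr u \<and> arr v \<and> tgt u = X \<and> src v = X \<and> n = v \<cdot> u)"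

lemma nullI: "\<lbrakk>X \<in> \<X>; u \<in> hom T A X; v \<in> hom T X B\<rbrakk> \<Longrightarrow> null (v \<cdot> u)"
  unfolding null_def by (metis homD)

lemma nullE:
  assumes "null n" "n \<in> hom T A B"
  obtains X u v where "X \<in> \<X>" "u \<in> hom T A X" "v \<in> hom T X B" "n = v \<cdot> u"
proof -
  from assms(1) obtain X u v where
    uv: "X \<in> \<X>" "arr u" "arr v" "tgt u = X" "src v = X" "n = v \<cdot> u"
    unfolding null_def by blast
  with assms(2) show ?thesis
    by (intro that[of X u v]) (simp_all add: hom_iff)
qed

lemma null_arr [simp]: "null n \<Longrightarrow> arr n"
  unfolding null_def by auto

lemma null_comp:
  assumes n: "null n" and f: "arr f"
  shows "src f = tgt n \<Longrightarrow> null (f \<cdot> n)" and "tgt f = src n \<Longrightarrow> null (n \<cdot> f)"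
proof -
  obtain A B where nAB: "n \<in> hom T A B"
    using arr_hom[OF null_arr[OF n]] by blast
  obtain X u v where X: "X \<in> \<X>" and uv: "u \<in> hom T A X" "v \<in> hom T X B" "n = v \<cdot> u"
    using n nAB by (rule nullE)
  note [simp] = homD[OF uv(1)] homD[OF uv(2)] f
  show "null (f \<cdot> n)" if "src f = tgt n"
  proof -
    have [simp]: "src f = B"
      using that uv(3) by simp
    have "null ((f \<cdot> v) \<cdot> u)"
      using nullI[OF X uv(1), of "f \<cdot> v" "tgt f"] by (simp add: hom_iff)
    then show ?thesis
      using uv(3) by (simp add: assoc)
  qed
  show "null (n \<cdot> f)" if "tgt f = src n"
  proof -
    have [simp]: "tgt f = A"
      using that uv(3) by simp
    have "null (v \<cdot> (u \<cdot> f))"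
      using nullI[OF X _ uv(2), of "u \<cdot> f" "src f"] by (simp add: hom_iff)
    then show ?thesis
      using uv(3) by (simp add: assoc)
  qed
qed

lemma null_scale:
  assumes n: "null n"
  shows "null (c \<odot> n)"
proof -
  obtain A B where nAB: "n \<in> hom T A B"
    using arr_hom[OF null_arr[OF n]] by blast
  obtain X u v where X: "X \<in> \<X>" and uv: "u \<in> hom T A X" "v \<in> hom T X B" "n = v \<cdot> u"
    using n nAB by (rule nullE)
  note [simp] = homD[OF uv(1)] homD[OF uv(2)]
  have "null ((c \<odot> v) \<cdot> u)"
    using nullI[OF X uv(1), of "c \<odot> v" B] by (simp add: hom_iff)
  then show ?thesis
    using uv(3) by (simp add: scale_comp)
qed

lemma null_zero:
  assumes [simp]: "A \<in> obj T" "B \<in> obj T"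
  shows "null (zero_mor T A B)"
proof -
  obtain Z where Z: "zero_object T Z" and [simp]: "Z \<in> obj T"
    by (rule ex_zero)
  have "Z \<in> \<X>"
    using X_subcategory Z unfolding subcategory_def by metis
  then have "null (zero_mor T Z B \<cdot> zero_mor T A Z)"
    by (rule nullI[of _ _ A _ B]) (simp_all add: hom_iff)
  then show ?thesis
    by simp
qed

lemma null_add:
  assumes n: "null n" "null n'" and par: "src n = src n'" "tgt n = tgt n'"
  shows "null (n \<oplus> n')"
proof -
  obtain A B where nAB: "n \<in> hom T A B" "n' \<in> hom T A B"
    using arr_hom[OF null_arr[OF n(1)]] arr_hom[OF null_arr[OF n(2)]] unfolding par by blast
  obtain X u v where X: "X \<in> \<X>" and uv: "u \<in> hom T A X" "v \<in> hom T X B" "n = v \<cdot> u"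
    using n(1) nAB(1) by (rule nullE)
  obtain Y w z where Y: "Y \<in> \<X>" and wz: "w \<in> hom T A Y" "z \<in> hom T Y B" "n' = z \<cdot> w"
    using n(2) nAB(2) by (rule nullE)
  note [simp] = homD[OF uv(1)] homD[OF uv(2)] homD[OF wz(1)] homD[OF wz(2)]
    homD[OF nAB(1)] homD[OF nAB(2)]
  obtain S where S: "direct_sum T S X Y"
    using ex_direct_sum[OF X_obj[OF X] X_obj[OF Y]] by blast
  then obtain i j p q where i: "i \<in> hom T X S" and j: "j \<in> hom T Y S" and p: "p \<in> hom T S X"
    and q: "q \<in> hom T S Y" and pi: "p \<cdot> i = ident T X" "q \<cdot> j = ident T Y"
      "p \<cdot> j = zero_mor T Y X" "q \<cdot> i = zero_mor T X Y"
    unfolding direct_sum_def by blast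
  note [simp] = homD[OF i] homD[OF j] homD[OF p] homD[OF q]
  have "S \<in> \<X>"
    using X_subcategory S X Y unfolding subcategory_def by metis
  then have "null ((v \<cdot> p \<oplus> z \<cdot> q) \<cdot> (i \<cdot> u \<oplus> j \<cdot> w))"
    by (rule nullI[of _ _ A _ B]) (simp_all add: hom_iff)
  also have "(v \<cdot> p \<oplus> z \<cdot> q) \<cdot> (i \<cdot> u \<oplus> j \<cdot> w) = n \<oplus> n'"
    by (simp add: comp_add assoc comp_reduce[OF pi(1)] comp_reduce[OF pi(2)] comp_reduce[OF pi(3)]
        comp_reduce[OF pi(4)] uv(3)[symmetric] wz(3)[symmetric])
  finally show ?thesis .
qed

lemma in_cl_iff:
  assumes "f \<in> hom T A B"
  shows "f' \<in> cl f \<longleftrightarrow> (\<exists>n \<in> hom T A B. null n \<and> f' = f \<oplus> n)"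
proof -
  note [simp] = homD[OF assms]
  have "f' \<in> cl f \<longleftrightarrow> (\<exists>X \<in> \<X>. \<exists>u \<in> hom T A X. \<exists>v \<in> hom T X B. f' = f \<oplus> v \<cdot> u)"
    unfolding quot_class_def by (auto simp: hom_iff)
  also have "\<dots> \<longleftrightarrow> (\<exists>n \<in> hom T A B. null n \<and> f' = f \<oplus> n)"
  proof
    assume "\<exists>X \<in> \<X>. \<exists>u \<in> hom T A X. \<exists>v \<in> hom T X B. f' = f \<oplus> v \<cdot> u"
    then obtain X u v where "X \<in> \<X>" "u \<in> hom T A X" "v \<in> hom T X B" "f' = f \<oplus> v \<cdot> u"
      by blast
    then show "\<exists>n \<in> hom T A B. null n \<and> f' = f \<oplus> n"
      using nullI[of X u A v B] comp_hom[of v X B u A] by (intro bexI[of _ "v \<cdot> u"]) simp_all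
  next
    assume "\<exists>n \<in> hom T A B. null n \<and> f' = f \<oplus> n"
    then obtain n where "n \<in> hom T A B" "null n" and f': "f' = f \<oplus> n"
      by blast
    then obtain X u v where "X \<in> \<X>" "u \<in> hom T A X" "v \<in> hom T X B" "n = v \<cdot> u"
      using nullE by metis
    then show "\<exists>X \<in> \<X>. \<exists>u \<in> hom T A X. \<exists>v \<in> hom T X B. f' = f \<oplus> v \<cdot> u"
      unfolding f' by blast
  qed
  finally show ?thesis .
qed

lemma in_cl_self:
  assumes "f \<in> hom T A B"
  shows "f \<in> cl f"
  unfolding in_cl_iff[OF assms] using assms homD[OF assms] null_zero[of A B]
  by (intro bexI[of _ "zero_mor T A B"]) (simp_all add: hom_iff)

lemma cl_arrD: "f' \<in> cl f \<Longrightarrow> arr f"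
  unfolding quot_class_def by (auto simp: hom_iff)

lemma in_clD:
  assumes "f' \<in> cl f" "f \<in> hom T A B"
  shows "f' \<in> hom T A B"
  using assms add_hom by (auto simp: in_cl_iff)

lemma in_cl_iff_diff:
  assumes "f \<in> hom T A B" "g \<in> hom T A B"
  shows "g \<in> cl f \<longleftrightarrow> null (g \<oplus> neg T f)"
proof
  note [simp] = homD[OF assms(1)] homD[OF assms(2)]
  assume "g \<in> cl f"
  then obtain n where n: "n \<in> hom T A B" "null n" "g = f \<oplus> n"
    unfolding in_cl_iff[OF assms(1)] by blast
  have "g \<oplus> neg T f = n"
    using homD[OF n(1)] by (simp add: n(3) add_ac(2)[of f n])
  then show "null (g \<oplus> neg T f)"
    using n by simp
next
  note [simp] = homD[OF assms(1)] homD[OF assms(2)]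
  assume "null (g \<oplus> neg T f)"
  then show "g \<in> cl f"
    unfolding in_cl_iff[OF assms(1)]
    by (intro bexI[of _ "g \<oplus> neg T f"]) (simp_all add: hom_iff)
qed

lemma cl_add_null:
  assumes f: "f \<in> hom T A B" and n: "n \<in> hom T A B" "null n"
  shows "cl (f \<oplus> n) = cl f"
proof -
  note [simp] = homD[OF f] homD[OF n(1)]
  have sub: "cl (f \<oplus> n) \<subseteq> cl f" if f: "f \<in> hom T A B" and n: "n \<in> hom T A B" "null n" for f n
  proof
    fix h
    assume h: "h \<in> cl (f \<oplus> n)"
    then obtain m where m: "m \<in> hom T A B" "null m" "h = (f \<oplus> n) \<oplus> m"
      unfolding in_cl_iff[OF add_hom[OF f n(1)]] by blast
    note [simp] = homD[OF f] homD[OF n(1)] homD[OF m(1)]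
    have "null (n \<oplus> m)"
      using m n by (intro null_add) simp_all
    moreover have "h = f \<oplus> (n \<oplus> m)"
      by (simp add: m(3) add_ac(1))
    ultimately show "h \<in> cl f"
      unfolding in_cl_iff[OF f] by (intro bexI[of _ "n \<oplus> m"]) (simp_all add: hom_iff)
  qed
  have "cl ((f \<oplus> n) \<oplus> neg T n) \<subseteq> cl (f \<oplus> n)"
    by (rule sub) (simp_all add: hom_iff null_scale n)
  then show ?thesis
    using sub[OF f n] by simp
qed

lemma cl_eq_iff:
  assumes f: "f \<in> hom T A B"
  shows "cl g = cl f \<longleftrightarrow> g \<in> cl f"
proof
  assume "g \<in> cl f"
  then obtain n where n: "n \<in> hom T A B" "null n" "g = f \<oplus> n"
    unfolding in_cl_iff[OF f] by blast
  then show "cl g = cl f"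
    using cl_add_null[OF f] by simp
next
  assume *: "cl g = cl f"
  then have "arr g"
    using in_cl_self[OF f] cl_arrD[of f g] by simp
  then show "g \<in> cl f"
    using in_cl_self[OF arr_hom, of g] * by simp
qed

lemma cl_eq_hom:
  "\<lbrakk>cl g = cl f; f \<in> hom T A B\<rbrakk> \<Longrightarrow> g \<in> hom T A B"
  using cl_eq_iff in_clD by blast

lemma cl_eqE:
  assumes "cl g = cl f" "f \<in> hom T A B"
  obtains n where "n \<in> hom T A B" "null n" "g = f \<oplus> n"
  using assms cl_eq_iff in_cl_iff by blast

lemma cl_eqI:
  assumes "f \<in> hom T A B" "g \<in> hom T A B" "null (g \<oplus> neg T f)"
  shows "cl g = cl f"
  using assms cl_eq_iff in_cl_iff_diff by blast

lemma UN_classes_eq: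
  assumes "\<And>i. i \<in> I \<Longrightarrow> F i = c" "i \<in> I"
  shows "(\<Union>i \<in> I. F i) = c"
  using assms by blast

lemma cl_comp:
  assumes g: "g \<in> hom T B D" and f: "f \<in> hom T A B"
  shows "cl g \<cdot>\<^bsub>Q\<^esub> cl f = cl (g \<cdot> f)"
proof -
  have *: "cl (g' \<cdot> f') = cl (g \<cdot> f)" if g': "g' \<in> cl g" and f': "f' \<in> cl f" for f' g'
  proof -
    obtain n where n: "n \<in> hom T B D" "null n" "g' = g \<oplus> n"
      using g' unfolding in_cl_iff[OF g] by blast
    obtain m where m: "m \<in> hom T A B" "null m" "f' = f \<oplus> m"
      using f' unfolding in_cl_iff[OF f] by blast
    note [simp] = homD[OF f] homD[OF g] homD[OF m(1)] homD[OF n(1)]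
    have "null (g \<cdot> m \<oplus> n \<cdot> (f \<oplus> m))"
      using m(2) n(2) by (intro null_add null_comp) simp_all
    moreover have "g' \<cdot> f' = g \<cdot> f \<oplus> (g \<cdot> m \<oplus> n \<cdot> (f \<oplus> m))"
      by (simp add: m(3) n(3) comp_add add_ac(1) add_left_commute[of "n \<cdot> f" "g \<cdot> m"])
    ultimately show ?thesis
      using cl_add_null[of "g \<cdot> f" A D] by (simp add: hom_iff)
  qed
  have "(\<Union>f' \<in> cl f. cl (g' \<cdot> f')) = cl (g \<cdot> f)" if "g' \<in> cl g" for g'
    using *[OF that] in_cl_self[OF f] by (rule UN_classes_eq)
  then have "(\<Union>g' \<in> cl g. \<Union>f' \<in> cl f. cl (g' \<cdot> f')) = cl (g \<cdot> f)"
    using in_cl_self[OF g] by (rule UN_classes_eq)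
  then show ?thesis
    by (simp add: subfactor_def)
qed

lemma comp_cl [simp]: "\<lbrakk>arr g; arr f; src g = tgt f\<rbrakk> \<Longrightarrow> cl g \<cdot>\<^bsub>Q\<^esub> cl f = cl (g \<cdot> f)"
  by (rule cl_comp[of _ "tgt f" "tgt g" _ "src f"]) (simp_all add: hom_iff)

lemma add_cl:
  assumes f: "f \<in> hom T A B" and g: "g \<in> hom T A B"
  shows "cl f \<oplus>\<^bsub>Q\<^esub> cl g = cl (f \<oplus> g)"
proof -
  have *: "cl (f' \<oplus> g') = cl (f \<oplus> g)" if f': "f' \<in> cl f" and g': "g' \<in> cl g" for f' g'
  proof -
    obtain n where n: "n \<in> hom T A B" "null n" "g' = g \<oplus> n"
      using g' unfolding in_cl_iff[OF g] by blast
    obtain m where m: "m \<in> hom T A B" "null m" "f' = f \<oplus> m"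
      using f' unfolding in_cl_iff[OF f] by blast
    note [simp] = homD[OF f] homD[OF g] homD[OF m(1)] homD[OF n(1)]
    have "null (m \<oplus> n)"
      using m(2) n(2) by (intro null_add) simp_all
    moreover have "f' \<oplus> g' = (f \<oplus> g) \<oplus> (m \<oplus> n)"
      by (simp add: m(3) n(3) add_ac(1) add_left_commute[of m g n])
    ultimately show ?thesis
      using cl_add_null[of "f \<oplus> g" A B] by (simp add: hom_iff)
  qed
  have "(\<Union>g' \<in> cl g. cl (f' \<oplus> g')) = cl (f \<oplus> g)" if "f' \<in> cl f" for f'
    using *[OF that] in_cl_self[OF g] by (rule UN_classes_eq)
  then have "(\<Union>f' \<in> cl f. \<Union>g' \<in> cl g. cl (f' \<oplus> g')) = cl (f \<oplus> g)"
    using in_cl_self[OF f] by (rule UN_classes_eq)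
  then show ?thesis
    by (simp add: subfactor_def)
qed

lemma scale_cl:
  assumes f: "f \<in> hom T A B"
  shows "c \<odot>\<^bsub>Q\<^esub> cl f = cl (c \<odot> f)"
proof -
  note [simp] = homD[OF f]
  have "cl (c \<odot> f') = cl (c \<odot> f)" if f': "f' \<in> cl f" for f'
  proof -
    obtain m where m: "m \<in> hom T A B" "null m" "f' = f \<oplus> m"
      using f' unfolding in_cl_iff[OF f] by blast
    note [simp] = homD[OF m(1)]
    show ?thesis
      using cl_add_null[of "c \<odot> f" A B "c \<odot> m"] null_scale[OF m(2)]
      by (simp add: m(3) hom_iff scale_add)
  qed
  then have "(\<Union>f' \<in> cl f. cl (c \<odot> f')) = cl (c \<odot> f)"
    using in_cl_self[OF f] by (rule UN_classes_eq)
  then show ?thesis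
    by (simp add: subfactor_def)
qed

lemma obj_Q [simp]: "obj Q = \<A>"
  by (simp add: subfactor_def)

lemma ident_Q [simp]: "ident Q A = cl (ident T A)"
  by (simp add: subfactor_def)

lemma hom_Q_iff: "\<phi> \<in> hom Q A B \<longleftrightarrow> A \<in> \<A> \<and> B \<in> \<A> \<and> (\<exists>f \<in> hom T A B. \<phi> = cl f)"
  by (auto simp: subfactor_def)

lemma hom_QI: "\<lbrakk>f \<in> hom T A B; A \<in> \<A>; B \<in> \<A>\<rbrakk> \<Longrightarrow> cl f \<in> hom Q A B"
  by (auto simp: hom_Q_iff)

lemma hom_QE:
  assumes "\<phi> \<in> hom Q A B"
  obtains f where "f \<in> hom T A B" "\<phi> = cl f" "A \<in> \<A>" "B \<in> \<A>"
  using assms by (auto simp: hom_Q_iff)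

lemma cl_in_hom_QD:
  assumes "cl f \<in> hom Q A B"
  shows "f \<in> hom T A B" and "A \<in> \<A>" and "B \<in> \<A>"
  using assms cl_eq_hom by (metis hom_QE)+

sublocale Q: category Q
proof
  show "A \<in> obj Q \<and> B \<in> obj Q" if "\<phi> \<in> hom Q A B" for \<phi> A B
    using that by (simp add: hom_Q_iff)
  show "A = A' \<and> B = B'" if "\<phi> \<in> hom Q A B" "\<phi> \<in> hom Q A' B'" for \<phi> A B A' B'
    using that by (metis hom_QE cl_in_hom_QD(1) hom_disjoint)
  show "ident Q A \<in> hom Q A A" if "A \<in> obj Q" for A
    using that by (auto intro!: hom_QI ident_hom A_obj)
  show "\<psi> \<cdot>\<^bsub>Q\<^esub> \<phi> \<in> hom Q A D" if "\<psi> \<in> hom Q B D" "\<phi> \<in> hom Q A B" for \<psi> \<phi> A B D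
    using that by (elim hom_QE) (auto simp: hom_iff intro!: hom_QI)
  show "ident Q B \<cdot>\<^bsub>Q\<^esub> \<phi> = \<phi>" if "\<phi> \<in> hom Q A B" for \<phi> A B
    using that by (elim hom_QE) (auto simp: hom_iff)
  show "\<phi> \<cdot>\<^bsub>Q\<^esub> ident Q A = \<phi>" if "\<phi> \<in> hom Q A B" for \<phi> A B
    using that by (elim hom_QE) (auto simp: hom_iff)
  show "\<chi> \<cdot>\<^bsub>Q\<^esub> \<psi> \<cdot>\<^bsub>Q\<^esub> \<phi> = \<chi> \<cdot>\<^bsub>Q\<^esub> (\<psi> \<cdot>\<^bsub>Q\<^esub> \<phi>)"
    if "\<chi> \<in> hom Q D E" "\<psi> \<in> hom Q B D" "\<phi> \<in> hom Q A B" for \<chi> \<psi> \<phi> A B D E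
    using that by (elim hom_QE) (auto simp: hom_iff assoc)
qed

lemma is_iso_Q_iff:
  assumes f: "f \<in> hom T A B" and "A \<in> \<A>" "B \<in> \<A>"
  shows "is_iso Q A B (cl f) \<longleftrightarrow>
    (\<exists>g \<in> hom T B A. cl (g \<cdot> f) = cl (ident T A) \<and> cl (f \<cdot> g) = cl (ident T B))"
proof
  note [simp] = homD[OF f]
  assume "is_iso Q A B (cl f)"
  then obtain \<phi> where \<phi>: "\<phi> \<in> hom Q B A" "\<phi> \<cdot>\<^bsub>Q\<^esub> cl f = cl (ident T A)"
    "cl f \<cdot>\<^bsub>Q\<^esub> \<phi> = cl (ident T B)"
    unfolding is_iso_def by auto
  obtain g where g: "g \<in> hom T B A" "\<phi> = cl g"
    using \<phi>(1) by (rule hom_QE)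
  note [simp] = homD[OF g(1)]
  show "\<exists>g \<in> hom T B A. cl (g \<cdot> f) = cl (ident T A) \<and> cl (f \<cdot> g) = cl (ident T B)"
    using \<phi> g by auto
next
  note [simp] = homD[OF f]
  assume "\<exists>g \<in> hom T B A. cl (g \<cdot> f) = cl (ident T A) \<and> cl (f \<cdot> g) = cl (ident T B)"
  then obtain g where g: "g \<in> hom T B A" "cl (g \<cdot> f) = cl (ident T A)" "cl (f \<cdot> g) = cl (ident T B)"
    by blast
  note [simp] = homD[OF g(1)]
  show "is_iso Q A B (cl f)"
    by (rule Q.is_isoI[of _ _ _ "cl g"]) (use assms g in \<open>simp_all add: hom_QI\<close>)
qed

lemma split_epi_Q_iso:
  assumes t: "tri X M D u v (zero_mor T D (So X))" and X: "X \<in> \<X>" and "M \<in> \<A>" "D \<in> \<A>"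
  shows "is_iso Q M D (cl v)"
proof -
  note [simp] = homD[OF triD(1)[OF t]] homD[OF triD(2)[OF t]]
  obtain i p where i: "i \<in> hom T D M" and p: "p \<in> hom T M X" and
    eq: "v \<cdot> i = ident T D" "u \<cdot> p \<oplus> i \<cdot> v = ident T M"
    by (rule tri_split[OF t])
  note [simp] = homD[OF i] homD[OF p]
  have "cl (i \<cdot> v \<oplus> u \<cdot> p) = cl (i \<cdot> v)"
    by (rule cl_add_null[of _ M M]) (simp_all add: nullI[OF X p triD(1)[OF t]] hom_iff)
  moreover have "i \<cdot> v \<oplus> u \<cdot> p = ident T M"
    using eq(2) by (simp add: add_ac(2)[of "i \<cdot> v"])
  ultimately show ?thesis
    using assms(3,4) by (subst is_iso_Q_iff[OF triD(2)[OF t]]) (auto intro!: bexI[OF _ i] simp: eq(1))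
qed

lemma split_mono_Q_iso:
  assumes t: "tri K M X u v (zero_mor T X (So K))" and X: "X \<in> \<X>" and "M \<in> \<A>" "K \<in> \<A>"
  shows "is_iso Q K M (cl u)"
proof -
  note [simp] = homD[OF triD(1)[OF t]] homD[OF triD(2)[OF t]]
  obtain i p where i: "i \<in> hom T X M" and p: "p \<in> hom T M K" and
    eq: "p \<cdot> u = ident T K" "u \<cdot> p \<oplus> i \<cdot> v = ident T M"
    by (rule tri_split[OF t])
  note [simp] = homD[OF i] homD[OF p]
  have "cl (u \<cdot> p \<oplus> i \<cdot> v) = cl (u \<cdot> p)"
    by (rule cl_add_null[of _ M M]) (simp_all add: nullI[OF X triD(2)[OF t] i] hom_iff)
  then show ?thesis
    using assms(3,4) eq(2)
    by (subst is_iso_Q_iff[OF triD(1)[OF t]]) (auto intro!: bexI[OF _ p] simp: eq(1))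
qed

end

section \<open>The Frobenius structure of an extension closed mutation pair\<close>

locale frobenius_pair = subcategory_pair +
  assumes A_extension_closed: "extension_closed T \<A>"
    and X_shift_A: "\<lbrakk>f \<in> hom T X (So A); X \<in> \<X>; A \<in> \<A>\<rbrakk> \<Longrightarrow> f = zero_mor T X (So A)"
    and A_shift_X: "\<lbrakk>f \<in> hom T A (So X); A \<in> \<A>; X \<in> \<X>\<rbrakk> \<Longrightarrow> f = zero_mor T A (So X)"
    and enough_injectives: "A \<in> \<A> \<Longrightarrow> \<exists>X \<in> \<X>. \<exists>B \<in> \<A>. \<exists>a b d. tri A X B a b d"
    and enough_projectives: "B \<in> \<A> \<Longrightarrow> \<exists>X \<in> \<X>. \<exists>A \<in> \<A>. \<exists>a b d. tri A X B a b d"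
begin

lemma A_extension: "\<lbrakk>tri A B D f g h; A \<in> \<A>; D \<in> \<A>\<rbrakk> \<Longrightarrow> B \<in> \<A>"
  using A_extension_closed unfolding extension_closed_def by blast

lemma connecting_null:
  assumes d: "d \<in> hom T D (So A)" and "A \<in> \<A>" and n: "null n" "n \<in> hom T W D"
  shows "d \<cdot> n = zero_mor T W (So A)"
proof -
  obtain X u v where X: "X \<in> \<X>" and uv: "u \<in> hom T W X" "v \<in> hom T X D" "n = v \<cdot> u"
    using n by (rule nullE)
  note [simp] = homD[OF d] homD[OF uv(1)] homD[OF uv(2)]
  have "d \<cdot> v = zero_mor T X (So A)"
    using X assms(2) by (intro X_shift_A) (simp_all add: hom_iff)
  then show ?thesis
    by (simp add: uv(3) comp_reduce)
qed

lemma shift_null_connecting: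
  assumes d: "d \<in> hom T D (So A)" and "D \<in> \<A>" and n: "null n" "n \<in> hom T A W"
  shows "Sm n \<cdot> d = zero_mor T D (So W)"
proof -
  obtain X u v where X: "X \<in> \<X>" and uv: "u \<in> hom T A X" "v \<in> hom T X W" "n = v \<cdot> u"
    using n by (rule nullE)
  note [simp] = homD[OF d] homD[OF uv(1)] homD[OF uv(2)]
  have "Sm u \<cdot> d = zero_mor T D (So X)"
    using X assms(2) by (intro A_shift_X) (simp_all add: hom_iff)
  then show ?thesis
    by (simp add: uv(3) assoc)
qed

lemma left_approximation_tri:
  assumes t: "tri A X B a b d" and "B \<in> \<A>" "X \<in> \<X>"
  shows "left_approximation T \<X> A X a"
  unfolding left_approximation_def
proof (intro conjI ballI)
  fix Y f
  assume Y: "Y \<in> \<X>" and f: "f \<in> hom T A Y"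
  note [simp] = homD[OF triD(3)[OF t]] homD[OF f]
  have "Sm f \<cdot> d = zero_mor T B (So Y)"
    using Y assms(2) by (intro A_shift_X) (simp_all add: hom_iff)
  then show "\<exists>g \<in> hom T X Y. f = g \<cdot> a"
    using tri_extend[OF t f] by metis
qed (use assms triD[OF t] in auto)

lemma right_approximation_tri:
  assumes t: "tri A X B a b d" and "A \<in> \<A>" "X \<in> \<X>"
  shows "right_approximation T \<X> B X b"
  unfolding right_approximation_def
proof (intro conjI ballI)
  fix Y f
  assume Y: "Y \<in> \<X>" and f: "f \<in> hom T Y B"
  note [simp] = homD[OF triD(3)[OF t]] homD[OF f]
  have "d \<cdot> f = zero_mor T Y (So A)"
    using Y assms(2) by (intro X_shift_A) (simp_all add: hom_iff)
  then show "\<exists>g \<in> hom T Y X. f = b \<cdot> g"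
    using tri_lift_third[OF t f] by metis
qed (use assms triD[OF t] in auto)

lemma X_functorially_finite: "functorially_finite T \<X> \<A>"
  unfolding functorially_finite_def
  using enough_injectives enough_projectives left_approximation_tri right_approximation_tri
  by metis

lemma cones_in_A: "X_monics_have_cones T \<X> \<A>"
  unfolding X_monics_have_cones_def
proof (intro ballI allI impI)
  fix A B D f g h
  assume AB: "A \<in> \<A>" "B \<in> \<A>" and f: "X_monic T \<X> A B f" and s: "tri A B D f g h"
  obtain X C \<alpha> \<beta> \<gamma> where X: "X \<in> \<X>" and C: "C \<in> \<A>" and t: "tri A X C \<alpha> \<beta> \<gamma>"
    using enough_injectives[OF AB(1)] by blast
  note [simp] = homD[OF triD(1)[OF t]] homD[OF triD(2)[OF t]] homD[OF triD(3)[OF t]]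
    homD[OF triD(1)[OF s]] homD[OF triD(2)[OF s]] homD[OF triD(3)[OF s]]
  obtain D' g' h' where r: "tri B D' C g' h' (Sm f \<cdot> \<gamma>)"
    by (rule tri_cocone[of "Sm f \<cdot> \<gamma>" C B]) (simp_all add: hom_iff)
  obtain u v where uv: "tri X D' D u v (Sm \<alpha> \<cdot> h)"
    by (rule octahedron_cone[OF t s r])
  have "\<alpha> \<in> (\<lambda>\<phi>. \<phi> \<cdot> f) ` hom T B X"
    using f X triD(1)[OF t] unfolding X_monic_def by blast
  then obtain \<phi> where \<phi>: "\<phi> \<in> hom T B X" "\<alpha> = \<phi> \<cdot> f"
    by blast
  note [simp] = homD[OF \<phi>(1)]
  have "Sm \<alpha> \<cdot> h = zero_mor T D (So X)"
    by (simp add: \<phi>(2) assoc tri_comp_zero[OF s])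
  then have "direct_sum T D' X D"
    using uv tri_split_direct_sum by metis
  then show "D \<in> \<A>"
    using A_summand A_extension[OF r AB(2) C] by blast
qed

lemma cocones_in_A: "X_epics_have_cocones T \<X> \<A>"
  unfolding X_epics_have_cocones_def
proof (intro ballI allI impI)
  fix B D K f g h
  assume BD: "B \<in> \<A>" "D \<in> \<A>" and f: "X_epic T \<X> B D f" and s: "tri K B D g f h"
  obtain X C \<alpha> \<beta> \<gamma> where X: "X \<in> \<X>" and C: "C \<in> \<A>" and t: "tri C X D \<alpha> \<beta> \<gamma>"
    using enough_projectives[OF BD(2)] by blast
  note [simp] = homD[OF triD(1)[OF t]] homD[OF triD(2)[OF t]] homD[OF triD(3)[OF t]]
    homD[OF triD(1)[OF s]] homD[OF triD(2)[OF s]] homD[OF triD(3)[OF s]]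
  obtain B' f' g' where r: "tri C B' B f' g' (neg T (\<gamma> \<cdot> f))"
    by (rule tri_cocone[of "neg T (\<gamma> \<cdot> f)" B C]) (simp_all add: hom_iff)
  obtain u v where uv: "tri K B' X u v (h \<cdot> \<beta>)"
    by (rule octahedron_cocone[OF t s r])
  have "\<beta> \<in> (\<lambda>\<phi>. f \<cdot> \<phi>) ` hom T X B"
    using f X triD(2)[OF t] unfolding X_epic_def by blast
  then obtain \<phi> where \<phi>: "\<phi> \<in> hom T X B" "\<beta> = f \<cdot> \<phi>"
    by blast
  note [simp] = homD[OF \<phi>(1)]
  have "h \<cdot> \<beta> = zero_mor T X (So K)"
    by (simp add: \<phi>(2) comp_reduce[OF tri_comp_zero(2)[OF s]])
  then have "direct_sum T B' K X"
    using uv tri_split_direct_sum by metis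
  then show "K \<in> \<A>"
    using A_summand A_extension[OF r C BD(1)] by blast
qed

text \<open>Modulo \<open>\<X>\<close>, \<open>\<theta>\<close> agrees with a morphism that factors through \<open>f\<close> and with one that factors
  through \<open>g\<close>. Hence its square vanishes there and \<open>1 - \<theta>\<close> is inverse to \<open>1 + \<theta>\<close>.\<close>

lemma Q_iso_endo:
  assumes t: "tri A B D f g d" and A: "A \<in> \<A>" "B \<in> \<A>" "D \<in> \<A>"
    and \<theta>: "\<theta> \<in> hom T B B" and p: "null p" "p \<in> hom T A A" "\<theta> \<cdot> f = f \<cdot> p"
    and q: "null q" "q \<in> hom T D D" "g \<cdot> \<theta> = q \<cdot> g"
  shows "is_iso Q B B (cl (ident T B \<oplus> \<theta>))"
proof -
  note [simp] = homD[OF triD(1)[OF t]] homD[OF triD(2)[OF t]] homD[OF triD(3)[OF t]]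
    homD[OF \<theta>] homD[OF p(2)] homD[OF q(2)]
  obtain X u v where X: "X \<in> \<X>" and uv: "u \<in> hom T D X" "v \<in> hom T X D" "q = v \<cdot> u"
    using q(1,2) by (rule nullE)
  note [simp] = homD[OF uv(1)] homD[OF uv(2)]
  have "d \<cdot> v = zero_mor T X (So A)"
    using X A by (intro X_shift_A) (simp_all add: hom_iff)
  then obtain v' where v': "v' \<in> hom T X B" "v = g \<cdot> v'"
    by (rule tri_lift_third[OF t uv(2)])
  note [simp] = homD[OF v'(1)]
  define n1 where "n1 = v' \<cdot> (u \<cdot> g)"
  have n1: "null n1" "n1 \<in> hom T B B"
    unfolding n1_def using nullI[OF X _ v'(1), of "u \<cdot> g" B] by (simp_all add: hom_iff)
  note [simp] = homD[OF n1(2)]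
  have "g \<cdot> n1 = g \<cdot> \<theta>"
    using q(3) by (simp add: n1_def uv(3) v'(2) assoc)
  then have "g \<cdot> (\<theta> \<oplus> neg T n1) = zero_mor T B D"
    by (simp add: comp_add scale_comp)
  then obtain s where s: "s \<in> hom T B A" "\<theta> \<oplus> neg T n1 = f \<cdot> s"
    by (rule tri_lift[OF t, rotated]) (simp_all add: hom_iff)
  obtain Y w z where Y: "Y \<in> \<X>" and wz: "w \<in> hom T A Y" "z \<in> hom T Y A" "p = z \<cdot> w"
    using p(1,2) by (rule nullE)
  note [simp] = homD[OF wz(1)] homD[OF wz(2)] homD[OF s(1)]
  have "Sm w \<cdot> d = zero_mor T D (So Y)"
    using Y A by (intro A_shift_X) (simp_all add: hom_iff)
  then obtain w' where w': "w' \<in> hom T B Y" "w = w' \<cdot> f"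
    by (rule tri_extend[OF t wz(1)])
  note [simp] = homD[OF w'(1)]
  define n2 where "n2 = (f \<cdot> z) \<cdot> w'"
  have n2: "null n2" "n2 \<in> hom T B B"
    unfolding n2_def using nullI[OF Y w'(1), of "f \<cdot> z" B] by (simp_all add: hom_iff)
  note [simp] = homD[OF n2(2)]
  have "n2 \<cdot> f = \<theta> \<cdot> f"
    using p(3) by (simp add: n2_def wz(3) w'(2) assoc)
  then have "(\<theta> \<oplus> neg T n2) \<cdot> f = zero_mor T A B"
    by (simp add: comp_add scale_comp)
  then obtain r where r: "r \<in> hom T D B" "\<theta> \<oplus> neg T n2 = r \<cdot> g"
    by (rule tri_colift[OF t, rotated]) (simp_all add: hom_iff)
  note [simp] = homD[OF r(1)]
  have \<theta>_eq: "\<theta> = f \<cdot> s \<oplus> n1" "\<theta> = r \<cdot> g \<oplus> n2"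
    by (simp_all add: s(2)[symmetric] r(2)[symmetric])
  have "(r \<cdot> g) \<cdot> (f \<cdot> s) = zero_mor T B B"
    by (simp add: assoc comp_reduce[OF tri_comp_zero(1)[OF t]])
  then have "\<theta> \<cdot> \<theta> = (r \<cdot> g) \<cdot> n1 \<oplus> n2 \<cdot> \<theta>"
  proof -
    have "\<theta> \<cdot> \<theta> = (r \<cdot> g \<oplus> n2) \<cdot> \<theta>"
      using \<theta>_eq(2) by (rule arg_cong)
    also have "\<dots> = (r \<cdot> g) \<cdot> (f \<cdot> s \<oplus> n1) \<oplus> n2 \<cdot> \<theta>"
      using \<theta>_eq(1) by (subst comp_add) (simp_all add: arg_cong[OF \<theta>_eq(1)[symmetric]])
    also have "(r \<cdot> g) \<cdot> (f \<cdot> s \<oplus> n1) = (r \<cdot> g) \<cdot> n1"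
      using \<open>(r \<cdot> g) \<cdot> (f \<cdot> s) = zero_mor T B B\<close> by (subst comp_add) simp_all
    finally show ?thesis .
  qed
  then have "null (neg T (\<theta> \<cdot> \<theta>))"
    using n1(1) n2(1) by (simp add: null_scale null_add null_comp)
  then have *: "cl (ident T B \<oplus> neg T (\<theta> \<cdot> \<theta>)) = cl (ident T B)"
    by (intro cl_add_null[of _ B B]) (simp_all add: hom_iff)
  have e: "(ident T B \<oplus> neg T \<theta>) \<cdot> (ident T B \<oplus> \<theta>) = ident T B \<oplus> neg T (\<theta> \<cdot> \<theta>)"
    "(ident T B \<oplus> \<theta>) \<cdot> (ident T B \<oplus> neg T \<theta>) = ident T B \<oplus> neg T (\<theta> \<cdot> \<theta>)"
    by (simp_all add: comp_add scale_comp scale_add add_ac(1))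
  have h: "ident T B \<oplus> \<theta> \<in> hom T B B" "ident T B \<oplus> neg T \<theta> \<in> hom T B B"
    by (simp_all add: hom_iff)
  show ?thesis
    unfolding is_iso_Q_iff[OF h(1) A(2) A(2)] by (rule bexI[OF _ h(2)]) (simp only: e *)
qed

lemma Q_iso_middle:
  assumes t: "tri A B D f g d" and A: "A \<in> \<A>" "B \<in> \<A>" "D \<in> \<A>"
    and t': "tri A' B' D' f' g' d'" and A': "A' \<in> \<A>" "B' \<in> \<A>" "D' \<in> \<A>"
    and a: "is_iso Q A A' (cl a)" and b: "b \<in> hom T B B'" and c: "is_iso Q D D' (cl c)"
    and eq: "b \<cdot> f = f' \<cdot> a" "c \<cdot> g = g' \<cdot> b" "d' \<cdot> c = Sm a \<cdot> d"
  shows "is_iso Q B B' (cl b)"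
proof -
  have a1: "a \<in> hom T A A'" and c1: "c \<in> hom T D D'"
    using a c by (simp_all add: is_iso_def cl_in_hom_QD)
  note [simp] = homD[OF triD(1)[OF t]] homD[OF triD(2)[OF t]] homD[OF triD(3)[OF t]]
    homD[OF triD(1)[OF t']] homD[OF triD(2)[OF t']] homD[OF triD(3)[OF t']]
    homD[OF a1] homD[OF b] homD[OF c1]
  obtain a' where a': "a' \<in> hom T A' A" "cl (a' \<cdot> a) = cl (ident T A)" "cl (a \<cdot> a') = cl (ident T A')"
    using a is_iso_Q_iff[OF a1] A A' by blast
  obtain c' where c': "c' \<in> hom T D' D" "cl (c' \<cdot> c) = cl (ident T D)" "cl (c \<cdot> c') = cl (ident T D')"
    using c is_iso_Q_iff[OF c1] A A' by blast
  note [simp] = homD[OF a'(1)] homD[OF c'(1)]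
  obtain m where m: "m \<in> hom T A A" "null m" "a' \<cdot> a = ident T A \<oplus> m"
    by (rule cl_eqE[OF a'(2) ident_hom]) simp_all
  obtain m' where m': "m' \<in> hom T A' A'" "null m'" "a \<cdot> a' = ident T A' \<oplus> m'"
    by (rule cl_eqE[OF a'(3) ident_hom]) simp_all
  obtain n where n: "n \<in> hom T D D" "null n" "c' \<cdot> c = ident T D \<oplus> n"
    by (rule cl_eqE[OF c'(2) ident_hom]) simp_all
  obtain n' where n': "n' \<in> hom T D' D'" "null n'" "c \<cdot> c' = ident T D' \<oplus> n'"
    by (rule cl_eqE[OF c'(3) ident_hom]) simp_all
  note [simp] = homD[OF m(1)] homD[OF m'(1)] homD[OF n(1)] homD[OF n'(1)]
  have "d' = d' \<cdot> (c \<cdot> c')"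
    by (simp add: n'(3) comp_add connecting_null[OF triD(3)[OF t'] A'(1) n'(2,1)])
  also have "\<dots> = Sm a \<cdot> (d \<cdot> c')"
    by (simp add: comp_reduce[OF eq(3)] assoc)
  finally have "Sm a' \<cdot> d' = Sm (a' \<cdot> a) \<cdot> (d \<cdot> c')"
    by (simp add: assoc)
  also have "\<dots> = (Sm (a' \<cdot> a) \<cdot> d) \<cdot> c'"
    by (simp add: assoc)
  also have "Sm (a' \<cdot> a) \<cdot> d = d"
    unfolding m(3) using shift_null_connecting[OF triD(3)[OF t] A(3) m(2,1)] by (simp add: comp_add)
  finally have "d \<cdot> c' = Sm a' \<cdot> d'"
    by simp
  then obtain b' where b': "b' \<in> hom T B' B" "b' \<cdot> f' = f \<cdot> a'" "c' \<cdot> g' = g \<cdot> b'"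
    by (rule tri_fill_second[OF t' t a'(1) c'(1)])
  note [simp] = homD[OF b'(1)]
  have "is_iso Q B B (cl (b' \<cdot> b))"
  proof -
    have e1: "(b' \<cdot> b \<oplus> neg T (ident T B)) \<cdot> f = f \<cdot> m"
    proof -
      have "(b' \<cdot> b) \<cdot> f = f \<cdot> (ident T A \<oplus> m)"
        by (simp add: assoc eq(1) comp_reduce[OF b'(2)] m(3)[symmetric])
      then show ?thesis
        by (simp add: comp_add scale_comp add_ac(2)[of f])
    qed
    have e2: "g \<cdot> (b' \<cdot> b \<oplus> neg T (ident T B)) = n \<cdot> g"
    proof -
      have "g \<cdot> (b' \<cdot> b) = (c' \<cdot> c) \<cdot> g"
        by (simp add: assoc eq(2) comp_reduce[OF b'(3)[symmetric]])
      then show ?thesis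
        by (simp add: comp_add scale_comp n(3) add_ac(2)[of g])
    qed
    have "is_iso Q B B (cl (ident T B \<oplus> (b' \<cdot> b \<oplus> neg T (ident T B))))"
      by (rule Q_iso_endo[OF t A _ m(2,1) e1 n(2,1) e2]) (simp add: hom_iff)
    then show ?thesis
      by simp
  qed
  moreover have "is_iso Q B' B' (cl (b \<cdot> b'))"
  proof -
    have e1: "(b \<cdot> b' \<oplus> neg T (ident T B')) \<cdot> f' = f' \<cdot> m'"
    proof -
      have "(b \<cdot> b') \<cdot> f' = f' \<cdot> (ident T A' \<oplus> m')"
        by (simp add: assoc b'(2) comp_reduce[OF eq(1)] m'(3)[symmetric])
      then show ?thesis
        by (simp add: comp_add scale_comp add_ac(2)[of f'])
    qed
    have e2: "g' \<cdot> (b \<cdot> b' \<oplus> neg T (ident T B')) = n' \<cdot> g'"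
    proof -
      have "g' \<cdot> (b \<cdot> b') = (c \<cdot> c') \<cdot> g'"
        by (simp add: assoc b'(3) comp_reduce[OF eq(2)[symmetric]])
      then show ?thesis
        by (simp add: comp_add scale_comp n'(3) add_ac(2)[of g'])
    qed
    have "is_iso Q B' B' (cl (ident T B' \<oplus> (b \<cdot> b' \<oplus> neg T (ident T B'))))"
      by (rule Q_iso_endo[OF t' A' _ m'(2,1) e1 n'(2,1) e2]) (simp add: hom_iff)
    then show ?thesis
      by simp
  qed
  ultimately have "is_iso Q B B (cl b' \<cdot>\<^bsub>Q\<^esub> cl b)" "is_iso Q B' B' (cl b \<cdot>\<^bsub>Q\<^esub> cl b')"
    by simp_all
  then show ?thesis
    by (rule Q.is_iso_both_sides[OF hom_QI[OF b A(2) A'(2)]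
          hom_QI[OF b'(1) A'(2) A(2)] hom_QI[OF b'(1) A'(2) A(2)]])
qed

text \<open>A morphism between two triangles whose middle terms lie in \<open>\<X>\<close> only matters through its outer
  components \<open>f\<close> and \<open>h\<close>, which satisfy \<open>d' h = f[1] d\<close> and determine each other in the subfactor
  category. Functoriality, adjunction and equivalence of \<open>\<Sigma>\<close> and \<open>\<Omega>\<close> are all read off this
  correspondence.\<close>

lemma link_ex_right:
  assumes t: "tri A X B a b d" "X \<in> \<X>" "A \<in> \<A>" "B \<in> \<A>"
    and t': "tri A' X' B' a' b' d'" "X' \<in> \<X>" "A' \<in> \<A>" "B' \<in> \<A>" and f: "f \<in> hom T A A'"
  shows "\<exists>h \<in> hom T B B'. d' \<cdot> h = Sm f \<cdot> d"
proof -
  note [simp] = homD[OF triD(1)[OF t(1)]] homD[OF triD(2)[OF t(1)]] homD[OF triD(3)[OF t(1)]]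
    homD[OF triD(1)[OF t'(1)]] homD[OF triD(2)[OF t'(1)]] homD[OF triD(3)[OF t'(1)]] homD[OF f]
  have "Sm a' \<cdot> (Sm f \<cdot> d) = zero_mor T B (So X')"
    using t t' by (intro A_shift_X) (simp_all add: hom_iff)
  then obtain h where "h \<in> hom T B B'" "Sm f \<cdot> d = d' \<cdot> h"
    by (rule tri_lift_shift[OF t'(1), rotated]) (simp_all add: hom_iff)
  then show ?thesis
    by (intro bexI[of _ h]) simp_all
qed

lemma link_ex_left:
  assumes t: "tri A X B a b d" "X \<in> \<X>" "A \<in> \<A>" "B \<in> \<A>"
    and t': "tri A' X' B' a' b' d'" "X' \<in> \<X>" "A' \<in> \<A>" "B' \<in> \<A>" and h: "h \<in> hom T B B'"
  shows "\<exists>f \<in> hom T A A'. d' \<cdot> h = Sm f \<cdot> d"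
proof -
  note [simp] = homD[OF triD(1)[OF t(1)]] homD[OF triD(2)[OF t(1)]] homD[OF triD(3)[OF t(1)]]
    homD[OF triD(1)[OF t'(1)]] homD[OF triD(2)[OF t'(1)]] homD[OF triD(3)[OF t'(1)]] homD[OF h]
  have "(d' \<cdot> h) \<cdot> b = zero_mor T X (So A')"
    using t t' by (intro X_shift_A) (simp_all add: hom_iff)
  then obtain y where y: "y \<in> hom T (So A) (So A')" "d' \<cdot> h = y \<cdot> d"
    by (rule tri_colift_third[OF t(1), rotated]) (simp_all add: hom_iff)
  obtain f where "f \<in> hom T A A'" "y = Sm f"
    by (rule shift_fullE[OF y(1)]) simp_all
  with y(2) show ?thesis
    by (intro bexI[of _ f]) simp_all
qed

lemma cl_eq_if_connecting_eq:
  assumes t: "tri A X B a b d" "X \<in> \<X>"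
    and h: "h \<in> hom T W B" "h1 \<in> hom T W B" "d \<cdot> h1 = d \<cdot> h"
  shows "cl h1 = cl h"
proof -
  note [simp] = homD[OF triD(2)[OF t(1)]] homD[OF triD(3)[OF t(1)]] homD[OF h(1)] homD[OF h(2)]
  have "d \<cdot> (h1 \<oplus> neg T h) = zero_mor T W (So A)"
    using h(3) by (simp add: comp_add scale_comp)
  then obtain k where k: "k \<in> hom T W X" "h1 \<oplus> neg T h = b \<cdot> k"
    by (rule tri_lift_third[OF t(1), rotated]) (simp_all add: hom_iff)
  show ?thesis
    using nullI[OF t(2) k(1) triD(2)[OF t(1)]] k(2) by (intro cl_eqI[OF h(1,2)]) simp
qed

lemma cl_eq_if_shift_connecting_eq:
  assumes t: "tri A X B a b d" "X \<in> \<X>"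
    and f: "f \<in> hom T A W" "f1 \<in> hom T A W" "Sm f1 \<cdot> d = Sm f \<cdot> d"
  shows "cl f1 = cl f"
proof -
  note [simp] = homD[OF triD(1)[OF t(1)]] homD[OF triD(3)[OF t(1)]] homD[OF f(1)] homD[OF f(2)]
  have "Sm (f1 \<oplus> neg T f) \<cdot> d = zero_mor T B (So W)"
    using f(3) by (simp add: comp_add scale_comp)
  then obtain k where k: "k \<in> hom T X W" "f1 \<oplus> neg T f = k \<cdot> a"
    by (rule tri_extend[OF t(1), rotated]) (simp_all add: hom_iff)
  show ?thesis
    using nullI[OF t(2) triD(1)[OF t(1)] k(1)] k(2) by (intro cl_eqI[OF f(1,2)]) simp
qed

lemma link_unique_right:
  assumes d: "d \<in> hom T B (So A)" "B \<in> \<A>" and t': "tri A' X' B' a' b' d'" "X' \<in> \<X>"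
    and f: "f \<in> hom T A A'" "cl f1 = cl f"
    and h: "h \<in> hom T B B'" "d' \<cdot> h = Sm f \<cdot> d" "h1 \<in> hom T B B'" "d' \<cdot> h1 = Sm f1 \<cdot> d"
  shows "cl h1 = cl h"
proof -
  note [simp] = homD[OF triD(1)[OF t'(1)]] homD[OF triD(2)[OF t'(1)]] homD[OF triD(3)[OF t'(1)]]
    homD[OF d(1)] homD[OF f(1)] homD[OF h(1)] homD[OF h(3)]
  obtain n where n: "n \<in> hom T A A'" "null n" "f1 = f \<oplus> n"
    by (rule cl_eqE[OF f(2,1)])
  note [simp] = homD[OF n(1)]
  have "d' \<cdot> h1 = d' \<cdot> h"
    using shift_null_connecting[OF d n(2,1)] by (simp add: h n(3) comp_add)
  then show ?thesis
    by (rule cl_eq_if_connecting_eq[OF t' h(1,3)])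
qed

lemma link_unique_left:
  assumes t: "tri A X B a b d" "X \<in> \<X>" and d': "d' \<in> hom T B' (So A')" "A' \<in> \<A>"
    and h: "h \<in> hom T B B'" "cl h1 = cl h"
    and f: "f \<in> hom T A A'" "d' \<cdot> h = Sm f \<cdot> d" "f1 \<in> hom T A A'" "d' \<cdot> h1 = Sm f1 \<cdot> d"
  shows "cl f1 = cl f"
proof -
  note [simp] = homD[OF triD(1)[OF t(1)]] homD[OF triD(2)[OF t(1)]] homD[OF triD(3)[OF t(1)]]
    homD[OF d'(1)] homD[OF h(1)] homD[OF f(1)] homD[OF f(3)]
  obtain n where n: "n \<in> hom T B B'" "null n" "h1 = h \<oplus> n"
    by (rule cl_eqE[OF h(2,1)])
  note [simp] = homD[OF n(1)]
  have "Sm f1 \<cdot> d = Sm f \<cdot> d"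
    using connecting_null[OF d' n(2,1)] by (simp add: f(2,4)[symmetric] n(3) comp_add)
  then show ?thesis
    by (rule cl_eq_if_shift_connecting_eq[OF t f(1,3)])
qed

end

section \<open>The triangulated subfactor category\<close>

locale frobenius_choice = frobenius_pair +
  fixes S L
  assumes S_choice: "susp_choice T \<X> \<A> S" and L_choice: "loop_choice T \<X> \<A> L"
begin

abbreviation Si where "Si \<equiv> susp_ob S"
abbreviation Om where "Om \<equiv> loop_ob L"
abbreviation gam where "gam A \<equiv> mor3 (S A)"
abbreviation con where "con D \<equiv> mor3 (L D)"

lemma susp_triangle_S: "A \<in> \<A> \<Longrightarrow> susp_triangle T \<X> A (S A)"
proof -
  assume A: "A \<in> \<A>"
  obtain X B a b d where "X \<in> \<X>" "B \<in> \<A>" "tri A X B a b d"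
    using enough_injectives[OF A] by blast
  then have "susp_triangle T \<X> A (Sextuple A X B a b d)"
    by (simp add: susp_triangle_def left_approximation_tri)
  then show ?thesis
    using S_choice A unfolding susp_choice_def by blast
qed

lemma loop_triangle_L: "D \<in> \<A> \<Longrightarrow> loop_triangle T \<X> D (L D)"
proof -
  assume D: "D \<in> \<A>"
  obtain X A a b d where "X \<in> \<X>" "A \<in> \<A>" "tri A X D a b d"
    using enough_projectives[OF D] by blast
  then have "loop_triangle T \<X> D (Sextuple A X D a b d)"
    by (simp add: loop_triangle_def right_approximation_tri)
  then show ?thesis
    using L_choice D unfolding loop_choice_def by blast
qed

lemma S_triangle: "A \<in> \<A> \<Longrightarrow> S A \<in> triangles T"
  and S_ob1 [simp]: "A \<in> \<A> \<Longrightarrow> ob1 (S A) = A"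
  and S_ob2: "A \<in> \<A> \<Longrightarrow> ob2 (S A) \<in> \<X>"
  using susp_triangle_S by (auto simp: susp_triangle_def left_approximation_def)

lemma L_triangle: "D \<in> \<A> \<Longrightarrow> L D \<in> triangles T"
  and L_ob3 [simp]: "D \<in> \<A> \<Longrightarrow> ob3 (L D) = D"
  and L_ob2: "D \<in> \<A> \<Longrightarrow> ob2 (L D) \<in> \<X>"
  using loop_triangle_L by (auto simp: loop_triangle_def right_approximation_def)

lemma tri_S: "A \<in> \<A> \<Longrightarrow> tri A (ob2 (S A)) (Si A) (mor1 (S A)) (mor2 (S A)) (gam A)"
  using S_triangle[of A] S_ob1[of A] by (metis sextuple.collapse)

lemma tri_L: "D \<in> \<A> \<Longrightarrow> tri (Om D) (ob2 (L D)) D (mor1 (L D)) (mor2 (L D)) (con D)"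
  using L_triangle[of D] L_ob3[of D] by (metis sextuple.collapse)

lemma Si_A [simp]: "A \<in> \<A> \<Longrightarrow> Si A \<in> \<A>"
proof -
  assume A: "A \<in> \<A>"
  have "left_approximation T \<X> A (ob2 (S A)) (mor1 (S A))"
    using susp_triangle_S[OF A] by (simp add: susp_triangle_def)
  then have "X_monic T \<X> A (ob2 (S A)) (mor1 (S A))"
    unfolding X_monic_def left_approximation_def using comp_hom by (auto simp: image_iff)
  then show ?thesis
    using cones_in_A tri_S[OF A] A X_in_A[OF S_ob2[OF A]] unfolding X_monics_have_cones_def by blast
qed

lemma Om_A [simp]: "D \<in> \<A> \<Longrightarrow> Om D \<in> \<A>"
proof -
  assume D: "D \<in> \<A>"
  have "right_approximation T \<X> D (ob2 (L D)) (mor2 (L D))"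
    using loop_triangle_L[OF D] by (simp add: loop_triangle_def)
  then have "X_epic T \<X> (ob2 (L D)) D (mor2 (L D))"
    unfolding X_epic_def right_approximation_def using comp_hom by (auto simp: image_iff)
  then show ?thesis
    using cocones_in_A tri_L[OF D] D X_in_A[OF L_ob2[OF D]] unfolding X_epics_have_cocones_def
    by blast
qed

lemma gam_hom: "A \<in> \<A> \<Longrightarrow> gam A \<in> hom T (Si A) (So A)"
  using triD(3)[OF tri_S] .

lemma con_hom: "D \<in> \<A> \<Longrightarrow> con D \<in> hom T D (So (Om D))"
  using triD(3)[OF tri_L] .

lemma gam_arr [simp]:
  assumes "A \<in> \<A>"
  shows "arr (gam A)" and "src (gam A) = Si A" and "tgt (gam A) = So A"
  using homD[OF gam_hom[OF assms]] by simp_all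

lemma con_arr [simp]:
  assumes "D \<in> \<A>"
  shows "arr (con D)" and "src (con D) = D" and "tgt (con D) = So (Om D)"
  using homD[OF con_hom[OF assms]] by simp_all

lemmas S_data = tri_S S_ob2
lemmas L_data = tri_L L_ob2

lemma Union_classes_eq: "\<lbrakk>\<And>x. P x \<Longrightarrow> F x = c; P x\<rbrakk> \<Longrightarrow> \<Union> {F x |x. P x} = c"
  by blast

lemma susp_mor_cl:
  assumes A: "A \<in> \<A>" "A' \<in> \<A>" and f: "f \<in> hom T A A'"
    and h: "h \<in> hom T (Si A) (Si A')" "gam A' \<cdot> h = Sm f \<cdot> gam A"
  shows "susp_mor T \<X> S (cl f) = cl h"
  unfolding susp_mor_def
proof (rule Union_classes_eq)
  fix h1
  assume "\<exists>B B' f1 g. f1 \<in> cl f \<and> f1 \<in> hom T B B' \<and> triangle_morphism T (S B) (S B') f1 g h1"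
  then obtain B B' f1 g where f1: "f1 \<in> cl f" "f1 \<in> hom T B B'"
    and g: "triangle_morphism T (S B) (S B') f1 g h1"
    by blast
  have f2: "f1 \<in> hom T A A'" "cl f1 = cl f"
    using in_clD[OF f1(1) f] f1(1) cl_eq_iff[OF f] by simp_all
  then have "B = A" "B' = A'"
    using f1(2) hom_disjoint by blast+
  then have "h1 \<in> hom T (Si A) (Si A')" "gam A' \<cdot> h1 = Sm f1 \<cdot> gam A"
    using g triangle_morphism_ex_iff[OF S_triangle S_triangle, of A A' f1 h1] A by blast+
  from link_unique_right[OF gam_hom Si_A S_data f f2(2) h this] show "cl h1 = cl h"
    using A by simp
next
  obtain g where "triangle_morphism T (S A) (S A') f g h"
    using triangle_morphism_ex_iff[OF S_triangle S_triangle, of A A' f h] A f h by auto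
  then show "\<exists>B B' f1 g. f1 \<in> cl f \<and> f1 \<in> hom T B B' \<and> triangle_morphism T (S B) (S B') f1 g h"
    using in_cl_self[OF f] f by blast
qed

lemma loop_mor_cl:
  assumes A: "A \<in> \<A>" "A' \<in> \<A>" and h: "h \<in> hom T A A'"
    and f: "f \<in> hom T (Om A) (Om A')" "con A' \<cdot> h = Sm f \<cdot> con A"
  shows "loop_mor T \<X> L (cl h) = cl f"
  unfolding loop_mor_def
proof (rule Union_classes_eq)
  fix f1
  assume "\<exists>B B' g h1. h1 \<in> cl h \<and> h1 \<in> hom T B B' \<and> triangle_morphism T (L B) (L B') f1 g h1"
  then obtain B B' g h1 where h1: "h1 \<in> cl h" "h1 \<in> hom T B B'"
    and g: "triangle_morphism T (L B) (L B') f1 g h1"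
    by blast
  have h2: "h1 \<in> hom T A A'" "cl h1 = cl h"
    using in_clD[OF h1(1) h] h1(1) cl_eq_iff[OF h] by simp_all
  then have "B = A" "B' = A'"
    using h1(2) hom_disjoint by blast+
  then have "f1 \<in> hom T (Om A) (Om A')" "con A' \<cdot> h1 = Sm f1 \<cdot> con A"
    using g triangle_morphism_ex_iff[OF L_triangle L_triangle, of A A' f1 h1] A by blast+
  from link_unique_left[OF L_data con_hom Om_A h h2(2) f this] show "cl f1 = cl f"
    using A by simp
next
  obtain g where "triangle_morphism T (L A) (L A') f g h"
    using triangle_morphism_ex_iff[OF L_triangle L_triangle, of A A' f h] A f h by auto
  then show "\<exists>B B' g h1. h1 \<in> cl h \<and> h1 \<in> hom T B B' \<and> triangle_morphism T (L B) (L B') f g h1"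
    using in_cl_self[OF h] h by blast
qed

lemma adj_unit_cl:
  assumes A: "A \<in> \<A>" and \<psi>: "\<psi> \<in> hom T A (Om (Si A))" "Sm \<psi> \<cdot> gam A = neg T (con (Si A))"
  shows "adj_unit T \<X> S L A = cl \<psi>"
  unfolding adj_unit_def
proof (rule Union_classes_eq)
  have [simp]: "Si A \<in> obj T"
    using A A_obj by simp
  have eq: "con (Si A) \<cdot> neg T (ident T (Si A)) = neg T (con (Si A))"
    using A by (simp add: scale_comp)
  have hom: "neg T (ident T (Si A)) \<in> hom T (Si A) (Si A)"
    by (simp add: hom_iff)
  note iff = triangle_morphism_ex_iff[OF S_triangle L_triangle, of A "Si A"]
  show "\<exists>g. triangle_morphism T (S A) (L (Si A)) \<psi> g (neg T (ident T (Si A)))"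
    using A \<psi> hom eq by (subst iff) simp_all
  fix \<psi>1
  assume "\<exists>g. triangle_morphism T (S A) (L (Si A)) \<psi>1 g (neg T (ident T (Si A)))"
  then have \<psi>1: "\<psi>1 \<in> hom T A (Om (Si A))" "neg T (con (Si A)) = Sm \<psi>1 \<cdot> gam A"
    using A eq by (subst (asm) iff; simp)+
  show "cl \<psi>1 = cl \<psi>"
    by (rule cl_eq_if_shift_connecting_eq[OF tri_S[OF A] S_ob2[OF A] \<psi>(1) \<psi>1(1)])
      (simp only: \<psi>(2) \<psi>1(2)[symmetric])
qed

lemma adj_counit_cl:
  assumes D: "D \<in> \<A>" and \<phi>: "\<phi> \<in> hom T (Si (Om D)) D" "con D \<cdot> \<phi> = neg T (gam (Om D))"
  shows "adj_counit T \<X> S L D = cl \<phi>"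
  unfolding adj_counit_def
proof (rule Union_classes_eq)
  have [simp]: "Om D \<in> obj T"
    using D A_obj by simp
  have eq: "Sm (neg T (ident T (Om D))) \<cdot> gam (Om D) = neg T (gam (Om D))"
    using D by (simp add: scale_comp)
  have hom: "neg T (ident T (Om D)) \<in> hom T (Om D) (Om D)"
    by (simp add: hom_iff)
  note iff = triangle_morphism_ex_iff[OF S_triangle L_triangle, of "Om D" D]
  show "\<exists>g. triangle_morphism T (S (Om D)) (L D) (neg T (ident T (Om D))) g \<phi>"
    using D \<phi> hom eq by (subst iff) simp_all
  fix \<phi>1
  assume "\<exists>g. triangle_morphism T (S (Om D)) (L D) (neg T (ident T (Om D))) g \<phi>1"
  then have \<phi>1: "\<phi>1 \<in> hom T (Si (Om D)) D" "con D \<cdot> \<phi>1 = neg T (gam (Om D))"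
    using D eq by (subst (asm) iff; simp)+
  show "cl \<phi>1 = cl \<phi>"
    by (rule cl_eq_if_connecting_eq[OF tri_L[OF D] L_ob2[OF D] \<phi>(1) \<phi>1(1)])
      (simp only: \<phi>(2) \<phi>1(2))
qed

lemma susp_mor_ex:
  assumes "A \<in> \<A>" "A' \<in> \<A>" "f \<in> hom T A A'"
  obtains h where "h \<in> hom T (Si A) (Si A')" "gam A' \<cdot> h = Sm f \<cdot> gam A"
    "susp_mor T \<X> S (cl f) = cl h"
  using link_ex_right[OF tri_S S_ob2 _ Si_A tri_S S_ob2 _ Si_A, of A A' f] susp_mor_cl[of A A' f] assms
  by blast

lemma loop_mor_ex:
  assumes "A \<in> \<A>" "A' \<in> \<A>" "h \<in> hom T A A'"
  obtains f where "f \<in> hom T (Om A) (Om A')" "con A' \<cdot> h = Sm f \<cdot> con A"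
    "loop_mor T \<X> L (cl h) = cl f"
  using link_ex_left[OF tri_L L_ob2 Om_A _ tri_L L_ob2 Om_A, of A A' h] loop_mor_cl[of A A' h] assms
  by blast

lemma adj_unit_ex:
  assumes "A \<in> \<A>"
  obtains \<psi> where "\<psi> \<in> hom T A (Om (Si A))" "Sm \<psi> \<cdot> gam A = neg T (con (Si A))"
    "adj_unit T \<X> S L A = cl \<psi>"
proof -
  have [simp]: "Si A \<in> obj T"
    using assms A_obj by simp
  have "neg T (ident T (Si A)) \<in> hom T (Si A) (Si A)"
    by (simp add: hom_iff)
  then obtain \<psi> where \<psi>: "\<psi> \<in> hom T A (Om (Si A))"
    "con (Si A) \<cdot> neg T (ident T (Si A)) = Sm \<psi> \<cdot> gam A"
    using link_ex_left[OF tri_S S_ob2 _ Si_A tri_L L_ob2 Om_A, of A "Si A" "neg T (ident T (Si A))"]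
      assms by auto
  then have "Sm \<psi> \<cdot> gam A = neg T (con (Si A))"
    using assms by (simp add: scale_comp)
  with that \<psi>(1) adj_unit_cl[OF assms] show thesis
    by blast
qed

lemma adj_counit_ex:
  assumes "D \<in> \<A>"
  obtains \<phi> where "\<phi> \<in> hom T (Si (Om D)) D" "con D \<cdot> \<phi> = neg T (gam (Om D))"
    "adj_counit T \<X> S L D = cl \<phi>"
proof -
  have [simp]: "Om D \<in> obj T"
    using assms A_obj by simp
  have "neg T (ident T (Om D)) \<in> hom T (Om D) (Om D)"
    by (simp add: hom_iff)
  then obtain \<phi> where \<phi>: "\<phi> \<in> hom T (Si (Om D)) D"
    "con D \<cdot> \<phi> = Sm (neg T (ident T (Om D))) \<cdot> gam (Om D)"
    using link_ex_right[OF tri_S S_ob2 _ Si_A tri_L L_ob2 Om_A, of "Om D" D "neg T (ident T (Om D))"]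
      assms by auto
  then have "con D \<cdot> \<phi> = neg T (gam (Om D))"
    using assms by (simp add: scale_comp)
  with that \<phi>(1) adj_counit_cl[OF assms] show thesis
    by blast
qed

lemma susp_functor: "lin_endofunctor Q Si (susp_mor T \<X> S)"
  unfolding lin_endofunctor_def
proof (intro conjI allI ballI)
  show "Si A \<in> obj Q" if "A \<in> obj Q" for A
    using that by simp
  show "susp_mor T \<X> S \<phi> \<in> hom Q (Si A) (Si B)" if 1: "\<phi> \<in> hom Q A B" for A B \<phi>
  proof -
    obtain f where f: "f \<in> hom T A B" "\<phi> = cl f" "A \<in> \<A>" "B \<in> \<A>"
      using 1 by (rule hom_QE)
    then show ?thesis
      using susp_mor_ex[OF f(3,4,1)] by (metis hom_QI Si_A)
  qed
  show "susp_mor T \<X> S (ident Q A) = ident Q (Si A)" if "A \<in> obj Q" for A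
    using that susp_mor_cl[of A A "ident T A" "ident T (Si A)"] A_obj by (simp add: ident_hom)
  show "susp_mor T \<X> S (\<psi> \<cdot>\<^bsub>Q\<^esub> \<phi>) = susp_mor T \<X> S \<psi> \<cdot>\<^bsub>Q\<^esub> susp_mor T \<X> S \<phi>"
    if 2: "\<psi> \<in> hom Q B D" and 1: "\<phi> \<in> hom Q A B" for A B D \<phi> \<psi>
  proof -
    obtain f where f: "f \<in> hom T A B" "\<phi> = cl f" "A \<in> \<A>" "B \<in> \<A>"
      using 1 by (rule hom_QE)
    obtain g where g: "g \<in> hom T B D" "\<psi> = cl g" "B \<in> \<A>" "D \<in> \<A>"
      using 2 by (rule hom_QE)
    obtain h where h: "h \<in> hom T (Si A) (Si B)" "gam B \<cdot> h = Sm f \<cdot> gam A"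
      "susp_mor T \<X> S (cl f) = cl h"
      using f(3,4,1) by (rule susp_mor_ex)
    obtain k where k: "k \<in> hom T (Si B) (Si D)" "gam D \<cdot> k = Sm g \<cdot> gam B"
      "susp_mor T \<X> S (cl g) = cl k"
      using g(3,4,1) by (rule susp_mor_ex)
    note [simp] = homD[OF f(1)] homD[OF g(1)] homD[OF h(1)] homD[OF k(1)] f(3) g(3) g(4)
    have "susp_mor T \<X> S (cl (g \<cdot> f)) = cl (k \<cdot> h)"
      by (rule susp_mor_cl[of A D]) (simp_all add: hom_iff comp_reduce[OF k(2)] h(2) assoc)
    then show ?thesis
      by (simp add: f(2) g(2) h(3) k(3))
  qed
  show "susp_mor T \<X> S (\<phi> \<oplus>\<^bsub>Q\<^esub> \<psi>) = susp_mor T \<X> S \<phi> \<oplus>\<^bsub>Q\<^esub> susp_mor T \<X> S \<psi>"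
    if 1: "\<phi> \<in> hom Q A B" and 2: "\<psi> \<in> hom Q A B" for A B \<phi> \<psi>
  proof -
    obtain f where f: "f \<in> hom T A B" "\<phi> = cl f" "A \<in> \<A>" "B \<in> \<A>"
      using 1 by (rule hom_QE)
    obtain g where g: "g \<in> hom T A B" "\<psi> = cl g"
      using 2 by (rule hom_QE)
    obtain h where h: "h \<in> hom T (Si A) (Si B)" "gam B \<cdot> h = Sm f \<cdot> gam A"
      "susp_mor T \<X> S (cl f) = cl h"
      using f(3,4,1) by (rule susp_mor_ex)
    obtain k where k: "k \<in> hom T (Si A) (Si B)" "gam B \<cdot> k = Sm g \<cdot> gam A"
      "susp_mor T \<X> S (cl g) = cl k"
      using f(3,4) g(1) by (rule susp_mor_ex)
    note [simp] = homD[OF f(1)] homD[OF g(1)] homD[OF h(1)] homD[OF k(1)] f(3,4)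
    have "susp_mor T \<X> S (cl (f \<oplus> g)) = cl (h \<oplus> k)"
      by (rule susp_mor_cl[of A B]) (simp_all add: hom_iff comp_add h(2) k(2))
    then show ?thesis
      by (simp add: f(2) g(2) h(3) k(3) add_cl[OF f(1) g(1)] add_cl[OF h(1) k(1)])
  qed
  show "susp_mor T \<X> S (c \<odot>\<^bsub>Q\<^esub> \<phi>) = c \<odot>\<^bsub>Q\<^esub> susp_mor T \<X> S \<phi>" if 1: "\<phi> \<in> hom Q A B" for A B \<phi> c
  proof -
    obtain f where f: "f \<in> hom T A B" "\<phi> = cl f" "A \<in> \<A>" "B \<in> \<A>"
      using 1 by (rule hom_QE)
    obtain h where h: "h \<in> hom T (Si A) (Si B)" "gam B \<cdot> h = Sm f \<cdot> gam A"
      "susp_mor T \<X> S (cl f) = cl h"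
      using f(3,4,1) by (rule susp_mor_ex)
    note [simp] = homD[OF f(1)] homD[OF h(1)] f(3,4)
    have "susp_mor T \<X> S (cl (c \<odot> f)) = cl (c \<odot> h)"
      by (rule susp_mor_cl[of A B]) (simp_all add: hom_iff scale_comp h(2))
    then show ?thesis
      by (simp add: f(2) h(3) scale_cl[OF f(1)] scale_cl[OF h(1)])
  qed
qed

lemma loop_functor: "lin_endofunctor Q Om (loop_mor T \<X> L)"
  unfolding lin_endofunctor_def
proof (intro conjI allI ballI)
  show "Om A \<in> obj Q" if "A \<in> obj Q" for A
    using that by simp
  show "loop_mor T \<X> L \<phi> \<in> hom Q (Om A) (Om B)" if 1: "\<phi> \<in> hom Q A B" for A B \<phi>
  proof -
    obtain f where f: "f \<in> hom T A B" "\<phi> = cl f" "A \<in> \<A>" "B \<in> \<A>"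
      using 1 by (rule hom_QE)
    then show ?thesis
      using loop_mor_ex[OF f(3,4,1)] by (metis hom_QI Om_A)
  qed
  show "loop_mor T \<X> L (ident Q A) = ident Q (Om A)" if "A \<in> obj Q" for A
    using that loop_mor_cl[of A A "ident T A" "ident T (Om A)"] A_obj by (simp add: ident_hom)
  show "loop_mor T \<X> L (\<psi> \<cdot>\<^bsub>Q\<^esub> \<phi>) = loop_mor T \<X> L \<psi> \<cdot>\<^bsub>Q\<^esub> loop_mor T \<X> L \<phi>"
    if 2: "\<psi> \<in> hom Q B D" and 1: "\<phi> \<in> hom Q A B" for A B D \<phi> \<psi>
  proof -
    obtain f where f: "f \<in> hom T A B" "\<phi> = cl f" "A \<in> \<A>" "B \<in> \<A>"
      using 1 by (rule hom_QE)
    obtain g where g: "g \<in> hom T B D" "\<psi> = cl g" "B \<in> \<A>" "D \<in> \<A>"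
      using 2 by (rule hom_QE)
    obtain h where h: "h \<in> hom T (Om A) (Om B)" "con B \<cdot> f = Sm h \<cdot> con A"
      "loop_mor T \<X> L (cl f) = cl h"
      using f(3,4,1) by (rule loop_mor_ex)
    obtain k where k: "k \<in> hom T (Om B) (Om D)" "con D \<cdot> g = Sm k \<cdot> con B"
      "loop_mor T \<X> L (cl g) = cl k"
      using g(3,4,1) by (rule loop_mor_ex)
    note [simp] = homD[OF f(1)] homD[OF g(1)] homD[OF h(1)] homD[OF k(1)] f(3) g(3) g(4)
    have "loop_mor T \<X> L (cl (g \<cdot> f)) = cl (k \<cdot> h)"
      by (rule loop_mor_cl[of A D]) (simp_all add: hom_iff comp_reduce[OF k(2)] h(2) assoc)
    then show ?thesis
      by (simp add: f(2) g(2) h(3) k(3))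
  qed
  show "loop_mor T \<X> L (\<phi> \<oplus>\<^bsub>Q\<^esub> \<psi>) = loop_mor T \<X> L \<phi> \<oplus>\<^bsub>Q\<^esub> loop_mor T \<X> L \<psi>"
    if 1: "\<phi> \<in> hom Q A B" and 2: "\<psi> \<in> hom Q A B" for A B \<phi> \<psi>
  proof -
    obtain f where f: "f \<in> hom T A B" "\<phi> = cl f" "A \<in> \<A>" "B \<in> \<A>"
      using 1 by (rule hom_QE)
    obtain g where g: "g \<in> hom T A B" "\<psi> = cl g"
      using 2 by (rule hom_QE)
    obtain h where h: "h \<in> hom T (Om A) (Om B)" "con B \<cdot> f = Sm h \<cdot> con A"
      "loop_mor T \<X> L (cl f) = cl h"
      using f(3,4,1) by (rule loop_mor_ex)
    obtain k where k: "k \<in> hom T (Om A) (Om B)" "con B \<cdot> g = Sm k \<cdot> con A"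
      "loop_mor T \<X> L (cl g) = cl k"
      using f(3,4) g(1) by (rule loop_mor_ex)
    note [simp] = homD[OF f(1)] homD[OF g(1)] homD[OF h(1)] homD[OF k(1)] f(3,4)
    have "loop_mor T \<X> L (cl (f \<oplus> g)) = cl (h \<oplus> k)"
      by (rule loop_mor_cl[of A B]) (simp_all add: hom_iff comp_add h(2) k(2))
    then show ?thesis
      by (simp add: f(2) g(2) h(3) k(3) add_cl[OF f(1) g(1)] add_cl[OF h(1) k(1)])
  qed
  show "loop_mor T \<X> L (c \<odot>\<^bsub>Q\<^esub> \<phi>) = c \<odot>\<^bsub>Q\<^esub> loop_mor T \<X> L \<phi>" if 1: "\<phi> \<in> hom Q A B" for A B \<phi> c
  proof -
    obtain f where f: "f \<in> hom T A B" "\<phi> = cl f" "A \<in> \<A>" "B \<in> \<A>"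
      using 1 by (rule hom_QE)
    obtain h where h: "h \<in> hom T (Om A) (Om B)" "con B \<cdot> f = Sm h \<cdot> con A"
      "loop_mor T \<X> L (cl f) = cl h"
      using f(3,4,1) by (rule loop_mor_ex)
    note [simp] = homD[OF f(1)] homD[OF h(1)] f(3,4)
    have "loop_mor T \<X> L (cl (c \<odot> f)) = cl (c \<odot> h)"
      by (rule loop_mor_cl[of A B]) (simp_all add: hom_iff scale_comp h(2))
    then show ?thesis
      by (simp add: f(2) h(3) scale_cl[OF f(1)] scale_cl[OF h(1)])
  qed
qed

lemma adj_unit_counit:
  "adjunction Q Si (susp_mor T \<X> S) Om (loop_mor T \<X> L) (adj_unit T \<X> S L) (adj_counit T \<X> S L)"
  unfolding adjunction_def
proof (intro conjI allI ballI)
  show "lin_endofunctor Q Si (susp_mor T \<X> S)" "lin_endofunctor Q Om (loop_mor T \<X> L)"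
    by (rule susp_functor loop_functor)+
  show "adj_unit T \<X> S L A \<in> hom Q A (Om (Si A))" if A: "A \<in> obj Q" for A
  proof -
    obtain \<psi> where "\<psi> \<in> hom T A (Om (Si A))" "adj_unit T \<X> S L A = cl \<psi>"
      using adj_unit_ex[of A] A by auto
    then show ?thesis
      using A by (simp add: hom_QI)
  qed
  show "adj_counit T \<X> S L A \<in> hom Q (Si (Om A)) A" if A: "A \<in> obj Q" for A
  proof -
    obtain \<phi> where "\<phi> \<in> hom T (Si (Om A)) A" "adj_counit T \<X> S L A = cl \<phi>"
      using adj_counit_ex[of A] A by auto
    then show ?thesis
      using A by (simp add: hom_QI)
  qed
  show "loop_mor T \<X> L (susp_mor T \<X> S \<xi>) \<cdot>\<^bsub>Q\<^esub> adj_unit T \<X> S L A = adj_unit T \<X> S L B \<cdot>\<^bsub>Q\<^esub> \<xi>"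
    if \<xi>: "\<xi> \<in> hom Q A B" for A B \<xi>
  proof -
    obtain f where f: "f \<in> hom T A B" "\<xi> = cl f" and A: "A \<in> \<A>" "B \<in> \<A>"
      using \<xi> by (rule hom_QE)
    obtain h where h: "h \<in> hom T (Si A) (Si B)" "gam B \<cdot> h = Sm f \<cdot> gam A"
      "susp_mor T \<X> S (cl f) = cl h"
      using A f(1) by (rule susp_mor_ex)
    obtain g where g: "g \<in> hom T (Om (Si A)) (Om (Si B))" "con (Si B) \<cdot> h = Sm g \<cdot> con (Si A)"
      "loop_mor T \<X> L (cl h) = cl g"
      using Si_A[OF A(1)] Si_A[OF A(2)] h(1) by (rule loop_mor_ex)
    obtain \<psi> where \<psi>: "\<psi> \<in> hom T A (Om (Si A))" "Sm \<psi> \<cdot> gam A = neg T (con (Si A))"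
      "adj_unit T \<X> S L A = cl \<psi>"
      using A(1) by (rule adj_unit_ex)
    obtain \<psi>' where \<psi>': "\<psi>' \<in> hom T B (Om (Si B))" "Sm \<psi>' \<cdot> gam B = neg T (con (Si B))"
      "adj_unit T \<X> S L B = cl \<psi>'"
      using A(2) by (rule adj_unit_ex)
    note [simp] = homD[OF f(1)] homD[OF h(1)] homD[OF g(1)] homD[OF \<psi>(1)] homD[OF \<psi>'(1)] A
    have "Sm (g \<cdot> \<psi>) \<cdot> gam A = neg T (con (Si B) \<cdot> h)"
      by (simp add: assoc \<psi>(2) g(2) scale_comp)
    also have "\<dots> = Sm (\<psi>' \<cdot> f) \<cdot> gam A"
      by (simp add: assoc h(2)[symmetric] comp_reduce[OF \<psi>'(2)] scale_comp)
    finally have "cl (g \<cdot> \<psi>) = cl (\<psi>' \<cdot> f)"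
      by (intro cl_eq_if_shift_connecting_eq[OF tri_S[of A] S_ob2[of A], where W = "Om (Si B)"])
        (simp_all add: hom_iff)
    then show ?thesis
      by (simp add: f(2) h(3) g(3) \<psi>(3) \<psi>'(3))
  qed
  show "\<xi> \<cdot>\<^bsub>Q\<^esub> adj_counit T \<X> S L A = adj_counit T \<X> S L B \<cdot>\<^bsub>Q\<^esub> susp_mor T \<X> S (loop_mor T \<X> L \<xi>)"
    if \<xi>: "\<xi> \<in> hom Q A B" for A B \<xi>
  proof -
    obtain f where f: "f \<in> hom T A B" "\<xi> = cl f" and A: "A \<in> \<A>" "B \<in> \<A>"
      using \<xi> by (rule hom_QE)
    obtain g where g: "g \<in> hom T (Om A) (Om B)" "con B \<cdot> f = Sm g \<cdot> con A"
      "loop_mor T \<X> L (cl f) = cl g"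
      using A f(1) by (rule loop_mor_ex)
    obtain h where h: "h \<in> hom T (Si (Om A)) (Si (Om B))" "gam (Om B) \<cdot> h = Sm g \<cdot> gam (Om A)"
      "susp_mor T \<X> S (cl g) = cl h"
      using Om_A[OF A(1)] Om_A[OF A(2)] g(1) by (rule susp_mor_ex)
    obtain \<phi> where \<phi>: "\<phi> \<in> hom T (Si (Om A)) A" "con A \<cdot> \<phi> = neg T (gam (Om A))"
      "adj_counit T \<X> S L A = cl \<phi>"
      using A(1) by (rule adj_counit_ex)
    obtain \<phi>' where \<phi>': "\<phi>' \<in> hom T (Si (Om B)) B" "con B \<cdot> \<phi>' = neg T (gam (Om B))"
      "adj_counit T \<X> S L B = cl \<phi>'"
      using A(2) by (rule adj_counit_ex)
    note [simp] = homD[OF f(1)] homD[OF h(1)] homD[OF g(1)] homD[OF \<phi>(1)] homD[OF \<phi>'(1)] A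
    have "con B \<cdot> (f \<cdot> \<phi>) = neg T (Sm g \<cdot> gam (Om A))"
      by (simp add: assoc comp_reduce[OF g(2)] \<phi>(2) scale_comp)
    also have "\<dots> = con B \<cdot> (\<phi>' \<cdot> h)"
      by (simp add: h(2)[symmetric] comp_reduce[OF \<phi>'(2)] scale_comp)
    finally have "cl (f \<cdot> \<phi>) = cl (\<phi>' \<cdot> h)"
      by (intro cl_eq_if_connecting_eq[OF tri_L[of B] L_ob2[of B], where W = "Si (Om A)"])
        (simp_all add: hom_iff)
    then show ?thesis
      by (simp add: f(2) h(3) g(3) \<phi>(3) \<phi>'(3))
  qed
  show "adj_counit T \<X> S L (Si A) \<cdot>\<^bsub>Q\<^esub> susp_mor T \<X> S (adj_unit T \<X> S L A) = ident Q (Si A)"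
    if "A \<in> obj Q" for A
  proof -
    have A: "A \<in> \<A>"
      using that by simp
    then have [simp]: "Si A \<in> obj T"
      using A_obj by simp
    obtain \<psi> where \<psi>: "\<psi> \<in> hom T A (Om (Si A))" "Sm \<psi> \<cdot> gam A = neg T (con (Si A))"
      "adj_unit T \<X> S L A = cl \<psi>"
      using A by (rule adj_unit_ex)
    obtain \<phi> where \<phi>: "\<phi> \<in> hom T (Si (Om (Si A))) (Si A)"
      "con (Si A) \<cdot> \<phi> = neg T (gam (Om (Si A)))" "adj_counit T \<X> S L (Si A) = cl \<phi>"
      using Si_A[OF A] by (rule adj_counit_ex)
    obtain h where h: "h \<in> hom T (Si A) (Si (Om (Si A)))" "gam (Om (Si A)) \<cdot> h = Sm \<psi> \<cdot> gam A"
      "susp_mor T \<X> S (cl \<psi>) = cl h"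
      using A Om_A[OF Si_A[OF A]] \<psi>(1) by (rule susp_mor_ex)
    note [simp] = homD[OF h(1)] homD[OF \<phi>(1)] homD[OF \<psi>(1)] A
    have "con (Si A) \<cdot> (\<phi> \<cdot> h) = con (Si A) \<cdot> ident T (Si A)"
      by (simp add: comp_reduce[OF \<phi>(2)] scale_comp h(2) \<psi>(2))
    then have "cl (\<phi> \<cdot> h) = cl (ident T (Si A))"
      by (intro cl_eq_if_connecting_eq[OF tri_L[of "Si A"] L_ob2[of "Si A"], where W = "Si A"])
        (simp_all add: hom_iff)
    then show ?thesis
      by (simp add: h(3) \<phi>(3) \<psi>(3))
  qed
  show "loop_mor T \<X> L (adj_counit T \<X> S L A) \<cdot>\<^bsub>Q\<^esub> adj_unit T \<X> S L (Om A) = ident Q (Om A)"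
    if "A \<in> obj Q" for A
  proof -
    have A: "A \<in> \<A>"
      using that by simp
    then have [simp]: "Om A \<in> obj T"
      using A_obj by simp
    obtain \<phi> where \<phi>: "\<phi> \<in> hom T (Si (Om A)) A" "con A \<cdot> \<phi> = neg T (gam (Om A))"
      "adj_counit T \<X> S L A = cl \<phi>"
      using A by (rule adj_counit_ex)
    obtain g where g: "g \<in> hom T (Om (Si (Om A))) (Om A)" "con A \<cdot> \<phi> = Sm g \<cdot> con (Si (Om A))"
      "loop_mor T \<X> L (cl \<phi>) = cl g"
      using Si_A[OF Om_A[OF A]] A \<phi>(1) by (rule loop_mor_ex)
    obtain \<psi> where \<psi>: "\<psi> \<in> hom T (Om A) (Om (Si (Om A)))"
      "Sm \<psi> \<cdot> gam (Om A) = neg T (con (Si (Om A)))" "adj_unit T \<X> S L (Om A) = cl \<psi>"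
      using Om_A[OF A] by (rule adj_unit_ex)
    note [simp] = homD[OF g(1)] homD[OF \<phi>(1)] homD[OF \<psi>(1)] A
    have "Sm (g \<cdot> \<psi>) \<cdot> gam (Om A) = Sm (ident T (Om A)) \<cdot> gam (Om A)"
      by (simp add: assoc \<psi>(2) scale_comp g(2)[symmetric] \<phi>(2))
    then have "cl (g \<cdot> \<psi>) = cl (ident T (Om A))"
      by (intro cl_eq_if_shift_connecting_eq[OF tri_S[of "Om A"] S_ob2[of "Om A"], where W = "Om A"])
        (simp_all add: hom_iff)
    then show ?thesis
      by (simp add: g(3) \<phi>(3) \<psi>(3))
  qed
qed

lemma adj_unit_iso:
  assumes A: "A \<in> \<A>"
  shows "is_iso Q A (Om (Si A)) (adj_unit T \<X> S L A)"
proof -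
  have [simp]: "Si A \<in> obj T" "A \<in> obj T" "Om (Si A) \<in> obj T"
    using A A_obj by simp_all
  note [simp] = A
  obtain \<psi> where \<psi>: "\<psi> \<in> hom T A (Om (Si A))" "Sm \<psi> \<cdot> gam A = neg T (con (Si A))"
    "adj_unit T \<X> S L A = cl \<psi>"
    using A by (rule adj_unit_ex)
  have "neg T (ident T (Si A)) \<in> hom T (Si A) (Si A)"
    by (simp add: hom_iff)
  then obtain \<theta> where \<theta>: "\<theta> \<in> hom T (Om (Si A)) A"
    "gam A \<cdot> neg T (ident T (Si A)) = Sm \<theta> \<cdot> con (Si A)"
    using link_ex_left[OF tri_L L_ob2 Om_A _ tri_S S_ob2 _ Si_A, of "Si A" A "neg T (ident T (Si A))"]
    by auto
  then have \<theta>2: "Sm \<theta> \<cdot> con (Si A) = neg T (gam A)"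
    by (simp add: scale_comp)
  note [simp] = homD[OF \<psi>(1)] homD[OF \<theta>(1)]
  have "Sm (\<theta> \<cdot> \<psi>) \<cdot> gam A = Sm (ident T A) \<cdot> gam A"
    by (simp add: assoc \<psi>(2) scale_comp \<theta>2)
  then have 1: "cl (\<theta> \<cdot> \<psi>) = cl (ident T A)"
    by (intro cl_eq_if_shift_connecting_eq[OF tri_S[of A] S_ob2[of A], where W = A])
      (simp_all add: hom_iff)
  have "Sm (\<psi> \<cdot> \<theta>) \<cdot> con (Si A) = Sm (ident T (Om (Si A))) \<cdot> con (Si A)"
    by (simp add: assoc \<psi>(2) scale_comp \<theta>2)
  then have 2: "cl (\<psi> \<cdot> \<theta>) = cl (ident T (Om (Si A)))"
    by (intro cl_eq_if_shift_connecting_eq[OF tri_L[of "Si A"] L_ob2[of "Si A"], where W = "Om (Si A)"])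
      (simp_all add: hom_iff)
  show ?thesis
    unfolding \<psi>(3) is_iso_Q_iff[OF \<psi>(1) A Om_A[OF Si_A[OF A]]]
    by (rule bexI[OF _ \<theta>(1)]) (simp add: 1 2)
qed

lemma adj_counit_iso:
  assumes D: "D \<in> \<A>"
  shows "is_iso Q (Si (Om D)) D (adj_counit T \<X> S L D)"
proof -
  have [simp]: "Om D \<in> obj T" "D \<in> obj T" "Si (Om D) \<in> obj T"
    using D A_obj by simp_all
  note [simp] = D
  obtain \<phi> where \<phi>: "\<phi> \<in> hom T (Si (Om D)) D" "con D \<cdot> \<phi> = neg T (gam (Om D))"
    "adj_counit T \<X> S L D = cl \<phi>"
    using D by (rule adj_counit_ex)
  have "neg T (ident T (Om D)) \<in> hom T (Om D) (Om D)"
    by (simp add: hom_iff)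
  then obtain \<theta> where \<theta>: "\<theta> \<in> hom T D (Si (Om D))"
    "gam (Om D) \<cdot> \<theta> = Sm (neg T (ident T (Om D))) \<cdot> con D"
    using link_ex_right[OF tri_L L_ob2 Om_A _ tri_S S_ob2 _ Si_A, of D "Om D" "neg T (ident T (Om D))"]
    by auto
  then have \<theta>2: "gam (Om D) \<cdot> \<theta> = neg T (con D)"
    by (simp add: scale_comp)
  note [simp] = homD[OF \<phi>(1)] homD[OF \<theta>(1)]
  have "con D \<cdot> (\<phi> \<cdot> \<theta>) = con D \<cdot> ident T D"
    by (simp add: comp_reduce[OF \<phi>(2)] scale_comp \<theta>2)
  then have 1: "cl (\<phi> \<cdot> \<theta>) = cl (ident T D)"
    by (intro cl_eq_if_connecting_eq[OF tri_L[of D] L_ob2[of D], where W = D])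
      (simp_all add: hom_iff)
  have "gam (Om D) \<cdot> (\<theta> \<cdot> \<phi>) = gam (Om D) \<cdot> ident T (Si (Om D))"
    by (simp add: comp_reduce[OF \<theta>2] scale_comp \<phi>(2))
  then have 2: "cl (\<theta> \<cdot> \<phi>) = cl (ident T (Si (Om D)))"
    by (intro cl_eq_if_connecting_eq[OF tri_S[of "Om D"] S_ob2[of "Om D"], where W = "Si (Om D)"])
      (simp_all add: hom_iff)
  show ?thesis
    unfolding \<phi>(3) is_iso_Q_iff[OF \<phi>(1) Si_A[OF Om_A[OF D]] D]
    by (rule bexI[OF _ \<theta>(1)]) (simp add: 1 2)
qed

definition induced_triangle where
  "induced_triangle A0 A B \<chi> \<omega> e \<longleftrightarrow> (\<exists>A' \<in> \<A>. \<exists>h g a. tri A0 A' B h g e \<and> is_iso Q A' A a \<and>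
     \<chi> = a \<cdot>\<^bsub>Q\<^esub> cl h \<and> cl g = \<omega> \<cdot>\<^bsub>Q\<^esub> a)"

lemma induced_triangle_transport:
  assumes t: "tri A0 K B0 h g e" and A: "A0 \<in> \<A>" "K \<in> \<A>" "B0 \<in> \<A>" "A1 \<in> \<A>" "A \<in> \<A>" "B \<in> \<A>"
    and e': "e' \<in> hom T B (So A1)" "e' \<cdot> b = Sm p \<cdot> e"
    and p: "is_iso Q A0 A1 (cl p)" and a: "is_iso Q K A a" and b: "is_iso Q B0 B (cl b)"
    and \<chi>: "\<chi> \<in> hom Q A1 A" "\<chi> \<cdot>\<^bsub>Q\<^esub> cl p = a \<cdot>\<^bsub>Q\<^esub> cl h"
    and \<omega>: "\<omega> \<in> hom Q A B" "\<omega> \<cdot>\<^bsub>Q\<^esub> a = cl b \<cdot>\<^bsub>Q\<^esub> cl g"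
  shows "induced_triangle A1 A B \<chi> \<omega> e'"
proof -
  have p1: "p \<in> hom T A0 A1" and b1: "b \<in> hom T B0 B"
    using p b by (simp_all add: is_iso_def cl_in_hom_QD)
  obtain A' h' g' where t': "tri A1 A' B h' g' e'"
    using tri_cocone[OF e'(1) A_obj[OF A(4)]] by blast
  have A': "A' \<in> \<A>"
    by (rule A_extension[OF t' A(4) A(6)])
  obtain k where k: "k \<in> hom T K A'" "k \<cdot> h = h' \<cdot> p" "b \<cdot> g = g' \<cdot> k"
    by (rule tri_fill_second[OF t t' p1 b1 e'(2)])
  have k_iso: "is_iso Q K A' (cl k)"
    by (rule Q_iso_middle[OF t A(1-3) t' A(4) A' A(6) p k(1) b k(2,3) e'(2)])
  then obtain \<kappa> where \<kappa>: "\<kappa> \<in> hom Q A' K" "\<kappa> \<cdot>\<^bsub>Q\<^esub> cl k = ident Q K" "cl k \<cdot>\<^bsub>Q\<^esub> \<kappa> = ident Q A'"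
    "is_iso Q A' K \<kappa>"
    by (rule Q.is_isoE)
  obtain \<pi> where \<pi>: "\<pi> \<in> hom Q A1 A0" "cl p \<cdot>\<^bsub>Q\<^esub> \<pi> = ident Q A1"
    using p by (rule Q.is_isoE)
  note homs = triD[OF t] triD[OF t'] p1 b1 k(1)
  note cls = hom_QI[OF homs(1) A(1,2)] hom_QI[OF homs(2) A(2,3)] hom_QI[OF homs(4) A(4) A']
    hom_QI[OF homs(5) A' A(6)] hom_QI[OF p1 A(1,4)] hom_QI[OF b1 A(3,6)] hom_QI[OF k(1) A(2) A']
  have a1: "a \<in> hom Q K A"
    using a by (simp add: is_iso_def)
  note [simp del] = comp_cl ident_Q
  note [simp] = Q.homD[OF cls(1)] Q.homD[OF cls(2)] Q.homD[OF cls(3)] Q.homD[OF cls(4)]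
    Q.homD[OF cls(5)] Q.homD[OF cls(6)] Q.homD[OF cls(7)] Q.homD[OF a1] Q.homD[OF \<kappa>(1)]
    Q.homD[OF \<pi>(1)] Q.homD[OF \<chi>(1)] Q.homD[OF \<omega>(1)]
  have kh: "cl k \<cdot>\<^bsub>Q\<^esub> cl h = cl h' \<cdot>\<^bsub>Q\<^esub> cl p" and bg: "cl b \<cdot>\<^bsub>Q\<^esub> cl g = cl g' \<cdot>\<^bsub>Q\<^esub> cl k"
    using k(2,3) cl_comp[OF k(1) homs(1)] cl_comp[OF homs(4) p1] cl_comp[OF b1 homs(2)]
      cl_comp[OF homs(5) k(1)] by simp_all
  show ?thesis
    unfolding induced_triangle_def
  proof (intro bexI[OF _ A'] exI conjI)
    show "tri A1 A' B h' g' e'"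
      by (rule t')
    show "is_iso Q A' A (a \<cdot>\<^bsub>Q\<^esub> \<kappa>)"
      by (rule Q.is_iso_comp[OF a \<kappa>(4)])
    have "\<chi> = (\<chi> \<cdot>\<^bsub>Q\<^esub> cl p) \<cdot>\<^bsub>Q\<^esub> \<pi>"
      by (simp add: Q.assoc \<pi>(2))
    also have "\<dots> = a \<cdot>\<^bsub>Q\<^esub> ((\<kappa> \<cdot>\<^bsub>Q\<^esub> cl k) \<cdot>\<^bsub>Q\<^esub> (cl h \<cdot>\<^bsub>Q\<^esub> \<pi>))"
      by (simp add: \<chi>(2) \<kappa>(2) Q.assoc)
    also have "\<dots> = (a \<cdot>\<^bsub>Q\<^esub> \<kappa>) \<cdot>\<^bsub>Q\<^esub> cl h'"
      by (simp add: Q.assoc Q.comp_reduce[OF kh] \<pi>(2))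
    finally show "\<chi> = (a \<cdot>\<^bsub>Q\<^esub> \<kappa>) \<cdot>\<^bsub>Q\<^esub> cl h'" .
    have "\<omega> \<cdot>\<^bsub>Q\<^esub> (a \<cdot>\<^bsub>Q\<^esub> \<kappa>) = cl g' \<cdot>\<^bsub>Q\<^esub> (cl k \<cdot>\<^bsub>Q\<^esub> \<kappa>)"
      by (simp add: Q.comp_reduce[OF \<omega>(2)] bg Q.assoc)
    then show "cl g' = \<omega> \<cdot>\<^bsub>Q\<^esub> (a \<cdot>\<^bsub>Q\<^esub> \<kappa>)"
      by (simp add: \<kappa>(3))
  qed
qed

lemma endofunctor_is_iso:
  assumes F: "lin_endofunctor Q Fo Fm" and f: "is_iso Q A B f"
  shows "is_iso Q (Fo A) (Fo B) (Fm f)"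
proof -
  obtain g where g: "f \<in> hom Q A B" "g \<in> hom Q B A" "g \<cdot>\<^bsub>Q\<^esub> f = ident Q A" "f \<cdot>\<^bsub>Q\<^esub> g = ident Q B"
    using f by (rule Q.is_isoE)
  have hom: "Fm k \<in> hom Q (Fo X) (Fo Y)" if "k \<in> hom Q X Y" for k X Y
    using F that unfolding lin_endofunctor_def by simp
  have ident: "Fm (ident Q X) = ident Q (Fo X)" if "X \<in> obj Q" for X
    using F that unfolding lin_endofunctor_def by simp
  have comp: "Fm (l \<cdot>\<^bsub>Q\<^esub> k) = Fm l \<cdot>\<^bsub>Q\<^esub> Fm k" if "l \<in> hom Q Y Z" "k \<in> hom Q X Y" for k l X Y Z
    using F that unfolding lin_endofunctor_def by metis
  show ?thesis
  proof (rule Q.is_isoI[OF hom[OF g(1)] hom[OF g(2)]])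
    show "Fm g \<cdot>\<^bsub>Q\<^esub> Fm f = ident Q (Fo A)"
      using comp[OF g(2,1)] ident[OF Q.homD(4)[OF g(1)]] g(3) by metis
    show "Fm f \<cdot>\<^bsub>Q\<^esub> Fm g = ident Q (Fo B)"
      using comp[OF g(1,2)] ident[OF Q.homD(5)[OF g(1)]] g(4) by metis
  qed
qed

lemma delta_iff:
  assumes A: "A \<in> \<A>" "B \<in> \<A>" "D \<in> \<A>"
    and h: "h \<in> hom Q (Om D) A" and g: "g \<in> hom Q A B" and f: "f \<in> hom T B D"
  shows "Sextuple A B D h g (cl f) \<in> delta T \<X> \<A> L \<longleftrightarrow>
    induced_triangle (Om D) A B h g (con D \<cdot> f)"
proof
  assume "Sextuple A B D h g (cl f) \<in> delta T \<X> \<A> L"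
  then obtain K B0 D0 f0 g0 h0 where K: "K \<in> \<A>" "B0 \<in> \<A>" "D0 \<in> \<A>" and f0: "f0 \<in> hom T B0 D0"
    and t: "tri (Om D0) K B0 h0 g0 (con D0 \<cdot> f0)"
    and iso: "left_isomorphic Q Om (loop_mor T \<X> L) (Sextuple K B0 D0 (cl h0) (cl g0) (cl f0))
      (Sextuple A B D h g (cl f))"
    unfolding delta_def by blast
  obtain a b d where a: "is_iso Q K A a" and b: "is_iso Q B0 B b" and d: "is_iso Q D0 D d"
    and eq: "a \<cdot>\<^bsub>Q\<^esub> cl h0 = h \<cdot>\<^bsub>Q\<^esub> loop_mor T \<X> L d" "b \<cdot>\<^bsub>Q\<^esub> cl g0 = g \<cdot>\<^bsub>Q\<^esub> a"
      "d \<cdot>\<^bsub>Q\<^esub> cl f0 = cl f \<cdot>\<^bsub>Q\<^esub> b"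
    using iso unfolding left_isomorphic_def by auto
  obtain b1 where b1: "b1 \<in> hom T B0 B" "b = cl b1"
    using b by (auto simp: is_iso_def elim: hom_QE)
  obtain d1 where d1: "d1 \<in> hom T D0 D" "d = cl d1"
    using d by (auto simp: is_iso_def elim: hom_QE)
  obtain p where p: "p \<in> hom T (Om D0) (Om D)" "con D \<cdot> d1 = Sm p \<cdot> con D0"
    "loop_mor T \<X> L (cl d1) = cl p"
    using K(3) A(3) d1(1) by (rule loop_mor_ex)
  note [simp] = homD[OF f] homD[OF f0] homD[OF b1(1)] homD[OF d1(1)] homD[OF p(1)] A K
  have "cl (f \<cdot> b1) = cl (d1 \<cdot> f0)"
    using eq(3) b1(2) d1(2) by simp
  then obtain n where n: "n \<in> hom T B0 D" "null n" "f \<cdot> b1 = d1 \<cdot> f0 \<oplus> n"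
    by (rule cl_eqE[of _ _ B0 D]) (simp_all add: hom_iff)
  note [simp] = homD[OF n(1)]
  have *: "(con D \<cdot> f) \<cdot> b1 = Sm p \<cdot> (con D0 \<cdot> f0)"
    by (simp add: assoc n(3) comp_add connecting_null[OF con_hom Om_A n(2,1)] comp_reduce[OF p(2)])
  show "induced_triangle (Om D) A B h g (con D \<cdot> f)"
  proof (rule induced_triangle_transport[OF t _ _ _ _ _ _ _ * _ a])
    show "is_iso Q (Om D0) (Om D) (cl p)"
      using endofunctor_is_iso[OF loop_functor d] d1(2) p(3) by simp
  qed (use b b1(2) h g eq(1,2) d1(2) p(3) in \<open>simp_all add: hom_iff\<close>)
next
  assume "induced_triangle (Om D) A B h g (con D \<cdot> f)"
  then obtain A' h' g' a where A': "A' \<in> \<A>" and t: "tri (Om D) A' B h' g' (con D \<cdot> f)"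
    and a: "is_iso Q A' A a" and eq: "h = a \<cdot>\<^bsub>Q\<^esub> cl h'" "cl g' = g \<cdot>\<^bsub>Q\<^esub> a"
    unfolding induced_triangle_def by blast
  note [simp] = A A' A_obj
  have iso: "is_iso Q B B (cl (ident T B))" "is_iso Q D D (cl (ident T D))"
    using Q.is_iso_ident[of B] Q.is_iso_ident[of D] by simp_all
  have loop: "loop_mor T \<X> L (cl (ident T D)) = ident Q (Om D)"
    using loop_functor unfolding lin_endofunctor_def by simp
  have h': "cl h' \<in> hom Q (Om D) A'" "cl g' \<in> hom Q A' B" "cl f \<in> hom Q B D"
    using triD[OF t] f by (simp_all add: hom_QI)
  have "left_isomorphic Q Om (loop_mor T \<X> L) (Sextuple A' B D (cl h') (cl g') (cl f))
      (Sextuple A B D h g (cl f))"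
    unfolding left_isomorphic_def left_sextuple_def
  proof (intro conjI exI)
    show "a \<cdot>\<^bsub>Q\<^esub> mor1 (Sextuple A' B D (cl h') (cl g') (cl f)) =
      mor1 (Sextuple A B D h g (cl f)) \<cdot>\<^bsub>Q\<^esub> loop_mor T \<X> L (cl (ident T D))"
      unfolding loop using Q.ident_right[OF h] eq(1) by simp
    show "cl (ident T B) \<cdot>\<^bsub>Q\<^esub> mor2 (Sextuple A' B D (cl h') (cl g') (cl f)) =
      mor2 (Sextuple A B D h g (cl f)) \<cdot>\<^bsub>Q\<^esub> a"
      using Q.ident_left[OF h'(2)] eq(2) by simp
    show "cl (ident T D) \<cdot>\<^bsub>Q\<^esub> mor3 (Sextuple A' B D (cl h') (cl g') (cl f)) =
      mor3 (Sextuple A B D h g (cl f)) \<cdot>\<^bsub>Q\<^esub> cl (ident T B)"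
      using Q.ident_left[OF h'(3)] Q.ident_right[OF h'(3)] by simp
  qed (use h' h g a iso in simp_all)
  then show "Sextuple A B D h g (cl f) \<in> delta T \<X> \<A> L"
    unfolding delta_def using A A' f t by blast
qed

lemma nabla_iff:
  assumes A: "A \<in> \<A>" "B \<in> \<A>" "D \<in> \<A>"
    and f: "f \<in> hom Q A B" and g: "g \<in> hom Q B D" and w: "w \<in> hom T D (Si A)"
  shows "Sextuple A B D f g (cl w) \<in> nabla T \<X> \<A> S \<longleftrightarrow>
    induced_triangle A B D f g (neg T (gam A \<cdot> w))"
proof
  assume "Sextuple A B D f g (cl w) \<in> nabla T \<X> \<A> S"
  then obtain A0 B0 D0 f0 g0 h0 where K: "A0 \<in> \<A>" "B0 \<in> \<A>" "D0 \<in> \<A>" and f0: "f0 \<in> hom T A0 B0"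
    and s: "tri B0 D0 (Si A0) g0 h0 (Sm f0 \<cdot> gam A0)"
    and iso: "right_isomorphic Q Si (susp_mor T \<X> S) (Sextuple A0 B0 D0 (cl f0) (cl g0) (cl h0))
      (Sextuple A B D f g (cl w))"
    unfolding nabla_def by blast
  obtain a b d where a: "is_iso Q A0 A a" and b: "is_iso Q B0 B b" and d: "is_iso Q D0 D d"
    and eq: "b \<cdot>\<^bsub>Q\<^esub> cl f0 = f \<cdot>\<^bsub>Q\<^esub> a" "d \<cdot>\<^bsub>Q\<^esub> cl g0 = g \<cdot>\<^bsub>Q\<^esub> b"
      "susp_mor T \<X> S a \<cdot>\<^bsub>Q\<^esub> cl h0 = cl w \<cdot>\<^bsub>Q\<^esub> d"
    using iso unfolding right_isomorphic_def right_morphism_def by auto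
  obtain a1 where a1: "a1 \<in> hom T A0 A" "a = cl a1"
    using a by (auto simp: is_iso_def elim: hom_QE)
  obtain d1 where d1: "d1 \<in> hom T D0 D" "d = cl d1"
    using d by (auto simp: is_iso_def elim: hom_QE)
  obtain p where p: "p \<in> hom T (Si A0) (Si A)" "gam A \<cdot> p = Sm a1 \<cdot> gam A0"
    "susp_mor T \<X> S (cl a1) = cl p"
    using K(1) A(1) a1(1) by (rule susp_mor_ex)
  note [simp] = homD[OF w] homD[OF f0] homD[OF a1(1)] homD[OF d1(1)] homD[OF p(1)] A K
    homD[OF triD(1)[OF s]] homD[OF triD(2)[OF s]]
  have "cl (w \<cdot> d1) = cl (p \<cdot> h0)"
    using eq(3) a1(2) d1(2) p(3) by simp
  then obtain n where n: "n \<in> hom T D0 (Si A)" "null n" "w \<cdot> d1 = p \<cdot> h0 \<oplus> n"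
    by (rule cl_eqE[of _ _ D0 "Si A"]) (simp_all add: hom_iff)
  note [simp] = homD[OF n(1)]
  have *: "neg T (gam A \<cdot> w) \<cdot> d1 = Sm a1 \<cdot> neg T (gam A0 \<cdot> h0)"
    by (simp add: assoc scale_comp n(3) comp_add connecting_null[OF gam_hom _ n(2,1)]
        comp_reduce[OF p(2)])
  obtain B' f' g' where r: "tri A0 B' D0 f' g' (neg T (gam A0 \<cdot> h0))"
    by (rule tri_cocone[of "neg T (gam A0 \<cdot> h0)" D0 A0]) (simp_all add: hom_iff A_obj)
  have B': "B' \<in> \<A>"
    by (rule A_extension[OF r]) simp_all
  obtain u v where uv: "tri B0 B' (ob2 (S A0)) u v ((Sm f0 \<cdot> gam A0) \<cdot> mor2 (S A0))"
    and u: "g' \<cdot> u = g0" "Sm u \<cdot> (Sm f0 \<cdot> gam A0) = Sm f' \<cdot> gam A0"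
    by (rule octahedron_cocone[OF tri_S[OF K(1)] s r])
  note [simp] = B' homD[OF triD(1)[OF r]] homD[OF triD(2)[OF r]] homD[OF triD(1)[OF uv]]
    homD[OF triD(2)[OF tri_S[OF K(1)]]]
  have "(Sm f0 \<cdot> gam A0) \<cdot> mor2 (S A0) = zero_mor T (ob2 (S A0)) (So B0)"
    by (simp add: assoc tri_comp_zero(2)[OF tri_S[OF K(1)]])
  then have u_iso: "is_iso Q B0 B' (cl u)"
    using uv S_ob2[OF K(1)] by (intro split_mono_Q_iso[of B0 B' "ob2 (S A0)" u v]) simp_all
  have "cl f' = cl (u \<cdot> f0)"
    by (rule cl_eq_if_shift_connecting_eq[OF tri_S[OF K(1)] S_ob2[OF K(1)], where W = "B'"])
      (simp_all add: hom_iff assoc u(2))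
  then have f': "cl f' = cl u \<cdot>\<^bsub>Q\<^esub> cl f0"
    by simp
  have g0: "cl g0 = cl g' \<cdot>\<^bsub>Q\<^esub> cl u"
    by (simp add: u(1))
  obtain \<upsilon> where \<upsilon>: "\<upsilon> \<in> hom Q B' B0" "\<upsilon> \<cdot>\<^bsub>Q\<^esub> cl u = ident Q B0" "cl u \<cdot>\<^bsub>Q\<^esub> \<upsilon> = ident Q B'"
    "is_iso Q B' B0 \<upsilon>"
    using u_iso by (rule Q.is_isoE)
  have homs: "cl u \<in> hom Q B0 B'" "cl f0 \<in> hom Q A0 B0" "cl g' \<in> hom Q B' D0" "b \<in> hom Q B0 B"
    "cl d1 \<in> hom Q D0 D"
    using b f0 d1(1) triD[OF uv] triD[OF r] by (simp_all add: hom_QI is_iso_def)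
  have b\<upsilon>: "is_iso Q B' B (b \<cdot>\<^bsub>Q\<^esub> \<upsilon>)"
    by (rule Q.is_iso_comp[OF b \<upsilon>(4)])
  have 1: "f \<cdot>\<^bsub>Q\<^esub> cl a1 = (b \<cdot>\<^bsub>Q\<^esub> \<upsilon>) \<cdot>\<^bsub>Q\<^esub> cl f'"
  proof -
    have "(b \<cdot>\<^bsub>Q\<^esub> \<upsilon>) \<cdot>\<^bsub>Q\<^esub> cl f' = b \<cdot>\<^bsub>Q\<^esub> ((\<upsilon> \<cdot>\<^bsub>Q\<^esub> cl u) \<cdot>\<^bsub>Q\<^esub> cl f0)"
      unfolding f' using Q.homD[OF homs(1)] Q.homD[OF homs(2)] Q.homD[OF homs(4)] Q.homD[OF \<upsilon>(1)]
      by (simp add: Q.assoc del: comp_cl)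
    also have "\<dots> = f \<cdot>\<^bsub>Q\<^esub> cl a1"
      unfolding \<upsilon>(2) Q.ident_left[OF homs(2)] eq(1) a1(2) ..
    finally show ?thesis ..
  qed
  have 2: "g \<cdot>\<^bsub>Q\<^esub> (b \<cdot>\<^bsub>Q\<^esub> \<upsilon>) = cl d1 \<cdot>\<^bsub>Q\<^esub> cl g'"
  proof -
    have "g \<cdot>\<^bsub>Q\<^esub> (b \<cdot>\<^bsub>Q\<^esub> \<upsilon>) = (cl d1 \<cdot>\<^bsub>Q\<^esub> cl g0) \<cdot>\<^bsub>Q\<^esub> \<upsilon>"
      using Q.comp_assoc[OF g homs(4) \<upsilon>(1)] eq(2) d1(2) by simp
    also have "\<dots> = cl d1 \<cdot>\<^bsub>Q\<^esub> (cl g' \<cdot>\<^bsub>Q\<^esub> (cl u \<cdot>\<^bsub>Q\<^esub> \<upsilon>))"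
      unfolding g0 using Q.homD[OF homs(1)] Q.homD[OF homs(3)] Q.homD[OF homs(5)] Q.homD[OF \<upsilon>(1)]
      by (simp add: Q.assoc del: comp_cl)
    also have "\<dots> = cl d1 \<cdot>\<^bsub>Q\<^esub> cl g'"
      unfolding \<upsilon>(3) Q.ident_right[OF homs(3)] ..
    finally show ?thesis .
  qed
  show "induced_triangle A B D f g (neg T (gam A \<cdot> w))"
    by (rule induced_triangle_transport[OF r K(1) B' K(3) A _ * _ b\<upsilon> _ f 1 g 2])
      (use a a1(2) d d1(2) in \<open>simp_all add: hom_iff\<close>)
next
  assume "induced_triangle A B D f g (neg T (gam A \<cdot> w))"
  then obtain B' f' g' b where B': "B' \<in> \<A>" and s: "tri A B' D f' g' (neg T (gam A \<cdot> w))"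
    and b: "is_iso Q B' B b" and eq: "f = b \<cdot>\<^bsub>Q\<^esub> cl f'" "cl g' = g \<cdot>\<^bsub>Q\<^esub> b"
    unfolding induced_triangle_def by blast
  note [simp] = A B' A_obj homD[OF triD(1)[OF s]] homD[OF triD(2)[OF s]] homD[OF w]
    homD[OF triD(1)[OF tri_S[OF A(1)]]]
  obtain D' g'' h'' where r: "tri B' D' (Si A) g'' h'' (Sm f' \<cdot> gam A)"
    by (rule tri_cocone[of "Sm f' \<cdot> gam A" "Si A" B']) (simp_all add: hom_iff)
  have D': "D' \<in> \<A>"
    by (rule A_extension[OF r]) simp_all
  obtain u v where uv: "tri (ob2 (S A)) D' D u v (Sm (mor1 (S A)) \<cdot> neg T (gam A \<cdot> w))"
    and v: "v \<cdot> g'' = g'" "neg T (gam A \<cdot> w) \<cdot> v = neg T (gam A \<cdot> h'')"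
    by (rule octahedron_cone[OF tri_S[OF A(1)] s r])
  note [simp] = D' homD[OF triD(1)[OF r]] homD[OF triD(2)[OF r]] homD[OF triD(2)[OF uv]]
  have "Sm (mor1 (S A)) \<cdot> neg T (gam A \<cdot> w) = zero_mor T D (So (ob2 (S A)))"
    by (simp add: scale_comp comp_reduce[OF tri_comp_zero(3)[OF tri_S[OF A(1)]]])
  then have v_iso: "is_iso Q D' D (cl v)"
    using uv S_ob2[OF A(1)] by (intro split_epi_Q_iso[of "ob2 (S A)" D' D u v]) simp_all
  have "gam A \<cdot> (w \<cdot> v) = gam A \<cdot> h''"
    using v(2) by (simp add: scale_comp assoc)
  then have wv: "cl (w \<cdot> v) = cl h''"
    by (intro cl_eq_if_connecting_eq[OF tri_S[OF A(1)] S_ob2[OF A(1)], where W = "D'"])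
      (simp_all add: hom_iff)
  have homs: "cl f' \<in> hom Q A B'" "cl g'' \<in> hom Q B' D'" "cl h'' \<in> hom Q D' (Si A)"
    "cl w \<in> hom Q D (Si A)" "b \<in> hom Q B' B" "cl v \<in> hom Q D' D"
    using triD[OF s] triD[OF r] triD[OF uv] w b by (simp_all add: hom_QI is_iso_def)
  have iso: "is_iso Q A A (cl (ident T A))"
    using Q.is_iso_ident[of A] by simp
  have susp: "susp_mor T \<X> S (cl (ident T A)) = ident Q (Si A)"
    using susp_functor unfolding lin_endofunctor_def by simp
  have "right_isomorphic Q Si (susp_mor T \<X> S) (Sextuple A B' D' (cl f') (cl g'') (cl h''))
      (Sextuple A B D f g (cl w))"
    unfolding right_isomorphic_def right_morphism_def right_sextuple_def
  proof (intro conjI exI)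
    show "b \<cdot>\<^bsub>Q\<^esub> mor1 (Sextuple A B' D' (cl f') (cl g'') (cl h'')) =
      mor1 (Sextuple A B D f g (cl w)) \<cdot>\<^bsub>Q\<^esub> cl (ident T A)"
      using Q.ident_right[OF f] eq(1) by simp
    show "cl v \<cdot>\<^bsub>Q\<^esub> mor2 (Sextuple A B' D' (cl f') (cl g'') (cl h'')) =
      mor2 (Sextuple A B D f g (cl w)) \<cdot>\<^bsub>Q\<^esub> b"
      using eq(2) v(1) by simp
    show "susp_mor T \<X> S (cl (ident T A)) \<cdot>\<^bsub>Q\<^esub> mor3 (Sextuple A B' D' (cl f') (cl g'') (cl h'')) =
      mor3 (Sextuple A B D f g (cl w)) \<cdot>\<^bsub>Q\<^esub> cl v"
      unfolding susp using Q.ident_left[OF homs(3)] wv by simp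
  qed (use homs f g iso b v_iso in \<open>simp_all add: is_iso_def\<close>)
  then show "Sextuple A B D f g (cl w) \<in> nabla T \<X> \<A> S"
    unfolding nabla_def using A B' D' triD(1)[OF s] r by blast
qed

lemma subfactor_triangulated_S_L: "subfactor_triangulated T \<X> \<A> S L"
  unfolding subfactor_triangulated_def Let_def
proof (intro conjI ballI)
  show "adjoint_equivalence Q Si (susp_mor T \<X> S) Om (loop_mor T \<X> L)
    (adj_unit T \<X> S L) (adj_counit T \<X> S L)"
    unfolding adjoint_equivalence_def using adj_unit_counit adj_unit_iso adj_counit_iso by simp
  fix A B D h g \<omega>
  assume A: "A \<in> \<A>" "B \<in> \<A>" "D \<in> \<A>" and h: "h \<in> hom Q (Om D) A" and g: "g \<in> hom Q A B"
    and \<omega>: "\<omega> \<in> hom Q B (Si (Om D))"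
  obtain w where w: "w \<in> hom T B (Si (Om D))" "\<omega> = cl w"
    using \<omega> by (rule hom_QE)
  obtain \<phi> where \<phi>: "\<phi> \<in> hom T (Si (Om D)) D" "con D \<cdot> \<phi> = neg T (gam (Om D))"
    "adj_counit T \<X> S L D = cl \<phi>"
    using A(3) by (rule adj_counit_ex)
  note [simp] = homD[OF w(1)] homD[OF \<phi>(1)] A
  have "con D \<cdot> (\<phi> \<cdot> w) = neg T (gam (Om D) \<cdot> w)"
    by (simp add: comp_reduce[OF \<phi>(2)] scale_comp)
  moreover have "\<phi> \<cdot> w \<in> hom T B D"
    by (simp add: hom_iff)
  ultimately show "Sextuple A B D h g (adj_counit T \<X> S L D \<cdot>\<^bsub>Q\<^esub> \<omega>) \<in> delta T \<X> \<A> L \<longleftrightarrow>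
    Sextuple (Om D) A B h g \<omega> \<in> nabla T \<X> \<A> S"
    using delta_iff[OF A h g] nabla_iff[OF Om_A[OF A(3)] A(1,2) h g w(1)] w(2) \<phi>(3) by simp
qed

end

context subcategory_pair
begin

lemma orthogonalD: "\<lbrakk>orthogonal T \<U> \<V>; f \<in> hom T U V; U \<in> \<U>; V \<in> \<V>\<rbrakk> \<Longrightarrow> f = zero_mor T U V"
  unfolding orthogonal_def by blast

lemma shift_in_shift_up: "U \<in> obj T \<Longrightarrow> U \<in> \<U> \<Longrightarrow> So U \<in> shift_up T \<U>"
  unfolding shift_up_def isomorphic_def using is_iso_ident[of "So U"] by auto

lemma frobenius_pair_if_mutation_pair:
  assumes ext: "extension_closed T \<A>" and mut: "mutation_pair T \<X> \<A> \<A>"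
  shows "frobenius_pair T \<X> \<A>"
proof
  show "extension_closed T \<A>"
    by (rule ext)
  have mu: "\<A> \<subseteq> mu T \<A> \<X>" "\<A> \<subseteq> mu_inv T \<A> \<X>"
    using mut unfolding mutation_pair_def by blast+
  show "f = zero_mor T X (So A)" if f: "f \<in> hom T X (So A)" and X: "X \<in> \<X>" and A: "A \<in> \<A>" for f X A
  proof -
    note [simp] = homD[OF f] X_obj[OF X] A_obj[OF A]
    obtain W \<phi> where W[simp]: "W \<in> obj T" and iso: "is_iso T (So W) X \<phi>"
      by (rule shift_surjE[of X]) simp_all
    then obtain \<psi> where \<phi>: "\<phi> \<in> hom T (So W) X" and \<psi>: "\<psi> \<in> hom T X (So W)"
      and inv: "\<phi> \<cdot> \<psi> = ident T X"
      using is_isoE by metis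
    note [simp] = homD[OF \<phi>] homD[OF \<psi>]
    obtain y where y: "y \<in> hom T W A" "f \<cdot> \<phi> = Sm y"
      by (rule shift_fullE[of "f \<cdot> \<phi>" W A]) (simp_all add: hom_iff)
    have "W \<in> shift_down T \<X>"
      using iso X unfolding shift_down_def isomorphic_def by auto
    moreover have "orthogonal T (shift_down T \<X>) {A}"
      using A mu(1) unfolding mu_def right_perp_def by blast
    ultimately have "y = zero_mor T W A"
      using y(1) by (intro orthogonalD) auto
    then have "f \<cdot> (\<phi> \<cdot> \<psi>) = zero_mor T X (So A)"
      using y(2) by (simp add: comp_reduce)
    then show ?thesis
      by (simp add: inv)
  qed
  show "f = zero_mor T A (So X)" if f: "f \<in> hom T A (So X)" and A: "A \<in> \<A>" and X: "X \<in> \<X>" for f X A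
  proof (rule orthogonalD[OF _ f])
    show "orthogonal T {A} (shift_up T \<X>)"
      using A mu(2) unfolding mu_inv_def left_perp_def by blast
    show "So X \<in> shift_up T \<X>"
      by (rule shift_in_shift_up[OF X_obj[OF X] X])
  qed simp
  show "\<exists>X \<in> \<X>. \<exists>B \<in> \<A>. \<exists>a b d. tri A X B a b d" if A: "A \<in> \<A>" for A
  proof -
    obtain W X f a b where "W \<in> shift_down T \<A>" and X: "X \<in> \<X>" and t: "tri W A X f a b"
      using A mu(1) unfolding mu_def star_def by blast
    then obtain U \<phi> where U: "U \<in> \<A>" and \<phi>: "is_iso T (So W) U \<phi>"
      unfolding shift_down_def isomorphic_def by blast
    obtain \<psi> where "is_iso T U (So W) \<psi>"
      using \<phi> by (rule is_isoE)
    then have "So W \<in> \<A>"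
      using A_isomorphic[OF _ U] unfolding isomorphic_def by blast
    then show ?thesis
      using tri_rotate[OF t] X by blast
  qed
  show "\<exists>X \<in> \<X>. \<exists>A \<in> \<A>. \<exists>a b d. tri A X B a b d" if B: "B \<in> \<A>" for B
  proof -
    obtain X W a b d where W: "W \<in> shift_up T \<A>" and X: "X \<in> \<X>" and t: "tri X B W a b d"
      using B mu(2) unfolding mu_inv_def star_def by blast
    obtain U \<phi> where U: "U \<in> \<A>" and \<phi>: "is_iso T W (So U) \<phi>"
      using W unfolding shift_up_def isomorphic_def by blast
    obtain A f h where t': "tri A X B f a h" and "isomorphic T (So A) W"
      using t by (rule tri_unrotate)
    then obtain \<theta> where \<theta>: "is_iso T (So A) W \<theta>"
      unfolding isomorphic_def by blast
    obtain \<zeta> where \<zeta>: "\<phi> \<cdot> \<theta> \<in> hom T (So A) (So U)" "\<zeta> \<in> hom T (So U) (So A)"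
      "\<zeta> \<cdot> (\<phi> \<cdot> \<theta>) = ident T (So A)" "(\<phi> \<cdot> \<theta>) \<cdot> \<zeta> = ident T (So U)"
      using is_iso_comp[OF \<phi> \<theta>] by (rule is_isoE)
    note [simp] = homD[OF triD(1)[OF t']] A_obj[OF U]
    obtain x where x: "x \<in> hom T A U" "\<phi> \<cdot> \<theta> = Sm x"
      by (rule shift_fullE[OF \<zeta>(1)]) simp_all
    obtain z where z: "z \<in> hom T U A" "\<zeta> = Sm z"
      by (rule shift_fullE[OF \<zeta>(2)]) simp_all
    note [simp] = homD[OF x(1)] homD[OF z(1)]
    have "Sm (z \<cdot> x) = Sm (ident T A)" "Sm (x \<cdot> z) = Sm (ident T U)"
      using \<zeta>(3,4) by (simp_all add: x(2) z(2))
    from shift_cancel[OF this(1)] shift_cancel[OF this(2)]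
    have "z \<cdot> x = ident T A" "x \<cdot> z = ident T U"
      by simp_all
    then have "is_iso T U A z"
      by (intro is_isoI[OF z(1) x(1)])
    then have "A \<in> \<A>"
      using A_isomorphic[OF _ U] unfolding isomorphic_def by blast
    then show ?thesis
      using t' X by blast
  qed
qed

end

section \<open>Recovering the mutation pair\<close>

locale triangulated_subfactor = subcategory_pair +
  fixes S L
  assumes S_choice: "susp_choice T \<X> \<A> S" and L_choice: "loop_choice T \<X> \<A> L"
    and functorially_finite: "functorially_finite T \<X> \<A>"
    and X_rigid: "orthogonal T \<X> (shift_up T \<X>)"
    and epics: "X_epics_have_cocones T \<X> \<A>"
    and triangulated: "subfactor_triangulated T \<X> \<A> S L"
begin

abbreviation Si where "Si \<equiv> susp_ob S"
abbreviation Om where "Om \<equiv> loop_ob L"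
abbreviation gam where "gam A \<equiv> mor3 (S A)"
abbreviation con where "con D \<equiv> mor3 (L D)"

lemma S_triangle:
  assumes A: "A \<in> \<A>"
  shows "tri A (ob2 (S A)) (Si A) (mor1 (S A)) (mor2 (S A)) (gam A)"
    and "left_approximation T \<X> A (ob2 (S A)) (mor1 (S A))" and "ob1 (S A) = A"
proof -
  obtain X a where a: "left_approximation T \<X> A X a"
    using functorially_finite A unfolding functorially_finite_def by blast
  then have "a \<in> hom T A X"
    by (simp add: left_approximation_def)
  then obtain B b d where "tri A X B a b d"
    using TR1_cone by blast
  with a have "susp_triangle T \<X> A (Sextuple A X B a b d)"
    by (simp add: susp_triangle_def)
  then have *: "susp_triangle T \<X> A (S A)"
    using S_choice A unfolding susp_choice_def by blast
  then show "left_approximation T \<X> A (ob2 (S A)) (mor1 (S A))" "ob1 (S A) = A"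
    by (simp_all add: susp_triangle_def)
  have "S A = Sextuple A (ob2 (S A)) (Si A) (mor1 (S A)) (mor2 (S A)) (gam A)"
    using * by (simp add: susp_triangle_def sextuple.expand)
  then show "tri A (ob2 (S A)) (Si A) (mor1 (S A)) (mor2 (S A)) (gam A)"
    using * unfolding susp_triangle_def by simp
qed

lemma L_triangle:
  assumes D: "D \<in> \<A>"
  shows "tri (Om D) (ob2 (L D)) D (mor1 (L D)) (mor2 (L D)) (con D)"
    and "right_approximation T \<X> D (ob2 (L D)) (mor2 (L D))" and "ob3 (L D) = D"
proof -
  obtain X b where b: "right_approximation T \<X> D X b"
    using functorially_finite D unfolding functorially_finite_def by blast
  then have "b \<in> hom T X D"
    by (simp add: right_approximation_def)
  then obtain A a d where "tri A X D a b d"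
    using TR1_cone tri_unrotate by metis
  with b have "loop_triangle T \<X> D (Sextuple A X D a b d)"
    by (simp add: loop_triangle_def)
  then have *: "loop_triangle T \<X> D (L D)"
    using L_choice D unfolding loop_choice_def by blast
  then show "right_approximation T \<X> D (ob2 (L D)) (mor2 (L D))" "ob3 (L D) = D"
    by (simp_all add: loop_triangle_def)
  have "L D = Sextuple (Om D) (ob2 (L D)) D (mor1 (L D)) (mor2 (L D)) (con D)"
    using * by (simp add: loop_triangle_def sextuple.expand)
  then show "tri (Om D) (ob2 (L D)) D (mor1 (L D)) (mor2 (L D)) (con D)"
    using * unfolding loop_triangle_def by simp
qed

lemma S_in_X: "A \<in> \<A> \<Longrightarrow> ob2 (S A) \<in> \<X>" and L_in_X: "A \<in> \<A> \<Longrightarrow> ob2 (L A) \<in> \<X>"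
  using S_triangle(2)[of A] L_triangle(2)[of A]
  by (simp_all add: left_approximation_def right_approximation_def)

lemma adjoint_equivalence_Si_Om:
  "adjoint_equivalence Q Si (susp_mor T \<X> S) Om (loop_mor T \<X> L) (adj_unit T \<X> S L)
    (adj_counit T \<X> S L)"
  using triangulated unfolding subfactor_triangulated_def Let_def by blast

lemma Si_A: "A \<in> \<A> \<Longrightarrow> Si A \<in> \<A>" and Om_A: "A \<in> \<A> \<Longrightarrow> Om A \<in> \<A>"
  using adjoint_equivalence_Si_Om
  unfolding adjoint_equivalence_def adjunction_def lin_endofunctor_def by simp_all

lemma X_shift_X: "\<lbrakk>f \<in> hom T X (So Y); X \<in> \<X>; Y \<in> \<X>\<rbrakk> \<Longrightarrow> f = zero_mor T X (So Y)"
  using orthogonalD[OF X_rigid] shift_in_shift_up X_obj by blast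

lemma connecting_gam_zero:
  assumes A: "A \<in> \<A>" and u: "u \<in> hom T A X" "X \<in> \<X>"
  shows "Sm u \<cdot> gam A = zero_mor T (Si A) (So X)"
proof -
  note t = S_triangle(1)[OF A]
  obtain u' where u': "u' \<in> hom T (ob2 (S A)) X" "u = u' \<cdot> mor1 (S A)"
    using S_triangle(2)[OF A] u unfolding left_approximation_def by blast
  note [simp] = homD[OF triD(1)[OF t]] homD[OF triD(3)[OF t]] homD[OF u'(1)]
  show ?thesis
    by (simp add: u'(2) assoc tri_comp_zero(3)[OF t])
qed

lemma connecting_con_zero:
  assumes A: "A \<in> \<A>" and v: "v \<in> hom T X A" "X \<in> \<X>"
  shows "con A \<cdot> v = zero_mor T X (So (Om A))"
proof -
  note t = L_triangle(1)[OF A]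
  obtain v' where v': "v' \<in> hom T X (ob2 (L A))" "v = mor2 (L A) \<cdot> v'"
    using L_triangle(2)[OF A] v unfolding right_approximation_def by blast
  note [simp] = homD[OF triD(2)[OF t]] homD[OF triD(3)[OF t]] homD[OF v'(1)]
  show ?thesis
    by (simp add: v'(2) comp_reduce[OF tri_comp_zero(2)[OF t]])
qed

lemma unit_retraction:
  assumes A: "A \<in> \<A>"
  obtains \<theta> where "\<theta> \<in> hom T (Om (Si A)) A" "gam A = neg T (Sm \<theta> \<cdot> con (Si A))"
proof -
  note t = S_triangle(1)[OF A] and r = L_triangle(1)[OF Si_A[OF A]]
  note [simp] = homD[OF triD(1)[OF t]] homD[OF triD(3)[OF t]] homD[OF triD(3)[OF r]]
  have unit: "adj_unit T \<X> S L A \<in> hom Q A (Om (Si A))" "is_iso Q A (Om (Si A)) (adj_unit T \<X> S L A)"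
    using adjoint_equivalence_Si_Om A unfolding adjoint_equivalence_def adjunction_def by simp_all
  obtain \<psi>0 where \<psi>0: "\<psi>0 \<in> hom T A (Om (Si A))" "adj_unit T \<X> S L A = cl \<psi>0"
    using unit(1) by (rule hom_QE)
  have "\<psi>0 \<in> adj_unit T \<X> S L A"
    using in_cl_self[OF \<psi>0(1)] \<psi>0(2) by simp
  then obtain \<psi> g where \<psi>_cl: "\<psi>0 \<in> cl \<psi>"
    and m: "triangle_morphism T (S A) (L (Si A)) \<psi> g (neg T (ident T (Si A)))"
    unfolding adj_unit_def by blast
  have \<psi>: "\<psi> \<in> hom T A (Om (Si A))" "Sm \<psi> \<cdot> gam A = neg T (con (Si A))"
    using m S_triangle(3)[OF A] by (simp_all add: right_morphism_def scale_comp)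
  have "is_iso Q A (Om (Si A)) (cl \<psi>)"
    using unit(2) \<psi>_cl unfolding \<psi>0(2) cl_eq_iff[OF \<psi>(1), symmetric] by simp
  then obtain \<theta> where \<theta>: "\<theta> \<in> hom T (Om (Si A)) A" "cl (\<theta> \<cdot> \<psi>) = cl (ident T A)"
    using is_iso_Q_iff[OF \<psi>(1) A Om_A[OF Si_A[OF A]]] by blast
  obtain n where n: "n \<in> hom T A A" "null n" "\<theta> \<cdot> \<psi> = ident T A \<oplus> n"
    by (rule cl_eqE[OF \<theta>(2) ident_hom]) simp_all
  obtain X u v where uv: "X \<in> \<X>" "u \<in> hom T A X" "v \<in> hom T X A" "n = v \<cdot> u"
    using n(2,1) by (rule nullE)
  note [simp] = homD[OF \<theta>(1)] homD[OF \<psi>(1)] homD[OF uv(2)] homD[OF uv(3)]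
  have "Sm n \<cdot> gam A = zero_mor T (Si A) (So A)"
    by (simp add: uv(4) assoc connecting_gam_zero[OF A uv(2,1)])
  then have "gam A = (ident T (So A) \<oplus> Sm n) \<cdot> gam A"
    using homD[OF n(1)] by (simp add: comp_add)
  also have "ident T (So A) \<oplus> Sm n = Sm (\<theta> \<cdot> \<psi>)"
    unfolding n(3) using homD[OF n(1)] by simp
  also have "Sm (\<theta> \<cdot> \<psi>) \<cdot> gam A = neg T (Sm \<theta> \<cdot> con (Si A))"
    by (simp add: assoc \<psi>(2) scale_comp)
  finally show thesis
    by (rule that[OF \<theta>(1)])
qed

lemma counit_section:
  assumes D: "D \<in> \<A>"
  obtains \<theta> where "\<theta> \<in> hom T D (Si (Om D))" "con D = neg T (gam (Om D) \<cdot> \<theta>)"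
proof -
  note t = S_triangle(1)[OF Om_A[OF D]] and r = L_triangle(1)[OF D]
  note [simp] = homD[OF triD(3)[OF t]] homD[OF triD(1)[OF r]] homD[OF triD(3)[OF r]]
  have counit: "adj_counit T \<X> S L D \<in> hom Q (Si (Om D)) D"
    "is_iso Q (Si (Om D)) D (adj_counit T \<X> S L D)"
    using adjoint_equivalence_Si_Om D unfolding adjoint_equivalence_def adjunction_def by simp_all
  obtain \<phi>0 where \<phi>0: "\<phi>0 \<in> hom T (Si (Om D)) D" "adj_counit T \<X> S L D = cl \<phi>0"
    using counit(1) by (rule hom_QE)
  have "\<phi>0 \<in> adj_counit T \<X> S L D"
    using in_cl_self[OF \<phi>0(1)] \<phi>0(2) by simp
  then obtain \<phi> g where \<phi>_cl: "\<phi>0 \<in> cl \<phi>"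
    and m: "triangle_morphism T (S (Om D)) (L D) (neg T (ident T (Om D))) g \<phi>"
    unfolding adj_counit_def by blast
  have \<phi>: "\<phi> \<in> hom T (Si (Om D)) D" "con D \<cdot> \<phi> = neg T (gam (Om D))"
    using m L_triangle(3)[OF D] by (simp_all add: right_morphism_def scale_comp)
  have "is_iso Q (Si (Om D)) D (cl \<phi>)"
    using counit(2) \<phi>_cl unfolding \<phi>0(2) cl_eq_iff[OF \<phi>(1), symmetric] by simp
  then obtain \<theta> where \<theta>: "\<theta> \<in> hom T D (Si (Om D))" "cl (\<phi> \<cdot> \<theta>) = cl (ident T D)"
    using is_iso_Q_iff[OF \<phi>(1) Si_A[OF Om_A[OF D]] D] by blast
  obtain n where n: "n \<in> hom T D D" "null n" "\<phi> \<cdot> \<theta> = ident T D \<oplus> n"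
    by (rule cl_eqE[OF \<theta>(2) ident_hom]) simp_all
  obtain X u v where uv: "X \<in> \<X>" "u \<in> hom T D X" "v \<in> hom T X D" "n = v \<cdot> u"
    using n(2,1) by (rule nullE)
  note [simp] = homD[OF \<theta>(1)] homD[OF \<phi>(1)] homD[OF uv(2)] homD[OF uv(3)]
  have "con D \<cdot> n = zero_mor T D (So (Om D))"
    by (simp add: uv(4) comp_reduce[OF connecting_con_zero[OF D uv(3,1)]])
  then have "con D = con D \<cdot> (ident T D \<oplus> n)"
    using homD[OF n(1)] by (simp add: comp_add)
  also have "\<dots> = neg T (gam (Om D) \<cdot> \<theta>)"
    unfolding n(3)[symmetric] by (simp add: comp_reduce[OF \<phi>(2)] scale_comp)
  finally show thesis
    by (rule that[OF \<theta>(1)])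
qed

lemma X_shift_A:
  assumes f: "f \<in> hom T X (So A)" and X: "X \<in> \<X>" and A: "A \<in> \<A>"
  shows "f = zero_mor T X (So A)"
proof -
  note t = S_triangle(1)[OF A] and r = L_triangle(1)[OF Si_A[OF A]]
  note [simp] = homD[OF f] homD[OF triD(1)[OF t]] homD[OF triD(3)[OF t]] homD[OF triD(3)[OF r]]
  have "Sm (mor1 (S A)) \<cdot> f = zero_mor T X (So (ob2 (S A)))"
    by (rule X_shift_X[OF _ X S_in_X[OF A]]) (simp add: hom_iff)
  then obtain x where x: "x \<in> hom T X (Si A)" "f = gam A \<cdot> x"
    by (rule tri_lift_shift[OF t f])
  obtain \<theta> where \<theta>: "\<theta> \<in> hom T (Om (Si A)) A" "gam A = neg T (Sm \<theta> \<cdot> con (Si A))"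
    using A by (rule unit_retraction)
  note [simp] = homD[OF x(1)] homD[OF \<theta>(1)]
  have "(Sm \<theta> \<cdot> con (Si A)) \<cdot> x = zero_mor T X (So A)"
    by (simp add: assoc connecting_con_zero[OF Si_A[OF A] x(1) X])
  then show ?thesis
    unfolding x(2) by (subst \<theta>(2)) (simp add: scale_comp)
qed

lemma A_shift_X:
  assumes f: "f \<in> hom T A (So X)" and A: "A \<in> \<A>" and X: "X \<in> \<X>"
  shows "f = zero_mor T A (So X)"
proof -
  note t = S_triangle(1)[OF Om_A[OF A]] and r = L_triangle(1)[OF A]
  note [simp] = homD[OF f] homD[OF triD(3)[OF t]] homD[OF triD(1)[OF r]] homD[OF triD(2)[OF r]]
    homD[OF triD(3)[OF r]] X_obj[OF X]
  have "f \<cdot> mor2 (L A) = zero_mor T (ob2 (L A)) (So X)"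
    by (rule X_shift_X[OF _ L_in_X[OF A] X]) (simp add: hom_iff)
  then obtain y where y: "y \<in> hom T (So (Om A)) (So X)" "f = y \<cdot> con A"
    by (rule tri_colift_third[OF r f])
  obtain x where x: "x \<in> hom T (Om A) X" "y = Sm x"
    by (rule shift_fullE[OF y(1)]) simp_all
  obtain \<theta> where \<theta>: "\<theta> \<in> hom T A (Si (Om A))" "con A = neg T (gam (Om A) \<cdot> \<theta>)"
    using A by (rule counit_section)
  note [simp] = homD[OF x(1)] homD[OF \<theta>(1)]
  have "Sm x \<cdot> (gam (Om A) \<cdot> \<theta>) = zero_mor T A (So X)"
    by (simp add: comp_reduce[OF connecting_gam_zero[OF Om_A[OF A] x(1) X]])
  then show ?thesis
    unfolding y(2) x(2) by (subst \<theta>(2)) (simp add: scale_comp)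
qed

lemma A_mutation_pair: "mutation_pair T \<X> \<A> \<A>"
  unfolding mutation_pair_def
proof (intro conjI X_rigid X_subset subsetI)
  fix A
  assume A: "A \<in> \<A>"
  note t = S_triangle(1)[OF A] and r = L_triangle(1)[OF A]
  have [simp]: "A \<in> obj T"
    using A A_obj by simp
  obtain W f h where W: "tri W A (ob2 (S A)) f (mor1 (S A)) h" "isomorphic T (So W) (Si A)"
    using t by (rule tri_unrotate)
  have "W \<in> obj T"
    using hom_obj[OF triD(1)[OF W(1)]] by simp
  then have "W \<in> shift_down T \<A>"
    using W(2) Si_A[OF A] unfolding shift_down_def by blast
  then have 1: "A \<in> star T (shift_down T \<A>) \<X>"
    using W(1) S_in_X[OF A] unfolding star_def by blast
  have "g = zero_mor T V A" if g: "g \<in> hom T V A" and V: "V \<in> shift_down T \<X>" for g V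
  proof -
    obtain X where X: "X \<in> \<X>" and "isomorphic T (So V) X"
      using V unfolding shift_down_def by blast
    then obtain \<phi> where "is_iso T (So V) X \<phi>"
      unfolding isomorphic_def by blast
    then obtain \<psi> where \<phi>: "\<phi> \<in> hom T (So V) X" and \<psi>: "\<psi> \<in> hom T X (So V)"
      and inv: "\<psi> \<cdot> \<phi> = ident T (So V)"
      by (rule is_isoE)
    note [simp] = homD[OF g] homD[OF \<phi>] homD[OF \<psi>]
    have "Sm g \<cdot> \<psi> = zero_mor T X (So A)"
      by (rule X_shift_A[OF _ X A]) (simp add: hom_iff)
    then have "Sm g \<cdot> (\<psi> \<cdot> \<phi>) = zero_mor T (So V) (So A)"
      by (simp add: comp_reduce)
    then have "Sm g = Sm (zero_mor T V A)"
      by (simp add: inv)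
    then show ?thesis
      by (rule shift_cancel) simp_all
  qed
  then have "orthogonal T (shift_down T \<X>) {A}"
    using zero_hom unfolding orthogonal_def shift_down_def by auto
  then show "A \<in> mu T \<A> \<X>"
    using 1 unfolding mu_def right_perp_def by simp
  have "So (Om A) \<in> shift_up T \<A>"
    using A_obj[OF Om_A[OF A]] Om_A[OF A] by (rule shift_in_shift_up)
  then have 2: "A \<in> star T \<X> (shift_up T \<A>)"
    using tri_rotate[OF r] L_in_X[OF A] unfolding star_def by blast
  have "g = zero_mor T A V" if g: "g \<in> hom T A V" and V: "V \<in> shift_up T \<X>" for g V
  proof -
    obtain X where X: "X \<in> \<X>" and "isomorphic T V (So X)"
      using V unfolding shift_up_def by blast
    then obtain \<phi> where "is_iso T V (So X) \<phi>"
      unfolding isomorphic_def by blast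
    then obtain \<psi> where \<phi>: "\<phi> \<in> hom T V (So X)" and \<psi>: "\<psi> \<in> hom T (So X) V"
      and inv: "\<psi> \<cdot> \<phi> = ident T V"
      by (rule is_isoE)
    note [simp] = homD[OF g] homD[OF \<phi>] homD[OF \<psi>]
    have "\<phi> \<cdot> g = zero_mor T A (So X)"
      by (rule A_shift_X[OF _ A X]) (simp add: hom_iff)
    then have "(\<psi> \<cdot> \<phi>) \<cdot> g = zero_mor T A V"
      by (simp add: assoc)
    then show ?thesis
      by (simp add: inv)
  qed
  then have "orthogonal T {A} (shift_up T \<X>)"
    using zero_hom unfolding orthogonal_def shift_up_def by auto
  then show "A \<in> mu_inv T \<A> \<X>"
    using 2 unfolding mu_inv_def left_perp_def by simp
qed

text \<open>The class \<open>d\<close> of the extension lifts to \<open>w : A1 \<rightarrow> \<Sigma>A2\<close>. Adding the approximation \<open>\<beta>\<close> turns \<open>w\<close>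
  into an \<open>\<X>\<close>-epimorphism \<open>A1 \<oplus> X \<rightarrow> \<Sigma>A2\<close>; an octahedron shows that \<open>B\<close> is a direct summand of the
  sum of its cocone and \<open>X\<close>.\<close>

lemma A_extension_closed: "extension_closed T \<A>"
  unfolding extension_closed_def
proof (intro allI impI)
  fix A2 B A1 f g d
  assume s: "tri A2 B A1 f g d" and A: "A1 \<in> \<A>" "A2 \<in> \<A>"
  define X C \<alpha> \<beta> \<gamma> where
    defs: "X = ob2 (S A2)" "C = Si A2" "\<alpha> = mor1 (S A2)" "\<beta> = mor2 (S A2)" "\<gamma> = gam A2"
  have t: "tri A2 X C \<alpha> \<beta> \<gamma>" and X: "X \<in> \<X>" and C: "C \<in> \<A>"
    using S_triangle(1)[OF A(2)] S_in_X[OF A(2)] Si_A[OF A(2)] by (simp_all add: defs)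
  note [simp] = homD[OF triD(1)[OF s]] homD[OF triD(2)[OF s]] homD[OF triD(3)[OF s]]
    homD[OF triD(1)[OF t]] homD[OF triD(2)[OF t]] homD[OF triD(3)[OF t]]
  have "Sm \<alpha> \<cdot> d = zero_mor T A1 (So X)"
    by (rule A_shift_X[OF _ A(1) X]) (simp add: hom_iff)
  then obtain w where w: "w \<in> hom T A1 C" "d = \<gamma> \<cdot> w"
    by (rule tri_lift_shift[OF t triD(3)[OF s]])
  obtain P where P: "direct_sum T P A1 X"
    using ex_direct_sum A_obj[OF A(1)] X_obj[OF X] by blast
  then obtain i j p q where i: "i \<in> hom T A1 P" and j: "j \<in> hom T X P" and p: "p \<in> hom T P A1"
    and q: "q \<in> hom T P X" and pi: "p \<cdot> i = ident T A1" "q \<cdot> j = ident T X"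
      "p \<cdot> j = zero_mor T X A1"
    unfolding direct_sum_def by blast
  have P_A: "P \<in> \<A>"
    by (rule A_direct_sum[OF P A(1) X_in_A[OF X]])
  note [simp] = homD[OF w(1)] homD[OF i] homD[OF j] homD[OF p] homD[OF q]
  define e where "e = w \<cdot> p \<oplus> \<beta> \<cdot> q"
  have e: "e \<in> hom T P C" and ej: "e \<cdot> j = \<beta>"
    by (simp_all add: e_def hom_iff comp_add assoc pi)
  note [simp] = homD[OF e]
  have e_epic: "X_epic T \<X> P C e"
    unfolding X_epic_def
  proof (intro conjI ballI e equalityI image_subsetI subsetI)
    show "e \<cdot> \<phi> \<in> hom T Y C" if "\<phi> \<in> hom T Y P" for \<phi> Y
      by (rule comp_hom[OF e that])
    fix Y x
    assume Y: "Y \<in> \<X>" and x: "x \<in> hom T Y C"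
    note [simp] = homD[OF x]
    have "\<gamma> \<cdot> x = zero_mor T Y (So A2)"
      by (rule X_shift_A[OF _ Y A(2)]) (simp add: hom_iff)
    then obtain y where y: "y \<in> hom T Y X" "x = \<beta> \<cdot> y"
      by (rule tri_lift_third[OF t x])
    note [simp] = homD[OF y(1)]
    have "x = e \<cdot> (j \<cdot> y)"
      by (simp add: y(2) comp_reduce[OF ej])
    moreover have "j \<cdot> y \<in> hom T Y P"
      by (simp add: hom_iff)
    ultimately show "x \<in> (\<lambda>\<phi>. e \<cdot> \<phi>) ` hom T Y P"
      by blast
  qed
  obtain E m n where "tri P C E e m n"
    using TR1_cone[OF e] by blast
  then obtain K k h where K: "tri K P C k e h"
    by (rule tri_unrotate)
  have K_A: "K \<in> \<A>"
    using epics P_A C e_epic K unfolding X_epics_have_cocones_def by blast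
  have \<gamma>e: "\<gamma> \<cdot> e = d \<cdot> p"
    by (simp add: e_def comp_add w(2) assoc comp_reduce[OF tri_comp_zero(2)[OF t]])
  obtain M f' g' where M: "tri A2 M P f' g' (neg T (\<gamma> \<cdot> e))"
    by (rule tri_cocone[of "neg T (\<gamma> \<cdot> e)" P A2]) (simp_all add: hom_iff)
  note [simp] = homD[OF triD(3)[OF K]] homD[OF triD(1)[OF M]] homD[OF triD(2)[OF M]]
  obtain u v where uv: "tri K M X u v (h \<cdot> \<beta>)"
    by (rule octahedron_cocone[OF t K M])
  have "h \<cdot> \<beta> = zero_mor T X (So K)"
    by (rule X_shift_A[OF _ X K_A]) (simp add: hom_iff)
  then have "direct_sum T M K X"
    using uv tri_split_direct_sum by metis
  then have M_A: "M \<in> \<A>"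
    by (rule A_direct_sum[OF _ K_A X_in_A[OF X]])
  have M': "tri A2 M P (neg T f') g' (d \<cdot> p)"
    using tri_neg(3)[OF M] by (simp add: \<gamma>e)
  have a: "ident T A2 \<in> hom T A2 A2"
    by (simp add: hom_iff)
  obtain b where b: "b \<in> hom T B M" "b \<cdot> f = neg T f' \<cdot> ident T A2" "i \<cdot> g = g' \<cdot> b"
    by (rule tri_fill_second[OF s M' a i]) (simp_all add: assoc pi)
  obtain c where c: "c \<in> hom T M B" "c \<cdot> neg T f' = f \<cdot> ident T A2" "p \<cdot> g' = g \<cdot> c"
    by (rule tri_fill_second[OF M' s a p]) simp_all
  note [simp] = homD[OF b(1)] homD[OF c(1)]
  have "is_iso T B B (c \<cdot> b)"
  proof (rule tri_endo_iso[OF s])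
    show "(c \<cdot> b) \<cdot> f = f"
      using b(2) c(2) by (simp add: assoc)
    show "g \<cdot> (c \<cdot> b) = g"
      using b(3) by (simp add: comp_reduce[OF c(3)[symmetric]] assoc comp_reduce[OF pi(1)] b(3)[symmetric])
  qed (simp add: hom_iff)
  then obtain r where r: "r \<in> hom T B B" "r \<cdot> (c \<cdot> b) = ident T B"
    by (rule is_isoE)
  note [simp] = homD[OF r(1)]
  have "\<exists>D. direct_sum T M B D"
    by (rule retract_direct_sum[of b B M "r \<cdot> c"]) (use r(2) in \<open>simp_all add: hom_iff assoc\<close>)
  then show "B \<in> \<A>"
    using A_summand M_A by blast
qed

end

theorem theorem2p13:
  fixes T :: "('k::field, 'o, 'm) tri_category"
    and \<X> \<A> :: "'o set"
    and S L :: "'o \<Rightarrow> ('o, 'm) sextuple"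
  assumes "triangulated_category T" and "hom_finite T" and "krull_schmidt T"
    and "subcategory T \<X>" and "subcategory T \<A>" and "\<X> \<subseteq> \<A>"
    and "susp_choice T \<X> \<A> S" and "loop_choice T \<X> \<A> L"
  shows "(extension_closed T \<A> \<and> mutation_pair T \<X> \<A> \<A>) \<longleftrightarrow>
    (functorially_finite T \<X> \<A> \<and> orthogonal T \<X> (shift_up T \<X>) \<and>
     X_monics_have_cones T \<X> \<A> \<and> X_epics_have_cocones T \<X> \<A> \<and>
     subfactor_triangulated T \<X> \<A> S L)"
proof -
  have pair: "subcategory_pair T \<X> \<A>"
    using assms(1,4-6) by (simp add: subcategory_pair_def subcategory_pair_axioms_def)
  show ?thesis
  proof
    assume a: "extension_closed T \<A> \<and> mutation_pair T \<X> \<A> \<A>"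
    then have "frobenius_pair T \<X> \<A>"
      by (intro subcategory_pair.frobenius_pair_if_mutation_pair[OF pair]) simp_all
    then interpret frobenius_choice T \<X> \<A> S L
      using assms(7,8) by (simp add: frobenius_choice_def frobenius_choice_axioms_def)
    have "orthogonal T \<X> (shift_up T \<X>)"
      using a by (simp add: mutation_pair_def)
    then show "functorially_finite T \<X> \<A> \<and> orthogonal T \<X> (shift_up T \<X>) \<and>
      X_monics_have_cones T \<X> \<A> \<and> X_epics_have_cocones T \<X> \<A> \<and>
      subfactor_triangulated T \<X> \<A> S L"
      using X_functorially_finite cones_in_A cocones_in_A subfactor_triangulated_S_L by simp
  next
    assume "functorially_finite T \<X> \<A> \<and> orthogonal T \<X> (shift_up T \<X>) \<and>
      X_monics_have_cones T \<X> \<A> \<and> X_epics_have_cocones T \<X> \<A> \<and>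
      subfactor_triangulated T \<X> \<A> S L"
    then interpret triangulated_subfactor T \<X> \<A> S L
      using pair assms(7,8)
      by (simp add: triangulated_subfactor_def triangulated_subfactor_axioms_def)
    show "extension_closed T \<A> \<and> mutation_pair T \<X> \<A> \<A>"
      using A_extension_closed A_mutation_pair by simp
  qed
qed

end
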